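(* Let $(A,\circ_A,[\cdot,\cdot]_A)$ and $(A^\ast,\circ_{A^\ast},[\cdot,\cdot]_{A^\ast})$ be Gel'fand-Dorfman algebras, where $A^\ast$ is the dual space of $A$, and let $\mathbf{k}[\partial]A$ and $\mathbf{k}[\partial]A^\ast$ be the corresponding Lie conformal algebras. Then there is a Lie conformal algebra structure on $\mathbf{k}[\partial](A\oplus A^\ast)$ for which $(\mathbf{k}[\partial](A\oplus A^\ast),\mathbf{k}[\partial]A,\mathbf{k}[\partial]A^\ast)$ is a conformal Manin triple with the conformal bilinear form determined by $$\langle a+f,b+g\rangle_\lambda=\langle f,b\rangle+\langle g,a\rangle,\qquad a,b\in A,\ f,g\in A^\ast,$$ if and only if there is a Gel'fand-Dorfman algebra structure on $A\oplus A^\ast$ for which $(A\oplus A^\ast,(A,\circ_A,[\cdot,\cdot]_A),(A^\ast,\circ_{A^\ast},[\cdot,\cdot]_{A^\ast}))$ is a Manin triple of Gel'fand-Dorfman algebras associated with the bilinear form $$(a+f,b+g)=\langle f,b\rangle+\langle g,a\rangle,\qquad a,b\in A,\ f,g\in A^\ast.$$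
   Context: Conventions: $\mathbf{k}$ is a field of characteristic $0$; vector spaces over $\mathbf{k}$ are finite-dimensional; $a\star b=a\circ b+b\circ a$; $\mathbf{k}[\partial]A=\mathbf{k}[\partial]\otimes_{\mathbf{k}}A$. A Novikov algebra $(A,\circ)$ satisfies $(a\circ b)\circ c-a\circ(b\circ c)=(b\circ a)\circ c-b\circ(a\circ c)$ and $(a\circ b)\circ c=(a\circ c)\circ b$. A Gel'fand-Dorfman (GD) algebra $(A,\circ,[\cdot,\cdot])$ is a Novikov algebra $(A,\circ)$ and a Lie algebra $(A,[\cdot,\cdot])$ with $[a\circ b,c]-[a\circ c,b]+[a,b]\circ c-[a,c]\circ b-a\circ[b,c]=0$ for all $a,b,c$. A (standard) Manin triple of GD algebras is a triple $(A\oplus A^\ast,(A,\circ_A,[\cdot,\cdot]_A),(A^\ast,\circ_{A^\ast},[\cdot,\cdot]_{A^\ast}))$ of GD algebras where the vector space direct sum $A\oplus A^\ast$ carries a GD algebra structure containing $A$ and $A^\ast$ as GD subalgebras, such that the bilinear form $(a+f,b+g)=\langle f,b\rangle+\langle g,a\rangle$ is invariant: $(x\circ y,z)=-(y,x\star z)$ and $([x,y],z)=(x,[y,z])$ for all $x,y,z$. A Lie conformal algebra is a $\mathbf{k}[\partial]$-module $R$ with a $\mathbf{k}$-bilinear map $[\cdot_\lambda\cdot]:R\times R\to R[\lambda]$ such that $[\partial a_\lambda b]=-\lambda[a_\lambda b]$, $[a_\lambda\partial b]=(\lambda+\partial)[a_\lambda b]$, $[a_\lambda b]=-[b_{-\lambda-\partial}a]$,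 $[a_\lambda[b_\mu c]]=[[a_\lambda b]_{\lambda+\mu}c]+[b_\mu[a_\lambda c]]$. The Lie conformal algebra corresponding to a GD algebra $(A,\circ,[\cdot,\cdot])$ is $\mathbf{k}[\partial]A$ with $[a_\lambda b]=\partial(b\circ a)+\lambda(a\star b)+[a,b]$ for $a,b\in A$, extended by the first two identities. A conformal bilinear form on a $\mathbf{k}[\partial]$-module $V$ is a $\mathbf{k}$-bilinear map $\langle\cdot,\cdot\rangle_\lambda:V\times V\to\mathbf{k}[\lambda]$ with $\langle\partial u,v\rangle_\lambda=-\lambda\langle u,v\rangle_\lambda=-\langle u,\partial v\rangle_\lambda$. It is symmetric if $\langle u,v\rangle_\lambda=\langle v,u\rangle_{-\lambda}$; invariant (on a Lie conformal algebra) if $\langle[a_\mu b],c\rangle_\lambda=\langle a,[b_{\lambda-\partial}c]\rangle_\mu$; nondegenerate if $v\mapsto L_v$, $(L_v)_\lambda u=\langle v,u\rangle_\lambda$, is an isomorphism $V\to V^{\ast c}$, where $V^{\ast c}$ is the space of $\mathbf{k}$-linear maps $f_\lambda:V\to\mathbf{k}[\lambda]$ with $f_\lambda(\partial b)=\lambda f_\lambda(b)$ and $(\partial f)_\lambda=-\lambda f_\lambda$. A conformal Manin triple is a triple $(R,R_0,R_1)$ of finite Lie conformal algebras, where $R$ carries a nondegenerate invariant symmetric conformal bilinear form, $R_0,R_1$ are Lie conformal subalgebras with $R=R_0\oplus R_1$ as $\mathbf{k}[\partial]$-modules, and $\langle R_i,R_i\rangle_\lambda=0$ for $i=0,1$.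 *)

theory Defs
  imports
    "HOL-Computational_Algebra.Polynomial"
    "HOL-Library.Function_Algebras"
    "HOL-Library.Product_Plus"
    "HOL-Library.FuncSet"
begin

text \<open>
  Vector spaces and modules are subspaces of an ambient type carrying a scalar
  multiplication; operations are functions on the whole type whose values outside
  the carrier are irrelevant.
\<close>

definition linear_on ::
  "('k \<Rightarrow> 'u \<Rightarrow> 'u) \<Rightarrow> ('k \<Rightarrow> 'w \<Rightarrow> 'w) \<Rightarrow> 'u set \<Rightarrow> ('u::plus \<Rightarrow> 'w::plus) \<Rightarrow> bool" where
  "linear_on s s' V f \<longleftrightarrow>
     (\<forall>x\<in>V. \<forall>y\<in>V. f (x + y) = f x + f y) \<and> (\<forall>c. \<forall>x\<in>V. f (s c x) = s' c (f x))"

definition bilinear_on ::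
  "('k \<Rightarrow> 'u \<Rightarrow> 'u) \<Rightarrow> ('k \<Rightarrow> 'w \<Rightarrow> 'w) \<Rightarrow> 'u set \<Rightarrow> ('u::plus \<Rightarrow> 'u \<Rightarrow> 'w::plus) \<Rightarrow> bool" where
  "bilinear_on s s' V b \<longleftrightarrow>
     (\<forall>x\<in>V. linear_on s s' V (\<lambda>y. b x y) \<and> linear_on s s' V (\<lambda>y. b y x))"


section \<open>Gel'fand-Dorfman algebras\<close>

locale novikov_algebra = vector_space scale
  for scale :: "'k::field \<Rightarrow> 'v::ab_group_add \<Rightarrow> 'v" +
  fixes V :: "'v set" and circ :: "'v \<Rightarrow> 'v \<Rightarrow> 'v"
  assumes subspace_carrier: "subspace V"
    and circ_closed: "\<lbrakk>a \<in> V; b \<in> V\<rbrakk> \<Longrightarrow> circ a b \<in> V"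
    and circ_bilinear: "bilinear_on scale scale V circ"
    and left_symmetric: "\<lbrakk>a \<in> V; b \<in> V; c \<in> V\<rbrakk> \<Longrightarrow>
      circ (circ a b) c - circ a (circ b c) = circ (circ b a) c - circ b (circ a c)"
    and right_commutative: "\<lbrakk>a \<in> V; b \<in> V; c \<in> V\<rbrakk> \<Longrightarrow>
      circ (circ a b) c = circ (circ a c) b"

locale lie_algebra = vector_space scale
  for scale :: "'k::field \<Rightarrow> 'v::ab_group_add \<Rightarrow> 'v" +
  fixes V :: "'v set" and br :: "'v \<Rightarrow> 'v \<Rightarrow> 'v"
  assumes subspace_carrier: "subspace V"
    and br_closed: "\<lbrakk>a \<in> V; b \<in> V\<rbrakk> \<Longrightarrow> br a b \<in> V"
    and br_bilinear: "bilinear_on scale scale V br"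
    and br_self: "a \<in> V \<Longrightarrow> br a a = 0"
    and br_jacobi: "\<lbrakk>a \<in> V; b \<in> V; c \<in> V\<rbrakk> \<Longrightarrow>
      br a (br b c) + br b (br c a) + br c (br a b) = 0"

locale gd_algebra = novikov_algebra scale V circ + lie: lie_algebra scale V br
  for scale :: "'k::field \<Rightarrow> 'v::ab_group_add \<Rightarrow> 'v" and V circ br +
  assumes gd_compatible: "\<lbrakk>a \<in> V; b \<in> V; c \<in> V\<rbrakk> \<Longrightarrow>
      br (circ a b) c - br (circ a c) b + circ (br a b) c - circ (br a c) b
        - circ a (br b c) = 0"

definition star :: "('v \<Rightarrow> 'v \<Rightarrow> 'v) \<Rightarrow> 'v \<Rightarrow> 'v \<Rightarrow> 'v::plus" where
  "star circ a b = circ a b + circ b a"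


section \<open>The space \<open>A \<oplus> A\<^sup>*\<close> and Manin triples of GD algebras\<close>

definition fun_scale :: "'k::field \<Rightarrow> ('a \<Rightarrow> 'k) \<Rightarrow> 'a \<Rightarrow> 'k" where
  "fun_scale c f = (\<lambda>x. c * f x)"

definition dual :: "('k::field \<Rightarrow> 'a::ab_group_add \<Rightarrow> 'a) \<Rightarrow> ('a \<Rightarrow> 'k) set" where
  "dual s = {f. Vector_Spaces.linear s (*) f}"

definition double_scale ::
  "('k::field \<Rightarrow> 'a \<Rightarrow> 'a) \<Rightarrow> 'k \<Rightarrow> 'a \<times> ('a \<Rightarrow> 'k) \<Rightarrow> 'a \<times> ('a \<Rightarrow> 'k)" where
  "double_scale s c = map_prod (s c) (fun_scale c)"

definition double_space ::
  "('k::field \<Rightarrow> 'a::ab_group_add \<Rightarrow> 'a) \<Rightarrow> ('a \<times> ('a \<Rightarrow> 'k)) set" where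
  "double_space s = UNIV \<times> dual s"

definition in_A :: "'a \<Rightarrow> 'a \<times> ('a \<Rightarrow> 'k::zero)" where
  "in_A a = (a, 0)"

definition in_dual :: "('a \<Rightarrow> 'k) \<Rightarrow> 'a::zero \<times> ('a \<Rightarrow> 'k)" where
  "in_dual f = (0, f)"

definition double_form :: "'a \<times> ('a \<Rightarrow> 'k) \<Rightarrow> 'a \<times> ('a \<Rightarrow> 'k) \<Rightarrow> 'k::plus" where
  "double_form x y = (snd x) (fst y) + (snd y) (fst x)"

definition gd_invariant ::
  "'v set \<Rightarrow> ('v \<Rightarrow> 'v \<Rightarrow> 'v::plus) \<Rightarrow> ('v \<Rightarrow> 'v \<Rightarrow> 'v) \<Rightarrow> ('v \<Rightarrow> 'v \<Rightarrow> 'k::uminus) \<Rightarrow> bool" where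
  "gd_invariant V circ br form \<longleftrightarrow>
     (\<forall>x\<in>V. \<forall>y\<in>V. \<forall>z\<in>V.
        form (circ x y) z = - form y (star circ x z) \<and>
        form (br x y) z = form x (br y z))"

definition gd_manin_triple ::
  "('k::field \<Rightarrow> 'a::ab_group_add \<Rightarrow> 'a) \<Rightarrow>
   ('a \<times> ('a \<Rightarrow> 'k) \<Rightarrow> 'a \<times> ('a \<Rightarrow> 'k) \<Rightarrow> 'a \<times> ('a \<Rightarrow> 'k)) \<Rightarrow>
   ('a \<times> ('a \<Rightarrow> 'k) \<Rightarrow> 'a \<times> ('a \<Rightarrow> 'k) \<Rightarrow> 'a \<times> ('a \<Rightarrow> 'k)) \<Rightarrow>
   ('a \<Rightarrow> 'a \<Rightarrow> 'a) \<Rightarrow> ('a \<Rightarrow> 'a \<Rightarrow> 'a) \<Rightarrow>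
   (('a \<Rightarrow> 'k) \<Rightarrow> ('a \<Rightarrow> 'k) \<Rightarrow> ('a \<Rightarrow> 'k)) \<Rightarrow>
   (('a \<Rightarrow> 'k) \<Rightarrow> ('a \<Rightarrow> 'k) \<Rightarrow> ('a \<Rightarrow> 'k)) \<Rightarrow> bool" where
  "gd_manin_triple s circ br circ\<^sub>A br\<^sub>A circ\<^sub>D br\<^sub>D \<longleftrightarrow>
     gd_algebra s UNIV circ\<^sub>A br\<^sub>A \<and>
     gd_algebra fun_scale (dual s) circ\<^sub>D br\<^sub>D \<and>
     gd_algebra (double_scale s) (double_space s) circ br \<and>
     (\<forall>a b. circ (in_A a) (in_A b) = in_A (circ\<^sub>A a b) \<and>
            br (in_A a) (in_A b) = in_A (br\<^sub>A a b)) \<and>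
     (\<forall>f\<in>dual s. \<forall>g\<in>dual s. circ (in_dual f) (in_dual g) = in_dual (circ\<^sub>D f g) \<and>
            br (in_dual f) (in_dual g) = in_dual (br\<^sub>D f g)) \<and>
     gd_invariant (double_space s) circ br double_form"


section \<open>Polynomials with coefficients in a module\<close>

text \<open>
  The type \<open>'v poly\<close> with \<open>'v\<close> an additive group serves both as \<open>V[\<lambda>]\<close> and as
  \<open>k[\<partial>] \<otimes> V\<close>.  In either case \<open>pCons 0\<close> is multiplication by the variable.
\<close>

definition polys_over :: "'v::zero set \<Rightarrow> 'v poly set" where
  "polys_over V = {p. \<forall>n. coeff p n \<in> V}"

text \<open>The action of \<open>k[\<partial>]\<close> on \<open>k[\<partial>] \<otimes> V\<close>.\<close>

definition poly_scale ::
  "('k::field \<Rightarrow> 'v \<Rightarrow> 'v) \<Rightarrow> 'k poly \<Rightarrow> 'v poly \<Rightarrow> 'v::ab_group_add poly" where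
  "poly_scale s p q =
     (\<Sum>i\<le>degree p. \<Sum>j\<le>degree q. monom (s (coeff p i) (coeff q j)) (i + j))"

text \<open>
  \<open>subst_var T e p\<close> is \<open>\<Sum>n. T^n (e (p_n))\<close>: the variable of \<open>p\<close> is replaced by the
  operator \<open>T\<close>, and the map \<open>e\<close> is applied to the coefficients.
\<close>

definition subst_var ::
  "('s \<Rightarrow> 's) \<Rightarrow> ('r \<Rightarrow> 's) \<Rightarrow> 'r::zero poly \<Rightarrow> 's::comm_monoid_add" where
  "subst_var T e p = (\<Sum>n\<le>degree p. (T ^^ n) (e (coeff p n)))"

text \<open>
  \<open>M[\<lambda>,\<mu>]\<close> is the type \<open>'m poly poly\<close>, the outer variable being \<open>\<mu>\<close> and the inner
  one \<open>\<lambda>\<close>.  The maps \<open>in_lam\<close> and \<open>in_mu\<close> regard a one-variable polynomial as a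
  polynomial in \<open>\<lambda>\<close>, respectively in \<open>\<mu>\<close>.
\<close>

definition mul_lam :: "'m::zero poly poly \<Rightarrow> 'm poly poly" where
  "mul_lam = map_poly (pCons 0)"

definition mul_mu :: "'m::zero poly poly \<Rightarrow> 'm poly poly" where
  "mul_mu = pCons 0"

definition in_lam :: "'m::zero poly \<Rightarrow> 'm poly poly" where
  "in_lam p = [:p:]"

definition in_mu :: "'m::zero poly \<Rightarrow> 'm poly poly" where
  "in_mu p = map_poly (\<lambda>c. [:c:]) p"


section \<open>Lie conformal algebras\<close>

text \<open>
  A \<open>k[\<partial>]\<close>-module is a module over \<open>'k poly\<close>; constants \<open>[:c:]\<close> act as the scalars
  of \<open>k\<close> and \<open>[:0, 1:]\<close> acts as \<open>\<partial>\<close>.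
\<close>

abbreviation const_scale :: "('k::zero poly \<Rightarrow> 'r \<Rightarrow> 'r) \<Rightarrow> 'k \<Rightarrow> 'r \<Rightarrow> 'r" where
  "const_scale scale c \<equiv> scale [:c:]"

abbreviation del :: "('k::zero_neq_one poly \<Rightarrow> 'r \<Rightarrow> 'r) \<Rightarrow> 'r \<Rightarrow> 'r" where
  "del scale \<equiv> scale [:0, 1:]"

text \<open>
  The value \<open>lb a b\<close> is \<open>[a\<^sub>\<lambda> b]\<close> as an element of \<open>R[\<lambda>]\<close>.  In the Jacobi identity
  the three sums are \<open>[a\<^sub>\<lambda> [b\<^sub>\<mu> c]]\<close>, \<open>[[a\<^sub>\<lambda> b] c]\<close> with subscript \<open>\<lambda> + \<mu>\<close> on the outer
  bracket, and \<open>[b\<^sub>\<mu> [a\<^sub>\<lambda> c]]\<close>.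
\<close>

locale lie_conformal_algebra = module scale
  for scale :: "'k::field poly \<Rightarrow> 'r::ab_group_add \<Rightarrow> 'r" +
  fixes R :: "'r set" and lb :: "'r \<Rightarrow> 'r \<Rightarrow> 'r poly"
  assumes submodule_carrier: "subspace R"
    and lb_closed: "\<lbrakk>a \<in> R; b \<in> R\<rbrakk> \<Longrightarrow> lb a b \<in> polys_over R"
    and lb_bilinear:
      "bilinear_on (const_scale scale) (\<lambda>c. map_poly (const_scale scale c)) R lb"
    and lb_del_left: "\<lbrakk>a \<in> R; b \<in> R\<rbrakk> \<Longrightarrow> lb (del scale a) b = - pCons 0 (lb a b)"
    and lb_del_right: "\<lbrakk>a \<in> R; b \<in> R\<rbrakk> \<Longrightarrow>
      lb a (del scale b) = pCons 0 (lb a b) + map_poly (del scale) (lb a b)"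
    and lb_skew: "\<lbrakk>a \<in> R; b \<in> R\<rbrakk> \<Longrightarrow>
      lb a b =
        - subst_var (\<lambda>q. - pCons 0 q - map_poly (del scale) q) (\<lambda>r. [:r:]) (lb b a)"
    and lb_jacobi: "\<lbrakk>a \<in> R; b \<in> R; c \<in> R\<rbrakk> \<Longrightarrow>
      subst_var mul_mu (\<lambda>x. in_lam (lb a x)) (lb b c) =
        subst_var mul_lam
          (\<lambda>x. subst_var (\<lambda>q. mul_lam q + mul_mu q) (\<lambda>r. [:[:r:]:]) (lb x c)) (lb a b) +
        subst_var mul_lam (\<lambda>x. in_mu (lb b x)) (lb a c)"

locale finite_lie_conformal_algebra = lie_conformal_algebra +
  assumes finitely_generated: "\<exists>S. finite S \<and> span S = R"

text \<open>
  The bracket of \<open>k[\<partial>]A\<close>: on \<open>A\<close> it is \<open>\<partial>(b \<circ> a) + [a,b] + \<lambda>(a \<star> b)\<close>, and it is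
  extended by \<open>(\<partial>\<^sup>i a, \<partial>\<^sup>j b) \<mapsto> (-\<lambda>)\<^sup>i (\<lambda> + \<partial>)\<^sup>j [a\<^sub>\<lambda> b]\<close>.
\<close>

definition gd_bracket_base ::
  "('v \<Rightarrow> 'v \<Rightarrow> 'v) \<Rightarrow> ('v \<Rightarrow> 'v \<Rightarrow> 'v) \<Rightarrow> 'v \<Rightarrow> 'v \<Rightarrow> 'v::ab_group_add poly poly" where
  "gd_bracket_base circ br a b = [: [: br a b, circ b a :], [: star circ a b :] :]"

definition gd_bracket ::
  "('v \<Rightarrow> 'v \<Rightarrow> 'v) \<Rightarrow> ('v \<Rightarrow> 'v \<Rightarrow> 'v) \<Rightarrow>
   'v poly \<Rightarrow> 'v poly \<Rightarrow> 'v::ab_group_add poly poly" where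
  "gd_bracket circ br p q =
     (\<Sum>i\<le>degree p. \<Sum>j\<le>degree q.
        ((\<lambda>r. - pCons 0 r) ^^ i)
          (((\<lambda>r. pCons 0 r + map_poly (pCons 0) r) ^^ j)
            (gd_bracket_base circ br (coeff p i) (coeff q j))))"


section \<open>Conformal bilinear forms and conformal Manin triples\<close>

definition conformal_form ::
  "('k::field poly \<Rightarrow> 'r \<Rightarrow> 'r) \<Rightarrow> 'r set \<Rightarrow> ('r::plus \<Rightarrow> 'r \<Rightarrow> 'k poly) \<Rightarrow> bool" where
  "conformal_form scale R form \<longleftrightarrow>
     bilinear_on (const_scale scale) smult R form \<and>
     (\<forall>u\<in>R. \<forall>v\<in>R. form (del scale u) v = - ([:0, 1:] * form u v) \<and>
                    form u (del scale v) = [:0, 1:] * form u v)"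

definition conformal_symmetric ::
  "'r set \<Rightarrow> ('r \<Rightarrow> 'r \<Rightarrow> 'k::field poly) \<Rightarrow> bool" where
  "conformal_symmetric R form \<longleftrightarrow>
     (\<forall>u\<in>R. \<forall>v\<in>R. form u v = pcompose (form v u) [:0, -1:])"

text \<open>
  In the following identity the left-hand side applies the form (in \<open>\<lambda>\<close>) to
  \<open>[a\<^sub>\<mu> b]\<close> and \<open>c\<close>, and the right-hand side applies it (in \<open>\<mu>\<close>) to \<open>a\<close> and the
  coefficients of \<open>[b c]\<close>, the bracket being taken at \<open>\<lambda> - \<partial>\<close>.
\<close>

definition conformal_invariant ::
  "('k::field poly \<Rightarrow> 'r \<Rightarrow> 'r) \<Rightarrow> 'r set \<Rightarrow> ('r \<Rightarrow> 'r \<Rightarrow> 'r::ab_group_add poly) \<Rightarrow>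
   ('r \<Rightarrow> 'r \<Rightarrow> 'k poly) \<Rightarrow> bool" where
  "conformal_invariant scale R lb form \<longleftrightarrow>
     (\<forall>a\<in>R. \<forall>b\<in>R. \<forall>c\<in>R.
        subst_var mul_mu (\<lambda>x. in_lam (form x c)) (lb a b) =
        subst_var mul_lam (\<lambda>x. in_mu (form a x))
          (subst_var (\<lambda>q. pCons 0 q - map_poly (del scale) q) (\<lambda>r. [:r:]) (lb b c)))"

text \<open>Elements of the conformal dual are functions on \<open>R\<close>, made unique by extensionality.\<close>

definition conformal_dual ::
  "('k::field poly \<Rightarrow> 'r \<Rightarrow> 'r) \<Rightarrow> 'r::plus set \<Rightarrow> ('r \<Rightarrow> 'k poly) set" where
  "conformal_dual scale R =
     {f \<in> extensional R.
        linear_on (const_scale scale) smult R f \<and>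
        (\<forall>b\<in>R. f (del scale b) = [:0, 1:] * f b)}"

text \<open>\<open>(\<partial> f)\<^sub>\<lambda> = -\<lambda> f\<^sub>\<lambda>\<close>, hence \<open>p(\<partial>)\<close> acts as multiplication by \<open>p(-\<lambda>)\<close>.\<close>

definition conformal_dual_scale ::
  "'r set \<Rightarrow> 'k::field poly \<Rightarrow> ('r \<Rightarrow> 'k poly) \<Rightarrow> 'r \<Rightarrow> 'k poly" where
  "conformal_dual_scale R p f = (\<lambda>b\<in>R. pcompose p [:0, -1:] * f b)"

definition conformal_nondegenerate ::
  "('k::field poly \<Rightarrow> 'r \<Rightarrow> 'r) \<Rightarrow> 'r::plus set \<Rightarrow> ('r \<Rightarrow> 'r \<Rightarrow> 'k poly) \<Rightarrow> bool" where
  "conformal_nondegenerate scale R form \<longleftrightarrow>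
     (let L = (\<lambda>v. restrict (form v) R) in
        (\<forall>u\<in>R. \<forall>v\<in>R. L (u + v) = (\<lambda>b\<in>R. L u b + L v b)) \<and>
        (\<forall>p. \<forall>v\<in>R. L (scale p v) = conformal_dual_scale R p (L v)) \<and>
        bij_betw L R (conformal_dual scale R))"

definition conformal_manin_triple ::
  "('k::field poly \<Rightarrow> 'r \<Rightarrow> 'r) \<Rightarrow> ('r \<Rightarrow> 'r \<Rightarrow> 'r::ab_group_add poly) \<Rightarrow>
   ('r \<Rightarrow> 'r \<Rightarrow> 'k poly) \<Rightarrow> 'r set \<Rightarrow> 'r set \<Rightarrow> 'r set \<Rightarrow> bool" where
  "conformal_manin_triple scale lb form R R\<^sub>0 R\<^sub>1 \<longleftrightarrow>
     finite_lie_conformal_algebra scale R lb \<and>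
     finite_lie_conformal_algebra scale R\<^sub>0 lb \<and> R\<^sub>0 \<subseteq> R \<and>
     finite_lie_conformal_algebra scale R\<^sub>1 lb \<and> R\<^sub>1 \<subseteq> R \<and>
     R = {x + y | x y. x \<in> R\<^sub>0 \<and> y \<in> R\<^sub>1} \<and> R\<^sub>0 \<inter> R\<^sub>1 = {0} \<and>
     conformal_form scale R form \<and>
     conformal_nondegenerate scale R form \<and>
     conformal_invariant scale R lb form \<and>
     conformal_symmetric R form \<and>
     (\<forall>x\<in>R\<^sub>0. \<forall>y\<in>R\<^sub>0. form x y = 0) \<and>
     (\<forall>x\<in>R\<^sub>1. \<forall>y\<in>R\<^sub>1. form x y = 0)"

text \<open>
  The conformal bilinear form on \<open>k[\<partial>]V\<close> determined by a bilinear form on \<open>V\<close>, i.e.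
  its extension by \<open>(\<partial>\<^sup>i u, \<partial>\<^sup>j v) \<mapsto> (-\<lambda>)\<^sup>i \<lambda>\<^sup>j (u, v)\<close>.
\<close>

definition extend_form ::
  "('v \<Rightarrow> 'v \<Rightarrow> 'k) \<Rightarrow> 'v::zero poly \<Rightarrow> 'v poly \<Rightarrow> 'k::field poly" where
  "extend_form form p q =
     (\<Sum>i\<le>degree p. \<Sum>j\<le>degree q.
        [:0, -1:] ^ i * [:0, 1:] ^ j * [:form (coeff p i) (coeff q j):])"

text \<open>
  The map \<open>k[\<partial>]V \<rightarrow> k[\<partial>]W\<close> induced by a linear map \<open>i\<close> respects the given
  \<open>\<lambda>\<close>-brackets on the submodule \<open>P\<close>.
\<close>

definition preserves_bracket ::
  "('v::zero \<Rightarrow> 'w::zero) \<Rightarrow> 'v poly set \<Rightarrow>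
   ('v poly \<Rightarrow> 'v poly \<Rightarrow> 'v poly poly) \<Rightarrow> ('w poly \<Rightarrow> 'w poly \<Rightarrow> 'w poly poly) \<Rightarrow> bool" where
  "preserves_bracket i P lb lb' \<longleftrightarrow>
     (\<forall>p\<in>P. \<forall>q\<in>P. lb' (map_poly i p) (map_poly i q) = map_poly (map_poly i) (lb p q))"

end

theory Submission
  imports Defs
begin

text \<open>
  Write \<open>V = A \<oplus> A\<^sup>*\<close>.  A \<open>\<lambda>\<close>-bracket on \<open>k[\<partial>]V\<close> that is additive and sesquilinear is determined
  by its values on \<open>V\<close>.  Suppose these have total degree at most one in \<open>\<lambda>\<close> and \<open>\<partial>\<close>, say
  \<open>[a\<^sub>\<lambda> b] = \<partial>(b \<circ> a) + \<lambda>(a \<star> b) + [a,b]\<close>.  Then every axiom to be compared reduces, by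
  sesquilinearity, to elements of \<open>V\<close>, where it is an equation between explicit polynomials.
  Comparing coefficients gives three equivalences: skew-symmetry of the \<open>\<lambda>\<close>-bracket is skew-symmetry
  of the bracket on \<open>V\<close> (\<open>skew_iff\<close>); granted this, the conformal Jacobi identity is the conjunction of the
  Novikov identities, the Jacobi identity and the Gel'fand-Dorfman compatibility (\<open>jacobi_iff\<close>);
  and invariance of the conformal form is invariance of the form on \<open>V\<close> (\<open>invariant_iff\<close>).

  From right to left the theorem follows by taking on \<open>k[\<partial>]V\<close> the bracket given by this formula.
  The form on \<open>k[\<partial>]V\<close> is nondegenerate because \<open>V\<close> has finite dual bases
  (\<open>conformal_nondegenerate_extend\<close>).

  From left to right the point is that the given bracket on \<open>k[\<partial>]V\<close> has degree at most one on all
  of \<open>V\<close>, although this is assumed only on \<open>A\<close> and on \<open>A\<^sup>*\<close> (\<open>degree_le_one_bracket\<close>).  For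
  \<open>a, b \<in> A\<close> and \<open>c \<in> V\<close>, invariance equates the pairing of \<open>[a\<^sub>\<mu> b]\<close> with \<open>c\<close>, which has degree at
  most one, and the pairing of \<open>a\<close> with \<open>[b c]\<close>, the bracket being taken at \<open>\<lambda> - \<partial>\<close>.  The
  substitution \<open>\<lambda> \<mapsto> \<lambda> - \<partial>\<close> is invertible and respects the total degree, and \<open>A\<close> is its own
  orthogonal; so the coefficients of \<open>[b\<^sub>\<lambda> c]\<close> of degree at least two lie in \<open>A\<close>.  By
  skew-symmetry the same holds for \<open>[c\<^sub>\<lambda> b]\<close>, and by symmetry with \<open>A\<^sup>*\<close> in place of \<open>A\<close>.  For one
  argument in \<open>A\<close> and one in \<open>A\<^sup>*\<close> these coefficients lie in \<open>A \<inter> A\<^sup>* = 0\<close>.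
\<close>

section \<open>Additive maps and substitution for a variable\<close>

text \<open>
  The reduction of the axioms from \<open>k[\<partial>]V\<close> to \<open>V\<close> rests on additivity and on the action of \<open>\<partial>\<close>.
  The carrier is a parameter because brackets and forms are controlled only on submodules, whereas
  the operators substituted for variables are additive on the whole type.
\<close>

definition additive_on :: "'u::ab_group_add set \<Rightarrow> ('u \<Rightarrow> 'w::ab_group_add) \<Rightarrow> bool" where
  "additive_on V f \<longleftrightarrow> (\<forall>x\<in>V. \<forall>y\<in>V. f (x + y) = f x + f y)"

abbreviation additive :: "('u::ab_group_add \<Rightarrow> 'w::ab_group_add) \<Rightarrow> bool" where
  "additive \<equiv> additive_on UNIV"

lemma additive_on_0: "additive_on V f \<Longrightarrow> 0 \<in> V \<Longrightarrow> f 0 = 0"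
  unfolding additive_on_def by (metis add.right_neutral add_left_cancel)

lemma additive_on_add: "additive_on V f \<Longrightarrow> x \<in> V \<Longrightarrow> y \<in> V \<Longrightarrow> f (x + y) = f x + f y"
  by (simp add: additive_on_def)

lemma additive_on_uminus:
  "additive_on V f \<Longrightarrow> 0 \<in> V \<Longrightarrow> x \<in> V \<Longrightarrow> - x \<in> V \<Longrightarrow> f (- x) = - f x"
  using additive_on_add[of V f x "- x"] additive_on_0[of V f]
  by (simp add: eq_neg_iff_add_eq_0 add.commute)

lemma additive_0: "additive f \<Longrightarrow> f 0 = 0"
  and additive_add: "additive f \<Longrightarrow> f (x + y) = f x + f y"
  and additive_uminus: "additive f \<Longrightarrow> f (- x) = - f x"
  by (simp_all add: additive_on_0 additive_on_add additive_on_uminus)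

lemma additive_diff: "additive f \<Longrightarrow> f (x - y) = f x - f y"
  using additive_add[of f x "- y"] by (simp add: additive_uminus)

lemma additive_sum: "additive f \<Longrightarrow> f (\<Sum>i\<in>I. g i) = (\<Sum>i\<in>I. f (g i))"
  by (induction I rule: infinite_finite_induct) (simp_all add: additive_0 additive_add)

lemma additive_onI: "(\<And>x y. x \<in> V \<Longrightarrow> y \<in> V \<Longrightarrow> f (x + y) = f x + f y) \<Longrightarrow> additive_on V f"
  by (simp add: additive_on_def)

named_theorems additive_intros

lemma additive_pCons [additive_intros]: "additive (pCons 0)"
  by (simp add: additive_on_def)

lemma additive_const [additive_intros]: "additive (\<lambda>x. [:x:])"
  by (simp add: additive_on_def)

lemma additive_map_poly [additive_intros]: "additive f \<Longrightarrow> additive (map_poly f)"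
  by (rule additive_onI, rule poly_eqI) (simp add: coeff_map_poly additive_0 additive_add)

lemma additive_plus [additive_intros]:
  "additive f \<Longrightarrow> additive g \<Longrightarrow> additive (\<lambda>x. f x + g x)"
  by (simp add: additive_on_def algebra_simps)

lemma additive_minus [additive_intros]:
  "additive f \<Longrightarrow> additive g \<Longrightarrow> additive (\<lambda>x. f x - g x)"
  by (simp add: additive_on_def algebra_simps)

lemma additive_neg [additive_intros]: "additive f \<Longrightarrow> additive (\<lambda>x. - f x)"
  by (simp add: additive_on_def)

lemma additive_mul_lam [additive_intros]: "additive mul_lam"
  unfolding mul_lam_def by (intro additive_intros)

lemma additive_mul_mu [additive_intros]: "additive mul_mu"
  unfolding mul_mu_def by (intro additive_intros)

lemma additive_in_lam [additive_intros]: "additive in_lam"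
  unfolding in_lam_def by (intro additive_intros)

lemma additive_in_mu [additive_intros]: "additive in_mu"
  unfolding in_mu_def by (intro additive_intros)

lemma polys_over_0 [simp]: "0 \<in> V \<Longrightarrow> 0 \<in> polys_over V"
  by (simp add: polys_over_def)

lemma polys_over_pCons [simp]: "pCons a p \<in> polys_over V \<longleftrightarrow> a \<in> V \<and> p \<in> polys_over V"
  by (auto simp: polys_over_def coeff_pCons split: nat.splits)

lemma polys_over_coeff: "p \<in> polys_over V \<Longrightarrow> coeff p n \<in> V"
  by (simp add: polys_over_def)

text \<open>
  As \<open>pCons a p = [:a:] + \<partial>p\<close>, a property that is compatible with sums and with the
  action of \<open>\<partial>\<close> holds on \<open>k[\<partial>]V\<close> as soon as it holds on \<open>V\<close>.
\<close>

lemma polys_over_induct [consumes 1, case_names const del add]: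
  fixes p :: "'v::ab_group_add poly"
  assumes "p \<in> polys_over V"
    and const: "\<And>a. a \<in> V \<Longrightarrow> P [:a:]"
    and del: "\<And>p. p \<in> polys_over V \<Longrightarrow> P p \<Longrightarrow> P (pCons 0 p)"
    and add: "\<And>p q. p \<in> polys_over V \<Longrightarrow> q \<in> polys_over V \<Longrightarrow> P p \<Longrightarrow> P q \<Longrightarrow> P (p + q)"
  shows "P p"
proof -
  have V0: "0 \<in> V"
    using assms(1) polys_over_coeff[of p V "Suc (degree p)"] by (simp add: coeff_eq_0)
  show ?thesis
    using assms(1)
  proof (induction p)
    case 0
    then show ?case using const[OF V0] by simp
  next
    case (pCons a p)
    then have "P ([:a:] + pCons 0 p)"
      using V0 by (intro add const del) auto
    then show ?case by simp
  qed
qed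

lemma additive_funpow:
  fixes T :: "'u::ab_group_add \<Rightarrow> 'u"
  shows "additive T \<Longrightarrow> additive (T ^^ n)"
  by (induction n) (auto simp: additive_on_def)

text \<open>
  The degree in \<open>subst_var\<close> may be replaced by any larger bound, which allows two polynomials of
  different degrees to be treated with a common index range.
\<close>

lemma subst_var_bound:
  assumes "additive T" "e 0 = 0" "degree p \<le> N"
  shows "subst_var T e p = (\<Sum>n\<le>N. (T ^^ n) (e (coeff p n)))"
  unfolding subst_var_def using assms
  by (intro sum.mono_neutral_left) (auto simp: coeff_eq_0 additive_0 additive_funpow)

lemma subst_var_0 [simp]: "e 0 = 0 \<Longrightarrow> subst_var T e 0 = 0"
  by (simp add: subst_var_def)

text \<open>
  Horner's rule; it evaluates a substitution into an explicitly given polynomial.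
\<close>

lemma subst_var_pCons:
  assumes "additive T" "e 0 = 0"
  shows "subst_var T e (pCons a p) = e a + T (subst_var T e p)"
proof -
  have "subst_var T e (pCons a p) = (\<Sum>n\<le>Suc (degree p). (T ^^ n) (e (coeff (pCons a p) n)))"
    using assms by (intro subst_var_bound) (auto simp: degree_pCons_le)
  also have "\<dots> = e a + (\<Sum>n\<le>degree p. T ((T ^^ n) (e (coeff p n))))"
    by (subst sum.atMost_Suc_shift) simp
  finally show ?thesis
    using assms by (simp add: subst_var_def additive_sum)
qed

lemma subst_var_add:
  assumes "additive T" "additive_on V e" "0 \<in> V" "p \<in> polys_over V" "q \<in> polys_over V"
  shows "subst_var T e (p + q) = subst_var T e p + subst_var T e q"
proof -
  define N where "N = max (degree p) (degree q)"
  have "e 0 = 0" using assms by (simp add: additive_on_0)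
  with assms show ?thesis
    by (subst (1 2 3) subst_var_bound[where N = N])
      (auto simp: N_def degree_add_le_max additive_on_add[OF assms(2)] polys_over_coeff
        additive_add[OF additive_funpow] sum.distrib)
qed

lemma additive_on_subst_var:
  assumes "additive T" "additive_on V e" "0 \<in> V"
  shows "additive_on (polys_over V) (subst_var T e)"
  by (rule additive_onI) (use assms subst_var_add in blast)

lemma polys_over_uminus:
  "(\<And>x. x \<in> V \<Longrightarrow> - x \<in> V) \<Longrightarrow> p \<in> polys_over V \<Longrightarrow> - p \<in> polys_over V"
  by (simp add: polys_over_def)

lemma subst_var_uminus:
  assumes "additive T" "additive_on V e" "0 \<in> V" "\<And>x. x \<in> V \<Longrightarrow> - x \<in> V" "p \<in> polys_over V"
  shows "subst_var T e (- p) = - subst_var T e p"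
  using assms by (intro additive_on_uminus[OF additive_on_subst_var[of T V e]])
    (auto simp: polys_over_uminus)

lemma subst_var_cong:
  "(\<And>n. e (coeff p n) = e' (coeff p n)) \<Longrightarrow> subst_var T e p = subst_var T e' p"
  by (simp add: subst_var_def)

lemma subst_var_polys_cong:
  "p \<in> polys_over V \<Longrightarrow> (\<And>x. x \<in> V \<Longrightarrow> e x = e' x) \<Longrightarrow> subst_var T e p = subst_var T e' p"
  by (rule subst_var_cong) (simp add: polys_over_coeff)

text \<open>
  An additive map that intertwines the operators \<open>T\<close> and \<open>T'\<close> carries \<open>T\<close>-substitution to
  \<open>T'\<close>-substitution.  With \<open>T = T'\<close> this moves multiplication by a variable, or the action of
  \<open>\<partial>\<close>, out of the iterated brackets.
\<close>

lemma subst_var_commute: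
  assumes "additive F" "\<And>x. F (T x) = T' (F x)"
  shows "F (subst_var T e p) = subst_var T' (\<lambda>x. F (e x)) p"
proof -
  have "F ((T ^^ n) x) = (T' ^^ n) (F x)" for n x
    by (induction n) (simp_all add: assms(2))
  then show ?thesis
    by (simp add: subst_var_def additive_sum[OF assms(1)])
qed

lemma subst_var_plus:
  "additive T \<Longrightarrow> subst_var T (\<lambda>x. e x + e' x) p = subst_var T e p + subst_var T e' p"
  by (simp add: subst_var_def additive_add[OF additive_funpow] sum.distrib)

lemma subst_var_neg:
  "additive T \<Longrightarrow> subst_var T (\<lambda>x. - e x) p = - subst_var T e p"
  by (simp add: subst_var_def additive_uminus[OF additive_funpow] sum_negf)

lemma subst_var_map_poly:
  assumes "additive T" "e 0 = 0" "g 0 = 0"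
  shows "subst_var T e (map_poly g p) = subst_var T (\<lambda>x. e (g x)) p"
proof -
  have "degree (map_poly g p) \<le> degree p"
    by (rule degree_le) (simp add: coeff_map_poly assms(3) coeff_eq_0)
  with assms show ?thesis
    by (subst (1 2) subst_var_bound[where N = "degree p"]) (auto simp: coeff_map_poly)
qed

lemma subst_var_closed:
  assumes "p \<in> polys_over V" "\<And>x. x \<in> V \<Longrightarrow> e x \<in> U" "\<And>x. x \<in> U \<Longrightarrow> T x \<in> U"
    "\<And>x y. x \<in> U \<Longrightarrow> y \<in> U \<Longrightarrow> x + y \<in> U" "0 \<in> U"
  shows "subst_var T e p \<in> U"
proof -
  have "(T ^^ n) x \<in> U" if "x \<in> U" for n x
    using that by (induction n) (simp_all add: assms(3))
  moreover have "sum g I \<in> U" if "\<And>n. g n \<in> U" for g :: "nat \<Rightarrow> _" and I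
    using that by (induction I rule: infinite_finite_induct) (simp_all add: assms(4,5))
  ultimately show ?thesis
    by (simp add: subst_var_def assms(1,2) polys_over_coeff)
qed


section \<open>Substitutions for the variable of a bracket\<close>

lemma mul_lam_0 [simp]: "mul_lam 0 = 0"
  and mul_lam_pCons [simp]: "mul_lam (pCons p P) = pCons (pCons 0 p) (mul_lam P)"
  by (simp_all add: mul_lam_def map_poly_pCons)

lemma mul_mu_eq: "mul_mu P = pCons 0 P"
  by (simp add: mul_mu_def)

lemma in_lam_eq: "in_lam p = [:p:]"
  by (simp add: in_lam_def)

lemma in_lam_0 [simp]: "in_lam 0 = 0"
  by (simp add: in_lam_def)

lemma in_mu_0 [simp]: "in_mu 0 = 0"
  and in_mu_pCons [simp]: "in_mu (pCons a p) = pCons [:a:] (in_mu p)"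
  by (simp_all add: in_mu_def map_poly_pCons)

text \<open>
  On \<open>R[\<lambda>]\<close> with \<open>R = k[\<partial>]V\<close> this is the substitution \<open>\<lambda> \<mapsto> T\<close> that leaves the coefficients
  unchanged.
\<close>

definition subst_lambda ::
  "('v poly poly \<Rightarrow> 'v poly poly) \<Rightarrow> 'v::ab_group_add poly poly \<Rightarrow> 'v poly poly" where
  "subst_lambda T = subst_var T (\<lambda>r. [:r:])"

lemma additive_subst_lambda: "additive T \<Longrightarrow> additive (subst_lambda T)"
proof -
  assume "additive T"
  then have "additive_on (polys_over UNIV) (subst_lambda T)"
    unfolding subst_lambda_def by (intro additive_on_subst_var additive_intros) auto
  then show ?thesis by (simp add: polys_over_def)
qed

lemma subst_lambda_pCons:
  "additive T \<Longrightarrow> subst_lambda T (pCons r p) = [:r:] + T (subst_lambda T p)"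
  unfolding subst_lambda_def by (simp add: subst_var_pCons)

lemma subst_lambda_del:
  assumes "additive T" "\<And>q. T (map_poly (pCons 0) q) = map_poly (pCons 0) (T q)"
  shows "subst_lambda T (map_poly (pCons 0) p) = map_poly (pCons 0) (subst_lambda T p)"
proof (induction p)
  case 0
  show ?case by (simp add: additive_0[OF additive_subst_lambda] assms)
next
  case (pCons r p)
  have a: "additive (map_poly (pCons 0 :: 'a poly \<Rightarrow> _))"
    by (intro additive_intros)
  from pCons show ?case
    by (simp add: map_poly_pCons subst_lambda_pCons additive_add[OF a] assms)
qed

lemma additive_map_del: "additive (map_poly (pCons 0))"
  by (intro additive_intros)

lemmas map_del_simps = additive_0[OF additive_map_del] additive_add[OF additive_map_del]
  additive_diff[OF additive_map_del] additive_uminus[OF additive_map_del]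

text \<open>
  The substitutions \<open>\<lambda> \<mapsto> -\<lambda> - \<partial>\<close> and \<open>\<lambda> \<mapsto> \<lambda> - \<partial>\<close>, which occur in skew-symmetry and in the
  invariance of a form.
\<close>

definition skew_op :: "'v::ab_group_add poly poly \<Rightarrow> 'v poly poly" where
  "skew_op = subst_lambda (\<lambda>q. - pCons 0 q - map_poly (pCons 0) q)"

definition shift_op :: "'v::ab_group_add poly poly \<Rightarrow> 'v poly poly" where
  "shift_op = subst_lambda (\<lambda>q. pCons 0 q - map_poly (pCons 0) q)"

lemma additive_skew_step: "additive (\<lambda>q. - pCons 0 q - map_poly (pCons 0) q)"
  and additive_shift_step: "additive (\<lambda>q. pCons 0 q - map_poly (pCons 0) q)"
  by (intro additive_intros)+

lemmas additive_skew_op = additive_subst_lambda[OF additive_skew_step, folded skew_op_def]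
  and additive_shift_op = additive_subst_lambda[OF additive_shift_step, folded shift_op_def]

lemma skew_op_0 [simp]: "skew_op 0 = 0" and shift_op_0 [simp]: "shift_op 0 = 0"
  by (rule additive_0[OF additive_skew_op], rule additive_0[OF additive_shift_op])

lemmas skew_op_pCons = subst_lambda_pCons[OF additive_skew_step, folded skew_op_def]
  and shift_op_pCons = subst_lambda_pCons[OF additive_shift_step, folded shift_op_def]

lemma skew_op_del: "skew_op (map_poly (pCons 0) p) = map_poly (pCons 0) (skew_op p)"
  unfolding skew_op_def
  by (rule subst_lambda_del[OF additive_skew_step]) (simp add: map_del_simps map_poly_pCons)

lemma shift_op_del: "shift_op (map_poly (pCons 0) p) = map_poly (pCons 0) (shift_op p)"
  unfolding shift_op_def
  by (rule subst_lambda_del[OF additive_shift_step]) (simp add: map_del_simps map_poly_pCons)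


section \<open>Sesquilinear brackets of degree one\<close>

text \<open>
  A \<open>\<lambda>\<close>-bracket on \<open>k[\<partial>]V\<close> given on \<open>V\<close> by two biadditive operations.  Keeping \<open>lb\<close> and the
  operations as separate parameters lets the locale cover both the bracket \<open>gd_bracket circ br\<close>
  built from two operations and a given conformal bracket from which the operations are read off.
\<close>

locale sesquilinear_bracket =
  fixes V :: "'v::ab_group_add set"
    and circ br :: "'v \<Rightarrow> 'v \<Rightarrow> 'v"
    and lb :: "'v poly \<Rightarrow> 'v poly \<Rightarrow> 'v poly poly"
  assumes zero_mem [simp]: "0 \<in> V"
    and add_mem [simp]: "\<And>x y. x \<in> V \<Longrightarrow> y \<in> V \<Longrightarrow> x + y \<in> V"
    and uminus_mem [simp]: "\<And>x. x \<in> V \<Longrightarrow> - x \<in> V"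
    and circ_mem [simp]: "\<And>x y. x \<in> V \<Longrightarrow> y \<in> V \<Longrightarrow> circ x y \<in> V"
    and br_mem [simp]: "\<And>x y. x \<in> V \<Longrightarrow> y \<in> V \<Longrightarrow> br x y \<in> V"
    and circ_left: "\<And>y. y \<in> V \<Longrightarrow> additive_on V (\<lambda>x. circ x y)"
    and circ_right: "\<And>x. x \<in> V \<Longrightarrow> additive_on V (circ x)"
    and br_left: "\<And>y. y \<in> V \<Longrightarrow> additive_on V (\<lambda>x. br x y)"
    and br_right: "\<And>x. x \<in> V \<Longrightarrow> additive_on V (br x)"
    and lb_mem: "\<And>p q. p \<in> polys_over V \<Longrightarrow> q \<in> polys_over V \<Longrightarrow>
      lb p q \<in> polys_over (polys_over V)"
    and lb_left: "\<And>q. q \<in> polys_over V \<Longrightarrow> additive_on (polys_over V) (\<lambda>p. lb p q)"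
    and lb_right: "\<And>p. p \<in> polys_over V \<Longrightarrow> additive_on (polys_over V) (lb p)"
    and lb_del_left: "\<And>p q. p \<in> polys_over V \<Longrightarrow> q \<in> polys_over V \<Longrightarrow>
      lb (pCons 0 p) q = - pCons 0 (lb p q)"
    and lb_del_right: "\<And>p q. p \<in> polys_over V \<Longrightarrow> q \<in> polys_over V \<Longrightarrow>
      lb p (pCons 0 q) = pCons 0 (lb p q) + map_poly (pCons 0) (lb p q)"
    and lb_const: "\<And>a b. a \<in> V \<Longrightarrow> b \<in> V \<Longrightarrow> lb [:a:] [:b:] = gd_bracket_base circ br a b"
begin

abbreviation "R \<equiv> polys_over V"

lemma R_add [simp]: "p \<in> R \<Longrightarrow> q \<in> R \<Longrightarrow> p + q \<in> R"
  and R_uminus [simp]: "p \<in> R \<Longrightarrow> - p \<in> R"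
  by (simp_all add: polys_over_def)

lemma circ_simps [simp]:
  "x \<in> V \<Longrightarrow> y \<in> V \<Longrightarrow> z \<in> V \<Longrightarrow> circ (x + y) z = circ x z + circ y z"
  "x \<in> V \<Longrightarrow> y \<in> V \<Longrightarrow> z \<in> V \<Longrightarrow> circ z (x + y) = circ z x + circ z y"
  "x \<in> V \<Longrightarrow> z \<in> V \<Longrightarrow> circ (- x) z = - circ x z"
  "x \<in> V \<Longrightarrow> z \<in> V \<Longrightarrow> circ z (- x) = - circ z x"
  "z \<in> V \<Longrightarrow> circ 0 z = 0" "z \<in> V \<Longrightarrow> circ z 0 = 0"
  using additive_on_add[OF circ_left] additive_on_add[OF circ_right]
    additive_on_uminus[OF circ_left] additive_on_uminus[OF circ_right]
    additive_on_0[OF circ_left] additive_on_0[OF circ_right]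
  by (auto simp del: add_uminus_conv_diff)

lemma br_simps [simp]:
  "x \<in> V \<Longrightarrow> y \<in> V \<Longrightarrow> z \<in> V \<Longrightarrow> br (x + y) z = br x z + br y z"
  "x \<in> V \<Longrightarrow> y \<in> V \<Longrightarrow> z \<in> V \<Longrightarrow> br z (x + y) = br z x + br z y"
  "x \<in> V \<Longrightarrow> z \<in> V \<Longrightarrow> br (- x) z = - br x z"
  "x \<in> V \<Longrightarrow> z \<in> V \<Longrightarrow> br z (- x) = - br z x"
  "z \<in> V \<Longrightarrow> br 0 z = 0" "z \<in> V \<Longrightarrow> br z 0 = 0"
  using additive_on_add[OF br_left] additive_on_add[OF br_right]
    additive_on_uminus[OF br_left] additive_on_uminus[OF br_right]
    additive_on_0[OF br_left] additive_on_0[OF br_right]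
  by auto

lemma star_mem [simp]: "x \<in> V \<Longrightarrow> y \<in> V \<Longrightarrow> star circ x y \<in> V"
  by (simp add: star_def)

lemma lb_zero [simp]: "q \<in> R \<Longrightarrow> lb 0 q = 0" "q \<in> R \<Longrightarrow> lb q 0 = 0"
  using additive_on_0[OF lb_left] additive_on_0[OF lb_right] by auto

lemma lb_add_left: "p \<in> R \<Longrightarrow> p' \<in> R \<Longrightarrow> q \<in> R \<Longrightarrow> lb (p + p') q = lb p q + lb p' q"
  and lb_add_right: "p \<in> R \<Longrightarrow> p' \<in> R \<Longrightarrow> q \<in> R \<Longrightarrow> lb q (p + p') = lb q p + lb q p'"
  using additive_on_add[OF lb_left] additive_on_add[OF lb_right] by auto

text \<open>
  The defect of skew-symmetry is itself additive and sesquilinear in its two arguments, so it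
  vanishes on \<open>k[\<partial>]V\<close> once it vanishes on \<open>V\<close>.
\<close>

definition skew_defect :: "'v poly \<Rightarrow> 'v poly \<Rightarrow> 'v poly poly" where
  "skew_defect p q = lb p q + skew_op (lb q p)"

lemma skew_defect_del_left:
  "p \<in> R \<Longrightarrow> q \<in> R \<Longrightarrow> skew_defect (pCons 0 p) q = - pCons 0 (skew_defect p q)"
  by (simp add: skew_defect_def lb_del_left lb_del_right additive_add[OF additive_skew_op]
      skew_op_del skew_op_pCons)

lemma skew_defect_del_right:
  assumes "p \<in> R" "q \<in> R"
  shows "skew_defect p (pCons 0 q) = pCons 0 (skew_defect p q) + map_poly (pCons 0) (skew_defect p q)"
proof -
  have a: "additive (map_poly (pCons 0 :: 'v poly \<Rightarrow> _))"
    by (intro additive_intros)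
  show ?thesis using assms
    by (simp add: skew_defect_def lb_del_left lb_del_right additive_uminus[OF additive_skew_op]
        skew_op_pCons additive_add[OF a] additive_uminus[OF a] algebra_simps)
qed

lemma skew_defect_add:
  "p \<in> R \<Longrightarrow> p' \<in> R \<Longrightarrow> q \<in> R \<Longrightarrow> skew_defect (p + p') q = skew_defect p q + skew_defect p' q"
  "p \<in> R \<Longrightarrow> p' \<in> R \<Longrightarrow> q \<in> R \<Longrightarrow> skew_defect q (p + p') = skew_defect q p + skew_defect q p'"
  by (simp_all add: skew_defect_def lb_add_left lb_add_right additive_add[OF additive_skew_op])

text \<open>
  The coefficients of \<open>\<lambda>\<close> and \<open>\<partial>\<close> cancel because \<open>a \<star> b\<close> is the symmetrised product.
\<close>

lemma skew_defect_const:
  "a \<in> V \<Longrightarrow> b \<in> V \<Longrightarrow> skew_defect [:a:] [:b:] = [: [: br a b + br b a :] :]"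
  by (simp add: skew_defect_def lb_const gd_bracket_base_def skew_op_pCons star_def map_poly_pCons)

lemma skew_iff:
  "(\<forall>p\<in>R. \<forall>q\<in>R. lb p q = - skew_op (lb q p)) \<longleftrightarrow> (\<forall>a\<in>V. \<forall>b\<in>V. br a b = - br b a)"
    (is "?L \<longleftrightarrow> ?R")
proof -
  have "?L \<longleftrightarrow> (\<forall>p\<in>R. \<forall>q\<in>R. skew_defect p q = 0)"
    by (simp add: skew_defect_def eq_neg_iff_add_eq_0)
  also have "\<dots> \<longleftrightarrow> (\<forall>a\<in>V. \<forall>b\<in>V. skew_defect [:a:] [:b:] = 0)" (is "_ \<longleftrightarrow> ?C")
  proof
    assume const: ?C
    have "skew_defect [:a:] q = 0" if "a \<in> V" "q \<in> R" for a q
      using that(2)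
      by (induction rule: polys_over_induct)
        (use that const in \<open>auto simp: skew_defect_del_right skew_defect_add\<close>)
    note c = this
    have "skew_defect p q = 0" if "p \<in> R" "q \<in> R" for p q
      using that(1)
      by (induction rule: polys_over_induct)
        (use that c in \<open>auto simp: skew_defect_del_left skew_defect_add\<close>)
    then show "\<forall>p\<in>R. \<forall>q\<in>R. skew_defect p q = 0" by blast
  qed auto
  also have "\<dots> \<longleftrightarrow> ?R"
    by (simp add: skew_defect_const eq_neg_iff_add_eq_0)
  finally show ?thesis .
qed


section \<open>The Jacobi identity and the Gel'fand-Dorfman axioms\<close>

text \<open>
  The substitution \<open>\<lambda> \<mapsto> \<lambda> + \<mu>\<close>, which gives the outer bracket of \<open>[[a\<^sub>\<lambda> b]\<^sub>\<lambda>\<^sub>+\<^sub>\<mu> c]\<close>.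
\<close>

definition sum_op :: "'v poly poly \<Rightarrow> 'v poly poly poly" where
  "sum_op = subst_var (\<lambda>q. mul_lam q + mul_mu q) (\<lambda>r. [:[:r:]:])"

definition jac_a_bc :: "'v poly \<Rightarrow> 'v poly \<Rightarrow> 'v poly \<Rightarrow> 'v poly poly poly" where
  "jac_a_bc a b c = subst_var mul_mu (\<lambda>x. in_lam (lb a x)) (lb b c)"

definition jac_ab_c :: "'v poly \<Rightarrow> 'v poly \<Rightarrow> 'v poly \<Rightarrow> 'v poly poly poly" where
  "jac_ab_c a b c = subst_var mul_lam (\<lambda>x. sum_op (lb x c)) (lb a b)"

definition jac_b_ac :: "'v poly \<Rightarrow> 'v poly \<Rightarrow> 'v poly \<Rightarrow> 'v poly poly poly" where
  "jac_b_ac a b c = subst_var mul_lam (\<lambda>x. in_mu (lb b x)) (lb a c)"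

text \<open>
  The action of \<open>\<partial>\<close> on the coefficients of \<open>R[\<lambda>,\<mu>]\<close>.
\<close>

definition del_op :: "'v poly poly poly \<Rightarrow> 'v poly poly poly" where
  "del_op = map_poly (map_poly (pCons 0))"

lemma additive_del_op [additive_intros]: "additive del_op"
  unfolding del_op_def by (intro additive_intros)

lemma additive_sum_op [additive_intros]: "additive sum_op"
proof -
  have "additive_on (polys_over UNIV) sum_op"
    unfolding sum_op_def
    by (intro additive_on_subst_var additive_intros) (simp_all add: additive_on_def)
  then show ?thesis by (simp add: polys_over_def)
qed

lemma sum_op_0 [simp]: "sum_op 0 = 0"
  by (rule additive_0[OF additive_sum_op])

lemma sum_op_pCons:
  "sum_op (pCons r p) = [:[:r:]:] + (mul_lam (sum_op p) + mul_mu (sum_op p))"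
  unfolding sum_op_def by (rule subst_var_pCons, intro additive_intros, simp)

lemma mul_lam_mu: "mul_lam (mul_mu P) = mul_mu (mul_lam P)"
  by (simp add: mul_mu_def)

lemma del_op_mu: "del_op (mul_mu P) = mul_mu (del_op P)"
  by (simp add: mul_mu_def del_op_def map_poly_pCons)

lemma del_op_lam: "del_op (mul_lam P) = mul_lam (del_op P)"
  by (induction P) (simp_all add: del_op_def map_poly_pCons)

lemma in_lam_pCons: "in_lam (pCons 0 q) = mul_lam (in_lam q)"
  and in_mu_pCons_0: "in_mu (pCons 0 q) = mul_mu (in_mu q)"
  by (simp_all add: in_lam_def mul_mu_def)

lemma in_lam_del: "in_lam (map_poly (pCons 0) q) = del_op (in_lam q)"
  by (simp add: in_lam_def del_op_def map_poly_pCons)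

lemma in_mu_del: "in_mu (map_poly (pCons 0) q) = del_op (in_mu q)"
  by (induction q) (simp_all add: del_op_def map_poly_pCons)

lemma sum_op_del: "sum_op (map_poly (pCons 0) p) = del_op (sum_op p)"
proof (induction p)
  case (pCons r p)
  then show ?case
    by (simp add: map_poly_pCons sum_op_pCons additive_add[OF additive_del_op] del_op_mu del_op_lam)
      (simp add: del_op_def map_poly_pCons)
qed (simp add: del_op_def)

lemmas op_add = additive_add[OF additive_in_lam] additive_add[OF additive_in_mu]
  additive_add[OF additive_sum_op] additive_add[OF additive_mul_lam] additive_add[OF additive_mul_mu]
  additive_add[OF additive_del_op]

lemmas op_uminus = additive_uminus[OF additive_in_lam] additive_uminus[OF additive_in_mu]
  additive_uminus[OF additive_sum_op] additive_uminus[OF additive_mul_lam]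
  additive_uminus[OF additive_mul_mu] additive_uminus[OF additive_del_op]

lemma additive_on_jac_maps:
  assumes "a \<in> R"
  shows "additive_on R (\<lambda>x. in_lam (lb a x))" "additive_on R (\<lambda>x. in_mu (lb a x))"
    "additive_on R (\<lambda>x. sum_op (lb x a))"
  using assms by (auto intro!: additive_onI simp: lb_add_left lb_add_right op_add)

lemma subst_jac_add:
  assumes "a \<in> R" "P \<in> polys_over R" "Q \<in> polys_over R"
  shows "subst_var mul_mu (\<lambda>x. in_lam (lb a x)) (P + Q) =
      subst_var mul_mu (\<lambda>x. in_lam (lb a x)) P + subst_var mul_mu (\<lambda>x. in_lam (lb a x)) Q"
    "subst_var mul_lam (\<lambda>x. in_mu (lb a x)) (P + Q) =
      subst_var mul_lam (\<lambda>x. in_mu (lb a x)) P + subst_var mul_lam (\<lambda>x. in_mu (lb a x)) Q"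
    "subst_var mul_lam (\<lambda>x. sum_op (lb x a)) (P + Q) =
      subst_var mul_lam (\<lambda>x. sum_op (lb x a)) P + subst_var mul_lam (\<lambda>x. sum_op (lb x a)) Q"
  using assms by (intro subst_var_add[where V = R] additive_intros additive_on_jac_maps; simp)+

lemma subst_jac_uminus:
  assumes "a \<in> R" "P \<in> polys_over R"
  shows "subst_var mul_mu (\<lambda>x. in_lam (lb a x)) (- P) = - subst_var mul_mu (\<lambda>x. in_lam (lb a x)) P"
    "subst_var mul_lam (\<lambda>x. in_mu (lb a x)) (- P) = - subst_var mul_lam (\<lambda>x. in_mu (lb a x)) P"
    "subst_var mul_lam (\<lambda>x. sum_op (lb x a)) (- P) = - subst_var mul_lam (\<lambda>x. sum_op (lb x a)) P"
  using assms by (intro subst_var_uminus[where V = R] additive_intros additive_on_jac_maps; simp)+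

lemma subst_jac_pCons:
  assumes "a \<in> R"
  shows "subst_var mul_mu (\<lambda>x. in_lam (lb a x)) (pCons p P) =
      in_lam (lb a p) + mul_mu (subst_var mul_mu (\<lambda>x. in_lam (lb a x)) P)"
    "subst_var mul_lam (\<lambda>x. in_mu (lb a x)) (pCons p P) =
      in_mu (lb a p) + mul_lam (subst_var mul_lam (\<lambda>x. in_mu (lb a x)) P)"
    "subst_var mul_lam (\<lambda>x. sum_op (lb x a)) (pCons p P) =
      sum_op (lb p a) + mul_lam (subst_var mul_lam (\<lambda>x. sum_op (lb x a)) P)"
  using assms by (intro subst_var_pCons additive_intros; simp)+

text \<open>
  The three terms of the Jacobi identity are additive in each argument, and they transform in the
  same way when \<open>\<partial>\<close> is applied to an argument: they are multiplied by \<open>-\<lambda>\<close>, by \<open>-\<mu>\<close> and by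
  \<open>\<lambda> + \<mu> + \<partial>\<close> for the first, second and third argument.  So the identity need only be checked on
  \<open>V\<close>.
\<close>

lemma jac_add_1:
  assumes "a \<in> R" "a' \<in> R" "b \<in> R" "c \<in> R"
  shows "jac_a_bc (a + a') b c = jac_a_bc a b c + jac_a_bc a' b c"
    "jac_ab_c (a + a') b c = jac_ab_c a b c + jac_ab_c a' b c"
    "jac_b_ac (a + a') b c = jac_b_ac a b c + jac_b_ac a' b c"
proof -
  have "jac_a_bc (a + a') b c = subst_var mul_mu (\<lambda>x. in_lam (lb a x) + in_lam (lb a' x)) (lb b c)"
    unfolding jac_a_bc_def by (rule subst_var_polys_cong[where V = R])
      (use assms in \<open>auto simp: lb_mem lb_add_left op_add\<close>)
  then show "jac_a_bc (a + a') b c = jac_a_bc a b c + jac_a_bc a' b c"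
    by (simp add: jac_a_bc_def subst_var_plus additive_intros)
qed (use assms in \<open>simp_all add: jac_ab_c_def jac_b_ac_def lb_add_left subst_jac_add lb_mem\<close>)

lemma jac_add_2:
  assumes "a \<in> R" "b \<in> R" "b' \<in> R" "c \<in> R"
  shows "jac_a_bc a (b + b') c = jac_a_bc a b c + jac_a_bc a b' c"
    "jac_ab_c a (b + b') c = jac_ab_c a b c + jac_ab_c a b' c"
    "jac_b_ac a (b + b') c = jac_b_ac a b c + jac_b_ac a b' c"
proof -
  have "jac_b_ac a (b + b') c = subst_var mul_lam (\<lambda>x. in_mu (lb b x) + in_mu (lb b' x)) (lb a c)"
    unfolding jac_b_ac_def by (rule subst_var_polys_cong[where V = R])
      (use assms in \<open>auto simp: lb_mem lb_add_left op_add\<close>)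
  then show "jac_b_ac a (b + b') c = jac_b_ac a b c + jac_b_ac a b' c"
    by (simp add: jac_b_ac_def subst_var_plus additive_intros)
qed (use assms in \<open>simp_all add: jac_a_bc_def jac_ab_c_def lb_add_left lb_add_right subst_jac_add lb_mem\<close>)

lemma jac_add_3:
  assumes "a \<in> R" "b \<in> R" "c \<in> R" "c' \<in> R"
  shows "jac_a_bc a b (c + c') = jac_a_bc a b c + jac_a_bc a b c'"
    "jac_ab_c a b (c + c') = jac_ab_c a b c + jac_ab_c a b c'"
    "jac_b_ac a b (c + c') = jac_b_ac a b c + jac_b_ac a b c'"
proof -
  have "jac_ab_c a b (c + c') = subst_var mul_lam (\<lambda>x. sum_op (lb x c) + sum_op (lb x c')) (lb a b)"
    unfolding jac_ab_c_def by (rule subst_var_polys_cong[where V = R])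
      (use assms in \<open>auto simp: lb_mem lb_add_right op_add\<close>)
  then show "jac_ab_c a b (c + c') = jac_ab_c a b c + jac_ab_c a b c'"
    by (simp add: jac_ab_c_def subst_var_plus additive_intros)
qed (use assms in \<open>simp_all add: jac_a_bc_def jac_b_ac_def lb_add_right subst_jac_add lb_mem\<close>)

lemma polys_del_mem: "P \<in> polys_over R \<Longrightarrow> map_poly (pCons 0) P \<in> polys_over R"
  by (simp add: polys_over_def coeff_map_poly coeff_pCons split: nat.splits)

lemma jac_del_1:
  assumes "a \<in> R" "b \<in> R" "c \<in> R"
  shows "jac_a_bc (pCons 0 a) b c = - mul_lam (jac_a_bc a b c)"
    "jac_ab_c (pCons 0 a) b c = - mul_lam (jac_ab_c a b c)"
    "jac_b_ac (pCons 0 a) b c = - mul_lam (jac_b_ac a b c)"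
proof -
  have "jac_a_bc (pCons 0 a) b c = subst_var mul_mu (\<lambda>x. - mul_lam (in_lam (lb a x))) (lb b c)"
    unfolding jac_a_bc_def by (rule subst_var_polys_cong[where V = R])
      (use assms in \<open>auto simp: lb_mem lb_del_left op_uminus in_lam_pCons simp del: minus_pCons\<close>)
  then show "jac_a_bc (pCons 0 a) b c = - mul_lam (jac_a_bc a b c)"
    by (simp add: jac_a_bc_def subst_var_neg additive_intros
        subst_var_commute[of mul_lam mul_mu mul_mu] mul_lam_mu)
qed (use assms in \<open>simp_all add: jac_ab_c_def jac_b_ac_def lb_del_left subst_jac_uminus subst_jac_pCons lb_mem
      del: minus_pCons\<close>)

lemma jac_del_2:
  assumes "a \<in> R" "b \<in> R" "c \<in> R"
  shows "jac_a_bc a (pCons 0 b) c = - mul_mu (jac_a_bc a b c)"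
    "jac_ab_c a (pCons 0 b) c = - mul_mu (jac_ab_c a b c)"
    "jac_b_ac a (pCons 0 b) c = - mul_mu (jac_b_ac a b c)"
proof -
  have "jac_b_ac a (pCons 0 b) c = subst_var mul_lam (\<lambda>x. - mul_mu (in_mu (lb b x))) (lb a c)"
    unfolding jac_b_ac_def by (rule subst_var_polys_cong[where V = R])
      (use assms in \<open>auto simp: lb_mem lb_del_left op_uminus in_mu_pCons_0 simp del: minus_pCons in_mu_pCons\<close>)
  then show "jac_b_ac a (pCons 0 b) c = - mul_mu (jac_b_ac a b c)"
    by (simp add: jac_b_ac_def subst_var_neg additive_intros
        subst_var_commute[of mul_mu mul_lam mul_lam] mul_lam_mu)
  have "jac_ab_c a (pCons 0 b) c = mul_lam (jac_ab_c a b c)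
      + subst_var mul_lam (\<lambda>x. sum_op (lb (pCons 0 x) c)) (lb a b)"
    using assms by (simp add: jac_ab_c_def lb_del_right subst_jac_add subst_jac_pCons lb_mem
        polys_del_mem subst_var_map_poly additive_intros)
  also have "subst_var mul_lam (\<lambda>x. sum_op (lb (pCons 0 x) c)) (lb a b)
      = subst_var mul_lam (\<lambda>x. - (mul_lam (sum_op (lb x c)) + mul_mu (sum_op (lb x c)))) (lb a b)"
    by (rule subst_var_polys_cong[where V = R])
      (use assms in \<open>auto simp: lb_mem lb_del_left op_uminus sum_op_pCons simp del: minus_pCons\<close>)
  also have "\<dots> = - (mul_lam (jac_ab_c a b c) + mul_mu (jac_ab_c a b c))"
    by (simp add: jac_ab_c_def subst_var_neg subst_var_plus additive_intros mul_lam_mu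
        subst_var_commute[of mul_mu mul_lam mul_lam] subst_var_commute[of mul_lam mul_lam mul_lam]
        del: minus_add_distrib)
  finally show "jac_ab_c a (pCons 0 b) c = - mul_mu (jac_ab_c a b c)" by simp
qed (use assms in \<open>simp_all add: jac_a_bc_def lb_del_left subst_jac_uminus subst_jac_pCons lb_mem
      del: minus_pCons\<close>)

lemma jac_del_3:
  assumes "a \<in> R" "b \<in> R" "c \<in> R"
  shows "jac_a_bc a b (pCons 0 c) = mul_lam (jac_a_bc a b c) + mul_mu (jac_a_bc a b c) + del_op (jac_a_bc a b c)"
    "jac_ab_c a b (pCons 0 c) = mul_lam (jac_ab_c a b c) + mul_mu (jac_ab_c a b c) + del_op (jac_ab_c a b c)"
    "jac_b_ac a b (pCons 0 c) = mul_lam (jac_b_ac a b c) + mul_mu (jac_b_ac a b c) + del_op (jac_b_ac a b c)"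
proof -
  have "jac_a_bc a b (pCons 0 c) = mul_mu (jac_a_bc a b c)
      + subst_var mul_mu (\<lambda>x. in_lam (lb a (pCons 0 x))) (lb b c)"
    using assms by (simp add: jac_a_bc_def lb_del_right subst_jac_add subst_jac_pCons lb_mem
        polys_del_mem subst_var_map_poly additive_intros)
  also have "subst_var mul_mu (\<lambda>x. in_lam (lb a (pCons 0 x))) (lb b c)
      = subst_var mul_mu (\<lambda>x. mul_lam (in_lam (lb a x)) + del_op (in_lam (lb a x))) (lb b c)"
    by (rule subst_var_polys_cong[where V = R])
      (use assms in \<open>auto simp: lb_mem lb_del_right op_add in_lam_pCons in_lam_del\<close>)
  also have "\<dots> = mul_lam (jac_a_bc a b c) + del_op (jac_a_bc a b c)"
    by (simp add: jac_a_bc_def subst_var_plus additive_intros mul_lam_mu del_op_mu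
        subst_var_commute[of mul_lam mul_mu mul_mu] subst_var_commute[of del_op mul_mu mul_mu])
  finally show "jac_a_bc a b (pCons 0 c) = mul_lam (jac_a_bc a b c) + mul_mu (jac_a_bc a b c) + del_op (jac_a_bc a b c)"
    by (simp add: ac_simps)
  have "jac_b_ac a b (pCons 0 c) = mul_lam (jac_b_ac a b c)
      + subst_var mul_lam (\<lambda>x. in_mu (lb b (pCons 0 x))) (lb a c)"
    using assms by (simp add: jac_b_ac_def lb_del_right subst_jac_add subst_jac_pCons lb_mem
        polys_del_mem subst_var_map_poly additive_intros)
  also have "subst_var mul_lam (\<lambda>x. in_mu (lb b (pCons 0 x))) (lb a c)
      = subst_var mul_lam (\<lambda>x. mul_mu (in_mu (lb b x)) + del_op (in_mu (lb b x))) (lb a c)"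
    by (rule subst_var_polys_cong[where V = R])
      (use assms in \<open>auto simp: lb_mem lb_del_right op_add in_mu_pCons_0 in_mu_del simp del: in_mu_pCons\<close>)
  also have "\<dots> = mul_mu (jac_b_ac a b c) + del_op (jac_b_ac a b c)"
    by (simp add: jac_b_ac_def subst_var_plus additive_intros mul_lam_mu del_op_lam
        subst_var_commute[of mul_mu mul_lam mul_lam] subst_var_commute[of del_op mul_lam mul_lam])
  finally show "jac_b_ac a b (pCons 0 c) = mul_lam (jac_b_ac a b c) + mul_mu (jac_b_ac a b c) + del_op (jac_b_ac a b c)"
    by (simp add: ac_simps)
  have "jac_ab_c a b (pCons 0 c)
      = subst_var mul_lam (\<lambda>x. mul_lam (sum_op (lb x c)) + mul_mu (sum_op (lb x c))
          + del_op (sum_op (lb x c))) (lb a b)"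
    unfolding jac_ab_c_def by (rule subst_var_polys_cong[where V = R])
      (use assms in \<open>auto simp: lb_mem lb_del_right op_add sum_op_pCons sum_op_del\<close>)
  then show "jac_ab_c a b (pCons 0 c) = mul_lam (jac_ab_c a b c) + mul_mu (jac_ab_c a b c) + del_op (jac_ab_c a b c)"
    by (simp add: jac_ab_c_def subst_var_plus additive_intros mul_lam_mu del_op_lam
        subst_var_commute[of mul_mu mul_lam mul_lam] subst_var_commute[of del_op mul_lam mul_lam]
        subst_var_commute[of mul_lam mul_lam mul_lam])
qed

lemma jacobi_from_const:
  assumes const: "\<And>a b c. a \<in> V \<Longrightarrow> b \<in> V \<Longrightarrow> c \<in> V \<Longrightarrow>
      jac_a_bc [:a:] [:b:] [:c:] = jac_ab_c [:a:] [:b:] [:c:] + jac_b_ac [:a:] [:b:] [:c:]"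
    and "p \<in> R" "q \<in> R" "r \<in> R"
  shows "jac_a_bc p q r = jac_ab_c p q r + jac_b_ac p q r"
proof -
  have c1: "jac_a_bc [:a:] [:b:] r = jac_ab_c [:a:] [:b:] r + jac_b_ac [:a:] [:b:] r"
    if "a \<in> V" "b \<in> V" "r \<in> R" for a b r
    using that(3)
    by (induction rule: polys_over_induct)
      (use that const in \<open>auto simp: jac_del_3 jac_add_3 op_add algebra_simps\<close>)
  have c2: "jac_a_bc [:a:] q r = jac_ab_c [:a:] q r + jac_b_ac [:a:] q r"
    if "a \<in> V" "q \<in> R" "r \<in> R" for a q r
    using that(2)
    by (induction rule: polys_over_induct)
      (use that c1 in \<open>auto simp: jac_del_2 jac_add_2 op_add algebra_simps\<close>)
  show ?thesis
    using assms(2)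
    by (induction rule: polys_over_induct)
      (use assms c2 in \<open>auto simp: jac_del_1 jac_add_1 op_add algebra_simps\<close>)
qed

lemma lb_const_left:
  assumes "a \<in> V" "x \<in> V" "y \<in> V"
  shows "lb [:a:] [:x, y:] = [: [:br a x, circ x a + br a y, circ y a:],
    [:star circ a x + br a y, circ y a + star circ a y:], [:star circ a y:] :]"
proof -
  have "lb [:a:] ([:x:] + pCons 0 [:y:]) = lb [:a:] [:x:] + lb [:a:] (pCons 0 [:y:])"
    using assms by (intro lb_add_right) auto
  then show ?thesis
    using assms lb_del_right[of "[:a:]" "[:y:]"]
    by (simp add: lb_const gd_bracket_base_def map_poly_pCons algebra_simps)
qed

lemma lb_const_right:
  assumes "c \<in> V" "x \<in> V" "y \<in> V"
  shows "lb [:x, y:] [:c:] = [: [:br x c, circ c x:],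
    [:star circ x c - br y c, - circ c y:], [:- star circ y c:] :]"
proof -
  have "lb ([:x:] + pCons 0 [:y:]) [:c:] = lb [:x:] [:c:] + lb (pCons 0 [:y:]) [:c:]"
    using assms by (intro lb_add_left) auto
  then show ?thesis
    using assms lb_del_left[of "[:y:]" "[:c:]"]
    by (simp add: lb_const gd_bracket_base_def)
qed

text \<open>
  The three terms on \<open>V\<close>, written as polynomials in \<open>\<mu>\<close> (outermost), \<open>\<lambda>\<close> and \<open>\<partial>\<close> (innermost).
\<close>

lemma jac_a_bc_const:
  assumes "a \<in> V" "b \<in> V" "c \<in> V"
  shows "jac_a_bc [:a:] [:b:] [:c:] = [:
    [: [:br a (br b c), circ (br b c) a + br a (circ c b), circ (circ c b) a:],
       [:star circ a (br b c) + br a (circ c b), circ (circ c b) a + star circ a (circ c b):],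
       [:star circ a (circ c b):] :],
    [: [:br a (star circ b c), circ (star circ b c) a:], [:star circ a (star circ b c):] :] :]"
  using assms
  by (simp add: jac_a_bc_def lb_const gd_bracket_base_def subst_jac_pCons lb_const_left)
    (simp add: in_lam_eq mul_mu_eq)

lemma jac_b_ac_const:
  assumes "a \<in> V" "b \<in> V" "c \<in> V"
  shows "jac_b_ac [:a:] [:b:] [:c:] = [:
    [: [:br b (br a c), circ (br a c) b + br b (circ c a), circ (circ c a) b:],
       [:br b (star circ a c), circ (star circ a c) b:] :],
    [: [:star circ b (br a c) + br b (circ c a), circ (circ c a) b + star circ b (circ c a):],
       [:star circ b (star circ a c):] :],
    [: [:star circ b (circ c a):] :] :]"
  using assms
  by (simp add: jac_b_ac_def lb_const gd_bracket_base_def subst_jac_pCons lb_const_left)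

lemma jac_ab_c_const:
  assumes "a \<in> V" "b \<in> V" "c \<in> V"
  shows "jac_ab_c [:a:] [:b:] [:c:] = [:
    [: [:br (br a b) c, circ c (br a b):],
       [:star circ (br a b) c - br (circ b a) c + br (star circ a b) c,
         circ c (star circ a b) - circ c (circ b a):],
       [:star circ (star circ a b) c - star circ (circ b a) c:] :],
    [: [:star circ (br a b) c - br (circ b a) c, - circ c (circ b a):],
       [:star circ (star circ a b) c - star circ (circ b a) c - star circ (circ b a) c:] :],
    [: [:- star circ (circ b a) c:] :] :]"
  using assms
  by (simp add: jac_ab_c_def lb_const gd_bracket_base_def subst_jac_pCons lb_const_right
      sum_op_pCons mul_mu_eq algebra_simps)

definition gd_identities :: bool where
  "gd_identities \<longleftrightarrow> (\<forall>a\<in>V. \<forall>b\<in>V. \<forall>c\<in>V.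
     circ (circ a b) c - circ a (circ b c) = circ (circ b a) c - circ b (circ a c) \<and>
     circ (circ a b) c = circ (circ a c) b \<and>
     br a (br b c) + br b (br c a) + br c (br a b) = 0 \<and>
     br (circ a b) c - br (circ a c) b + circ (br a b) c - circ (br a c) b
        - circ a (br b c) = 0)"

text \<open>
  All ten coefficients of the Jacobi identity, of degree at most two in \<open>\<lambda>\<close>, \<open>\<mu>\<close> and \<open>\<partial>\<close>, are
  consequences of the axioms: the terms of degree two of the Novikov identities, the linear ones of
  the compatibility condition, the constant one of the Jacobi identity.
\<close>

lemma jacobi_const_if_gd:
  assumes skew: "\<And>a b. a \<in> V \<Longrightarrow> b \<in> V \<Longrightarrow> br a b = - br b a"
    and gd_identities
    and V [simp]: "a \<in> V" "b \<in> V" "c \<in> V"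
  shows "jac_a_bc [:a:] [:b:] [:c:] = jac_ab_c [:a:] [:b:] [:c:] + jac_b_ac [:a:] [:b:] [:c:]"
proof -
  have gd: "circ (circ a b) c - circ a (circ b c) = circ (circ b a) c - circ b (circ a c)"
    "circ (circ a b) c = circ (circ a c) b"
    "br a (br b c) + br b (br c a) + br c (br a b) = 0"
    "br (circ a b) c - br (circ a c) b + circ (br a b) c - circ (br a c) b
        - circ a (br b c) = 0"
    if "a \<in> V" "b \<in> V" "c \<in> V" for a b c
    using \<open>gd_identities\<close> that by (auto simp: gd_identities_def)
  \<comment> \<open>The instances of the axioms are oriented so that they rewrite every term to a normal form.\<close>
  note rc = gd(2)[of c b a] gd(2)[of a b c] gd(2)[of b a c]
  have ls: "circ a (circ b c) = circ b (circ a c) + circ (circ a b) c - circ (circ b a) c"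
    "circ a (circ c b) = circ c (circ a b) + circ (circ a c) b - circ (circ c a) b"
    "circ c (circ b a) = circ b (circ c a) + circ (circ c b) a - circ (circ b c) a"
    using gd(1)[of a b c] gd(1)[of a c b] gd(1)[of c b a] by (simp_all add: algebra_simps)
  have sk: "br b (br c a) = - br b (br a c)" "br c (br a b) = - br (br a b) c"
    "br b (circ a c) = - br (circ a c) b" "br b (circ c a) = - br (circ c a) b"
    "br a (circ c b) = - br (circ c b) a" "br a (circ b c) = - br (circ b c) a"
    "br c b = - br b c" "br c a = - br a c" "br b a = - br a b"
    by (simp add: skew[of c a]) (rule skew; simp)+
  have g: "circ c (br a b) = br (circ c a) b - br (circ c b) a - circ (br a c) b + circ (br b c) a"
    "circ a (br b c) = br (circ a b) c - br (circ a c) b + circ (br a b) c - circ (br a c) b"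
    "circ b (br a c) = br (circ b a) c - br (circ b c) a - circ (br a b) c - circ (br b c) a"
    using gd(4)[of c a b] gd(4)[of a b c] gd(4)[of b a c] by (simp_all add: sk algebra_simps)
  have j: "br a (br b c) = br b (br a c) + br (br a b) c"
    using gd(3)[of a b c] by (simp add: sk algebra_simps)
  show ?thesis
    by (simp add: jac_a_bc_const jac_ab_c_const jac_b_ac_const star_def sk j)
      (simp add: rc ls g algebra_simps)
qed

text \<open>
  Conversely four coefficients suffice: \<open>\<partial>\<^sup>2\<close> gives right commutativity, then \<open>\<lambda>\<^sup>2\<close> left
  symmetry, \<open>\<partial>\<close> the compatibility condition, and the constant term the Jacobi identity.
\<close>

lemma gd_if_jacobi_const:
  assumes skew: "\<And>a b. a \<in> V \<Longrightarrow> b \<in> V \<Longrightarrow> br a b = - br b a"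
    and jac: "\<And>a b c. a \<in> V \<Longrightarrow> b \<in> V \<Longrightarrow> c \<in> V \<Longrightarrow>
      jac_a_bc [:a:] [:b:] [:c:] = jac_ab_c [:a:] [:b:] [:c:] + jac_b_ac [:a:] [:b:] [:c:]"
  shows gd_identities
proof -
  have coeffs: "circ (circ c b) a = circ (circ c a) b"
    "star circ a (circ c b) = star circ (star circ a b) c - star circ (circ b a) c"
    "br a (br b c) = br (br a b) c + br b (br a c)"
    "circ (br b c) a + br a (circ c b) = circ c (br a b) + (circ (br a c) b + br b (circ c a))"
    if "a \<in> V" "b \<in> V" "c \<in> V" for a b c
    using jac[OF that] that by (simp_all add: jac_a_bc_const jac_ab_c_const jac_b_ac_const)
  show ?thesis
    unfolding gd_identities_def
  proof (intro ballI conjI)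
    fix a b c assume V [simp]: "a \<in> V" "b \<in> V" "c \<in> V"
    show rc: "circ (circ a b) c = circ (circ a c) b"
      by (rule coeffs) simp_all
    show "circ (circ a b) c - circ a (circ b c) = circ (circ b a) c - circ b (circ a c)"
      using coeffs(2)[of a c b] coeffs(1)[of a c b] coeffs(1)[of b c a]
      by (simp add: star_def algebra_simps)
    show "br a (br b c) + br b (br c a) + br c (br a b) = 0"
      using coeffs(3)[of a b c] skew[of c a] skew[of c "br a b"] by simp
    show "br (circ a b) c - br (circ a c) b + circ (br a b) c - circ (br a c) b
        - circ a (br b c) = 0"
      using coeffs(4)[of b c a] skew[of "circ a b" c] skew[of "circ a c" b] skew[of b a] skew[of c a]
      by (simp add: algebra_simps)
  qed
qed

lemma jacobi_iff:
  assumes skew: "\<And>a b. a \<in> V \<Longrightarrow> b \<in> V \<Longrightarrow> br a b = - br b a"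
  shows "(\<forall>p\<in>R. \<forall>q\<in>R. \<forall>r\<in>R. jac_a_bc p q r = jac_ab_c p q r + jac_b_ac p q r) \<longleftrightarrow> gd_identities"
proof
  assume "\<forall>p\<in>R. \<forall>q\<in>R. \<forall>r\<in>R. jac_a_bc p q r = jac_ab_c p q r + jac_b_ac p q r"
  then show gd_identities
    using gd_if_jacobi_const[OF skew] by simp
next
  assume gd_identities
  then show "\<forall>p\<in>R. \<forall>q\<in>R. \<forall>r\<in>R. jac_a_bc p q r = jac_ab_c p q r + jac_b_ac p q r"
    using jacobi_from_const[OF jacobi_const_if_gd[OF skew]] by simp
qed

end


section \<open>Sesquilinear extensions\<close>

text \<open>
  The extension of a map \<open>\<beta>\<close> on \<open>U \<times> V\<close> by \<open>(\<partial>\<^sup>i a, \<partial>\<^sup>j b) \<mapsto> S\<^sup>i T\<^sup>j (\<beta> a b)\<close>.  The action of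
  \<open>k[\<partial>]\<close>, the extension of a bilinear form and the bracket of \<open>k[\<partial>]V\<close> are all of this kind,
  with different operators \<open>S\<close> and \<open>T\<close>.
\<close>

definition sesq_ext ::
  "('w \<Rightarrow> 'w) \<Rightarrow> ('w \<Rightarrow> 'w) \<Rightarrow> ('u \<Rightarrow> 'v \<Rightarrow> 'w) \<Rightarrow> 'u::zero poly \<Rightarrow> 'v::zero poly \<Rightarrow> 'w::comm_monoid_add" where
  "sesq_ext S T \<beta> p q = subst_var S (\<lambda>a. subst_var T (\<beta> a) q) p"

locale sesquilinear_extension =
  fixes U :: "'u::ab_group_add set" and V :: "'v::ab_group_add set"
    and S T :: "'w::ab_group_add \<Rightarrow> 'w" and \<beta> :: "'u \<Rightarrow> 'v \<Rightarrow> 'w"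
  assumes additive_S: "additive S" and additive_T: "additive T"
    and commute: "\<And>x. S (T x) = T (S x)"
    and zero_U: "0 \<in> U" and zero_V: "0 \<in> V"
    and \<beta>_right: "\<And>a. a \<in> U \<Longrightarrow> additive_on V (\<beta> a)"
    and \<beta>_left: "\<And>b. b \<in> V \<Longrightarrow> additive_on U (\<lambda>a. \<beta> a b)"
begin

lemma \<beta>_0: "a \<in> U \<Longrightarrow> \<beta> a 0 = 0" "b \<in> V \<Longrightarrow> \<beta> 0 b = 0"
  using additive_on_0[OF \<beta>_right zero_V] additive_on_0[OF \<beta>_left zero_U] by auto

lemma inner_additive_left: "q \<in> polys_over V \<Longrightarrow> additive_on U (\<lambda>a. subst_var T (\<beta> a) q)"
proof (rule additive_onI)
  fix a a' assume "q \<in> polys_over V" "a \<in> U" "a' \<in> U"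
  then have "subst_var T (\<beta> (a + a')) q = subst_var T (\<lambda>b. \<beta> a b + \<beta> a' b) q"
    by (intro subst_var_polys_cong) (auto intro: additive_on_add[OF \<beta>_left])
  then show "subst_var T (\<beta> (a + a')) q = subst_var T (\<beta> a) q + subst_var T (\<beta> a') q"
    by (simp add: subst_var_plus additive_T)
qed

lemma inner_0: "q \<in> polys_over V \<Longrightarrow> subst_var T (\<beta> 0) q = 0"
  using additive_on_0[OF inner_additive_left zero_U] .

lemma add_left:
  "p \<in> polys_over U \<Longrightarrow> p' \<in> polys_over U \<Longrightarrow> q \<in> polys_over V \<Longrightarrow>
    sesq_ext S T \<beta> (p + p') q = sesq_ext S T \<beta> p q + sesq_ext S T \<beta> p' q"
  unfolding sesq_ext_def
  by (rule subst_var_add[OF additive_S inner_additive_left zero_U])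

lemma add_right:
  assumes "p \<in> polys_over U" "q \<in> polys_over V" "q' \<in> polys_over V"
  shows "sesq_ext S T \<beta> p (q + q') = sesq_ext S T \<beta> p q + sesq_ext S T \<beta> p q'"
proof -
  have "sesq_ext S T \<beta> p (q + q')
      = subst_var S (\<lambda>a. subst_var T (\<beta> a) q + subst_var T (\<beta> a) q') p"
    unfolding sesq_ext_def using assms(1)
    by (rule subst_var_polys_cong)
      (use assms in \<open>auto intro: subst_var_add[OF additive_T \<beta>_right zero_V]\<close>)
  then show ?thesis
    by (simp add: subst_var_plus additive_S sesq_ext_def)
qed

lemma del_left:
  "q \<in> polys_over V \<Longrightarrow> sesq_ext S T \<beta> (pCons 0 p) q = S (sesq_ext S T \<beta> p q)"
  by (simp add: sesq_ext_def subst_var_pCons additive_S inner_0)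

lemma del_right:
  assumes "p \<in> polys_over U" "q \<in> polys_over V"
  shows "sesq_ext S T \<beta> p (pCons 0 q) = T (sesq_ext S T \<beta> p q)"
proof -
  have "sesq_ext S T \<beta> p (pCons 0 q) = subst_var S (\<lambda>a. T (subst_var T (\<beta> a) q)) p"
    unfolding sesq_ext_def using assms(1)
    by (rule subst_var_polys_cong) (simp add: subst_var_pCons additive_T \<beta>_0)
  also have "\<dots> = T (sesq_ext S T \<beta> p q)"
    by (simp add: sesq_ext_def subst_var_commute[of T S S] additive_T commute)
  finally show ?thesis .
qed

lemma const: "a \<in> U \<Longrightarrow> b \<in> V \<Longrightarrow> sesq_ext S T \<beta> [:a:] [:b:] = \<beta> a b"
  using zero_V by (simp add: sesq_ext_def subst_var_pCons additive_S additive_T \<beta>_0 inner_0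
      additive_0[OF additive_S] additive_0[OF additive_T])

end

lemma pCons_funpow_const: "(pCons 0 ^^ n) [:a:] = monom a n"
  by (induction n) (simp_all add: monom_Suc monom_0)

lemma pCons_funpow_monom: "(pCons 0 ^^ n) (monom a j) = monom a (n + j)"
  by (induction n) (simp_all add: monom_Suc)

lemma poly_scale_eq_sesq_ext:
  "poly_scale s p q = sesq_ext (pCons 0) (pCons 0) (\<lambda>c x. [:s c x:]) p q"
proof -
  have "(pCons 0 ^^ i) (\<Sum>j\<le>degree q. (pCons 0 ^^ j) [:f j:]) = (\<Sum>j\<le>degree q. monom (f j) (i + j))"
    for i and f :: "nat \<Rightarrow> 'a"
    by (simp add: additive_sum[OF additive_funpow[OF additive_pCons]] pCons_funpow_const
        pCons_funpow_monom)
  then show ?thesis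
    by (simp add: poly_scale_def sesq_ext_def subst_var_def)
qed

lemma extend_form_eq_sesq_ext:
  fixes form :: "'v::zero \<Rightarrow> 'v \<Rightarrow> 'k::field"
  shows "extend_form form p q = sesq_ext (\<lambda>x. - pCons 0 x) (pCons 0) (\<lambda>a b. [:form a b:]) p q"
proof -
  have S: "((\<lambda>x. - pCons 0 x) ^^ i) x = [:0, -1:] ^ i * x" for i and x :: "'k poly"
    by (induction i) (simp_all add: ac_simps)
  have T: "(pCons 0 ^^ i) x = [:0, 1:] ^ i * x" for i and x :: "'k poly"
    by (induction i) (simp_all add: ac_simps)
  show ?thesis
    unfolding extend_form_def sesq_ext_def subst_var_def S T
    by (simp add: sum_distrib_left mult.assoc
       del: mult_pCons_left mult_pCons_right)
qed

lemma gd_bracket_eq_sesq_ext: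
  "gd_bracket circ br p q = sesq_ext (\<lambda>r. - pCons 0 r) (\<lambda>r. pCons 0 r + map_poly (pCons 0) r)
    (gd_bracket_base circ br) p q"
proof -
  have "additive (\<lambda>r :: 'a poly poly. - pCons 0 r)"
    by (intro additive_intros)
  then show ?thesis
    by (simp add: gd_bracket_def sesq_ext_def subst_var_def additive_sum[OF additive_funpow])
qed


section \<open>Invariance of the conformal form\<close>

locale sesquilinear_pairing =
  fixes V :: "'v::ab_group_add set"
    and \<phi> :: "'v \<Rightarrow> 'v \<Rightarrow> 'k::field"
  assumes zero_mem: "0 \<in> V"
    and \<phi>_left: "\<And>y. y \<in> V \<Longrightarrow> additive_on V (\<lambda>x. \<phi> x y)"
    and \<phi>_right: "\<And>x. x \<in> V \<Longrightarrow> additive_on V (\<phi> x)"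
begin

abbreviation "F \<equiv> extend_form \<phi>"

sublocale ext: sesquilinear_extension V V "\<lambda>x :: 'k poly. - pCons 0 x" "pCons 0" "\<lambda>a b. [:\<phi> a b:]"
proof
  show "additive (\<lambda>x :: 'k poly. - pCons 0 x)" "additive (pCons 0 :: 'k poly \<Rightarrow> 'k poly)"
    by (intro additive_intros)+
qed (use \<phi>_left \<phi>_right in \<open>auto simp: additive_on_def zero_mem\<close>)

lemma F_add_left:
  "p \<in> polys_over V \<Longrightarrow> p' \<in> polys_over V \<Longrightarrow> q \<in> polys_over V \<Longrightarrow> F (p + p') q = F p q + F p' q"
  and F_add_right:
  "p \<in> polys_over V \<Longrightarrow> q \<in> polys_over V \<Longrightarrow> q' \<in> polys_over V \<Longrightarrow> F p (q + q') = F p q + F p q'"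
  and F_del_left: "q \<in> polys_over V \<Longrightarrow> F (pCons 0 p) q = - pCons 0 (F p q)"
  and F_del_right: "p \<in> polys_over V \<Longrightarrow> q \<in> polys_over V \<Longrightarrow> F p (pCons 0 q) = pCons 0 (F p q)"
  and F_const: "a \<in> V \<Longrightarrow> b \<in> V \<Longrightarrow> F [:a:] [:b:] = [:\<phi> a b:]"
  unfolding extend_form_eq_sesq_ext
  by (rule ext.add_left ext.add_right ext.del_left ext.del_right ext.const; assumption)+

lemma F_additive_left: "q \<in> polys_over V \<Longrightarrow> additive_on (polys_over V) (\<lambda>p. F p q)"
  and F_additive_right: "p \<in> polys_over V \<Longrightarrow> additive_on (polys_over V) (F p)"
  by (auto intro!: additive_onI simp: F_add_left F_add_right)

lemma F_0: "p \<in> polys_over V \<Longrightarrow> F 0 p = 0" "p \<in> polys_over V \<Longrightarrow> F p 0 = 0"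
  using additive_on_0[OF F_additive_left] additive_on_0[OF F_additive_right] zero_mem by auto

lemma F_const_left:
  assumes a: "a \<in> V" and "q \<in> polys_over V"
  shows "F [:a:] q = map_poly (\<phi> a) q"
proof -
  have 0: "\<phi> a 0 = 0" using additive_on_0[OF \<phi>_right[OF a] zero_mem] .
  have "map_poly (\<phi> a) (p + q) = map_poly (\<phi> a) p + map_poly (\<phi> a) q"
    if "p \<in> polys_over V" "q \<in> polys_over V" for p q
    using that by (intro poly_eqI)
      (simp add: coeff_map_poly 0 additive_on_add[OF \<phi>_right[OF a]] polys_over_coeff)
  with assms(2) show ?thesis
    by (induction rule: polys_over_induct)
      (use a zero_mem in \<open>auto simp: F_const F_del_right F_add_right map_poly_pCons 0\<close>)
qed

end

locale bracket_with_pairing =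
  sesquilinear_bracket V circ br lb + pairing: sesquilinear_pairing V \<phi>
  for V :: "'a::ab_group_add set" and circ br lb and \<phi> :: "'a \<Rightarrow> 'a \<Rightarrow> 'k::field" +
  assumes \<phi>_sym: "\<And>a b. a \<in> V \<Longrightarrow> b \<in> V \<Longrightarrow> \<phi> a b = \<phi> b a"
begin

abbreviation "F \<equiv> extend_form \<phi>"

definition form_ab_c :: "'a poly \<Rightarrow> 'a poly \<Rightarrow> 'a poly \<Rightarrow> 'k poly poly" where
  "form_ab_c a b c = subst_var mul_mu (\<lambda>x. in_lam (F x c)) (lb a b)"

definition form_a_bc :: "'a poly \<Rightarrow> 'a poly \<Rightarrow> 'a poly \<Rightarrow> 'k poly poly" where
  "form_a_bc a b c = subst_var mul_lam (\<lambda>x. in_mu (F a x)) (shift_op (lb b c))"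

lemma minus_mem [simp]: "x \<in> V \<Longrightarrow> y \<in> V \<Longrightarrow> x - y \<in> V"
  using add_mem[of x "- y"] by simp

lemma shift_op_mem: "P \<in> polys_over R \<Longrightarrow> shift_op P \<in> polys_over R"
  unfolding shift_op_def subst_lambda_def
  by (erule subst_var_closed)
    (auto simp: polys_over_def coeff_map_poly coeff_pCons split: nat.splits)

lemma additive_on_form_maps:
  assumes "c \<in> R"
  shows "additive_on R (\<lambda>x. in_lam (F x c))" "additive_on R (\<lambda>x. in_mu (F c x))"
  using assms
  by (auto intro!: additive_onI simp: pairing.F_add_left pairing.F_add_right op_add)

lemma subst_form_add:
  assumes "c \<in> R" "P \<in> polys_over R" "Q \<in> polys_over R"
  shows "subst_var mul_mu (\<lambda>x. in_lam (F x c)) (P + Q) =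
      subst_var mul_mu (\<lambda>x. in_lam (F x c)) P + subst_var mul_mu (\<lambda>x. in_lam (F x c)) Q"
    "subst_var mul_lam (\<lambda>x. in_mu (F c x)) (P + Q) =
      subst_var mul_lam (\<lambda>x. in_mu (F c x)) P + subst_var mul_lam (\<lambda>x. in_mu (F c x)) Q"
  using assms by (intro subst_var_add[where V = R] additive_intros additive_on_form_maps; simp)+

lemma subst_form_uminus:
  assumes "c \<in> R" "P \<in> polys_over R"
  shows "subst_var mul_mu (\<lambda>x. in_lam (F x c)) (- P) = - subst_var mul_mu (\<lambda>x. in_lam (F x c)) P"
    "subst_var mul_lam (\<lambda>x. in_mu (F c x)) (- P) = - subst_var mul_lam (\<lambda>x. in_mu (F c x)) P"
  using assms by (intro subst_var_uminus[where V = R] additive_intros additive_on_form_maps; simp)+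

lemma subst_form_pCons:
  assumes "c \<in> R"
  shows "subst_var mul_mu (\<lambda>x. in_lam (F x c)) (pCons p P) =
      in_lam (F p c) + mul_mu (subst_var mul_mu (\<lambda>x. in_lam (F x c)) P)"
    "subst_var mul_lam (\<lambda>x. in_mu (F c x)) (pCons p P) =
      in_mu (F c p) + mul_lam (subst_var mul_lam (\<lambda>x. in_mu (F c x)) P)"
  using assms by (intro subst_var_pCons additive_intros; simp add: pairing.F_0)+

lemma subst_form_del:
  assumes "c \<in> R" "P \<in> polys_over R"
  shows "subst_var mul_mu (\<lambda>x. in_lam (F x c)) (map_poly (pCons 0) P) =
      - mul_lam (subst_var mul_mu (\<lambda>x. in_lam (F x c)) P)"
    "subst_var mul_lam (\<lambda>x. in_mu (F c x)) (map_poly (pCons 0) P) =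
      mul_mu (subst_var mul_lam (\<lambda>x. in_mu (F c x)) P)"
proof -
  have "subst_var mul_mu (\<lambda>x. in_lam (F x c)) (map_poly (pCons 0) P) =
      subst_var mul_mu (\<lambda>x. in_lam (F (pCons 0 x) c)) P"
    using assms by (simp add: subst_var_map_poly additive_intros pairing.F_0)
  also have "\<dots> = subst_var mul_mu (\<lambda>x. - mul_lam (in_lam (F x c))) P"
    by (rule subst_var_polys_cong[OF assms(2)])
      (use assms in \<open>simp add: pairing.F_del_left op_uminus in_lam_pCons del: minus_pCons\<close>)
  finally show "subst_var mul_mu (\<lambda>x. in_lam (F x c)) (map_poly (pCons 0) P) =
      - mul_lam (subst_var mul_mu (\<lambda>x. in_lam (F x c)) P)"
    by (simp add: subst_var_neg additive_intros subst_var_commute[of mul_lam mul_mu mul_mu] mul_lam_mu)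
  have "subst_var mul_lam (\<lambda>x. in_mu (F c x)) (map_poly (pCons 0) P) =
      subst_var mul_lam (\<lambda>x. in_mu (F c (pCons 0 x))) P"
    using assms by (simp add: subst_var_map_poly additive_intros pairing.F_0)
  also have "\<dots> = subst_var mul_lam (\<lambda>x. mul_mu (in_mu (F c x))) P"
    by (rule subst_var_polys_cong[OF assms(2)])
      (use assms in \<open>simp add: pairing.F_del_right in_mu_pCons_0 del: in_mu_pCons\<close>)
  finally show "subst_var mul_lam (\<lambda>x. in_mu (F c x)) (map_poly (pCons 0) P) =
      mul_mu (subst_var mul_lam (\<lambda>x. in_mu (F c x)) P)"
    by (simp add: additive_intros subst_var_commute[of mul_mu mul_lam mul_lam] mul_lam_mu)
qed

text \<open>
  Both sides of the invariance condition are multiplied by \<open>-\<mu>\<close>, \<open>\<mu> - \<lambda>\<close> and \<open>\<lambda>\<close> when \<open>\<partial>\<close> is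
  applied to the first, second and third argument.
\<close>

lemma form_del_1:
  assumes "a \<in> R" "b \<in> R" "c \<in> R"
  shows "form_ab_c (pCons 0 a) b c = - mul_mu (form_ab_c a b c)"
    "form_a_bc (pCons 0 a) b c = - mul_mu (form_a_bc a b c)"
proof -
  have "form_a_bc (pCons 0 a) b c = subst_var mul_lam (\<lambda>x. - mul_mu (in_mu (F a x))) (shift_op (lb b c))"
    unfolding form_a_bc_def by (rule subst_var_polys_cong[where V = R])
      (use assms in \<open>auto simp: lb_mem shift_op_mem pairing.F_del_left op_uminus in_mu_pCons_0
        simp del: minus_pCons in_mu_pCons\<close>)
  then show "form_a_bc (pCons 0 a) b c = - mul_mu (form_a_bc a b c)"
    by (simp add: form_a_bc_def subst_var_neg additive_intros
        subst_var_commute[of mul_mu mul_lam mul_lam] mul_lam_mu)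
qed (use assms in \<open>simp add: form_ab_c_def lb_del_left subst_form_uminus subst_form_pCons pairing.F_0 lb_mem
      del: minus_pCons\<close>)

lemma form_del_2:
  assumes "a \<in> R" "b \<in> R" "c \<in> R"
  shows "form_ab_c a (pCons 0 b) c = mul_mu (form_ab_c a b c) - mul_lam (form_ab_c a b c)"
    "form_a_bc a (pCons 0 b) c = mul_mu (form_a_bc a b c) - mul_lam (form_a_bc a b c)"
proof -
  show "form_ab_c a (pCons 0 b) c = mul_mu (form_ab_c a b c) - mul_lam (form_ab_c a b c)"
    using assms by (simp add: form_ab_c_def lb_del_right subst_form_add subst_form_pCons pairing.F_0 subst_form_del
        lb_mem polys_del_mem)
  define P where "P = shift_op (lb b c)"
  have P: "P \<in> polys_over R"
    unfolding P_def using assms by (intro shift_op_mem lb_mem)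
  have *: "shift_op (lb (pCons 0 b) c) = map_poly (pCons 0) P + - pCons 0 P"
    using assms unfolding lb_del_left[OF assms(2,3)] additive_uminus[OF additive_shift_op]
    by (simp add: shift_op_pCons P_def)
  have "form_a_bc a (pCons 0 b) c = subst_var mul_lam (\<lambda>x. in_mu (F a x)) (map_poly (pCons 0) P)
      + subst_var mul_lam (\<lambda>x. in_mu (F a x)) (- pCons 0 P)"
    unfolding form_a_bc_def * using assms P by (intro subst_form_add) (auto simp: polys_del_mem polys_over_uminus)
  then show "form_a_bc a (pCons 0 b) c = mul_mu (form_a_bc a b c) - mul_lam (form_a_bc a b c)"
    using assms P by (simp add: form_a_bc_def subst_form_uminus subst_form_pCons pairing.F_0 subst_form_del
        flip: P_def del: minus_pCons)
qed

lemma form_del_3: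
  assumes "a \<in> R" "b \<in> R" "c \<in> R"
  shows "form_ab_c a b (pCons 0 c) = mul_lam (form_ab_c a b c)"
    "form_a_bc a b (pCons 0 c) = mul_lam (form_a_bc a b c)"
proof -
  have "form_ab_c a b (pCons 0 c) = subst_var mul_mu (\<lambda>x. mul_lam (in_lam (F x c))) (lb a b)"
    unfolding form_ab_c_def by (rule subst_var_polys_cong[where V = R])
      (use assms in \<open>auto simp: lb_mem pairing.F_del_right in_lam_pCons\<close>)
  then show "form_ab_c a b (pCons 0 c) = mul_lam (form_ab_c a b c)"
    by (simp add: form_ab_c_def subst_var_commute[of mul_lam mul_mu mul_mu] mul_lam_mu additive_intros)
  have "shift_op (lb b (pCons 0 c)) = pCons 0 (shift_op (lb b c))"
    using assms by (simp add: lb_del_right additive_add[OF additive_shift_op] shift_op_pCons shift_op_del)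
  then show "form_a_bc a b (pCons 0 c) = mul_lam (form_a_bc a b c)"
    using assms by (simp add: form_a_bc_def subst_form_pCons pairing.F_0)
qed

lemma form_add:
  assumes "a \<in> R" "a' \<in> R" "b \<in> R" "c \<in> R"
  shows "form_ab_c (a + a') b c = form_ab_c a b c + form_ab_c a' b c" "form_a_bc (a + a') b c = form_a_bc a b c + form_a_bc a' b c"
    "form_ab_c b (a + a') c = form_ab_c b a c + form_ab_c b a' c" "form_a_bc b (a + a') c = form_a_bc b a c + form_a_bc b a' c"
    "form_ab_c b c (a + a') = form_ab_c b c a + form_ab_c b c a'" "form_a_bc b c (a + a') = form_a_bc b c a + form_a_bc b c a'"
proof -
  have "form_a_bc (a + a') b c
      = subst_var mul_lam (\<lambda>x. in_mu (F a x) + in_mu (F a' x)) (shift_op (lb b c))"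
    unfolding form_a_bc_def by (rule subst_var_polys_cong[where V = R])
      (use assms in \<open>auto simp: lb_mem shift_op_mem pairing.F_add_left op_add\<close>)
  then show "form_a_bc (a + a') b c = form_a_bc a b c + form_a_bc a' b c"
    by (simp add: form_a_bc_def subst_var_plus additive_intros)
  have "form_ab_c b c (a + a') = subst_var mul_mu (\<lambda>x. in_lam (F x a) + in_lam (F x a')) (lb b c)"
    unfolding form_ab_c_def by (rule subst_var_polys_cong[where V = R])
      (use assms in \<open>auto simp: lb_mem pairing.F_add_right op_add\<close>)
  then show "form_ab_c b c (a + a') = form_ab_c b c a + form_ab_c b c a'"
    by (simp add: form_ab_c_def subst_var_plus additive_intros)
qed (use assms in \<open>simp_all add: form_ab_c_def form_a_bc_def lb_add_left lb_add_right lb_mem shift_op_mem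
      additive_add[OF additive_shift_op] subst_form_add\<close>)

lemma form_ab_c_const:
  assumes "a \<in> V" "b \<in> V" "c \<in> V"
  shows "form_ab_c [:a:] [:b:] [:c:] = [: [:\<phi> (br a b) c, - \<phi> (circ b a) c:], [:\<phi> (star circ a b) c:] :]"
proof -
  have "F ([:br a b:] + pCons 0 [:circ b a:]) [:c:] = F [:br a b:] [:c:] + F (pCons 0 [:circ b a:]) [:c:]"
    using assms by (intro pairing.F_add_left) auto
  then have "F [:br a b, circ b a:] [:c:] = [:\<phi> (br a b) c, - \<phi> (circ b a) c:]"
    using assms by (simp add: pairing.F_const pairing.F_del_left)
  then show ?thesis
    using assms by (simp add: form_ab_c_def lb_const gd_bracket_base_def subst_form_pCons pairing.F_const pairing.F_0)
      (simp add: in_lam_eq mul_mu_eq)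
qed

lemma form_a_bc_const:
  assumes "a \<in> V" "b \<in> V" "c \<in> V"
  shows "form_a_bc [:a:] [:b:] [:c:] =
    [: [:\<phi> a (br b c), \<phi> a (star circ b c):], [:\<phi> a (circ c b - star circ b c):] :]"
proof -
  have "shift_op (lb [:b:] [:c:]) = [: [:br b c, circ c b - star circ b c:], [:star circ b c:] :]"
    using assms by (simp add: lb_const gd_bracket_base_def shift_op_pCons map_poly_pCons)
  moreover have "circ c b - star circ b c \<in> V"
    using assms add_mem[of "circ c b" "- star circ b c"] by simp
  ultimately show ?thesis
    using assms additive_on_0[OF pairing.\<phi>_right]
    by (simp add: form_a_bc_def subst_form_pCons pairing.F_const_left map_poly_pCons)
qed

text \<open>
  On \<open>V\<close> the constant coefficient is the invariance of the bracket, and the coefficient of \<open>\<lambda>\<close> is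
  the invariance of the product.  The coefficient of \<open>\<mu>\<close> then follows, by symmetry of the form.
\<close>

lemma invariant_iff:
  "(\<forall>p\<in>R. \<forall>q\<in>R. \<forall>r\<in>R. form_ab_c p q r = form_a_bc p q r) \<longleftrightarrow>
    (\<forall>a\<in>V. \<forall>b\<in>V. \<forall>c\<in>V. \<phi> (circ a b) c = - \<phi> b (star circ a c) \<and> \<phi> (br a b) c = \<phi> a (br b c))"
    (is "?L \<longleftrightarrow> ?R")
proof -
  have "?L \<longleftrightarrow> (\<forall>a\<in>V. \<forall>b\<in>V. \<forall>c\<in>V. form_ab_c [:a:] [:b:] [:c:] = form_a_bc [:a:] [:b:] [:c:])" (is "_ \<longleftrightarrow> ?C")
  proof
    assume const: ?C
    have c1: "form_ab_c [:a:] [:b:] r = form_a_bc [:a:] [:b:] r" if "a \<in> V" "b \<in> V" "r \<in> R" for a b r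
      using that(3)
      by (induction rule: polys_over_induct)
        (use that const in \<open>auto simp: form_del_3 form_add\<close>)
    have c2: "form_ab_c [:a:] q r = form_a_bc [:a:] q r" if "a \<in> V" "q \<in> R" "r \<in> R" for a q r
      using that(2)
      by (induction rule: polys_over_induct)
        (use that c1 in \<open>auto simp: form_del_2 form_add\<close>)
    have "form_ab_c p q r = form_a_bc p q r" if "p \<in> R" "q \<in> R" "r \<in> R" for p q r
      using that(1)
      by (induction rule: polys_over_induct)
        (use that c2 in \<open>auto simp: form_del_1 form_add\<close>)
    then show ?L by blast
  qed auto
  also have "?C \<longleftrightarrow> ?R"
  proof
    assume C: ?C
    show ?R
    proof (intro ballI conjI)
      fix a b c assume V: "a \<in> V" "b \<in> V" "c \<in> V"
      show "\<phi> (circ a b) c = - \<phi> b (star circ a c)"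
        using C[rule_format, of b a c] V by (simp add: form_ab_c_const form_a_bc_const neg_eq_iff_add_eq_0 eq_neg_iff_add_eq_0)
      show "\<phi> (br a b) c = \<phi> a (br b c)"
        using C[rule_format, of a b c] V by (simp add: form_ab_c_const form_a_bc_const)
    qed
  next
    assume r: ?R
    show ?C
    proof (intro ballI)
      fix a b c assume V: "a \<in> V" "b \<in> V" "c \<in> V"
      have m: "circ c b - star circ b c = - circ b c"
        by (simp add: star_def)
      have "\<phi> (circ c b) a = - \<phi> b (star circ c a)" "\<phi> (circ a b) c = - \<phi> b (star circ a c)"
        "\<phi> (circ b a) c = - \<phi> a (star circ b c)" "\<phi> (circ b c) a = - \<phi> c (star circ b a)"
        "\<phi> (br a b) c = \<phi> a (br b c)"
        using r V by blast+
      moreover have "\<phi> (star circ a b) c = \<phi> c (star circ b a)"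
        using V \<phi>_sym[of "star circ a b" c] by (simp add: star_def add.commute)
      moreover have "\<phi> a (- circ b c) = - \<phi> (circ b c) a"
        using V \<phi>_sym[of a "circ b c"] additive_on_uminus[OF pairing.\<phi>_right] by simp
      ultimately show "form_ab_c [:a:] [:b:] [:c:] = form_a_bc [:a:] [:b:] [:c:]"
        using V by (simp add: form_ab_c_const form_a_bc_const m)
    qed
  qed
  finally show ?thesis .
qed

end


section \<open>The module \<open>k[\<partial>]V\<close>\<close>

context vector_space
begin

sublocale scaling: sesquilinear_extension UNIV UNIV "pCons 0" "pCons 0" "\<lambda>c x. [:scale c x:]"
  by unfold_locales
    (auto simp: additive_on_def scale_right_distrib scale_left_distrib intro!: additive_intros)

lemma polys_over_UNIV [simp]: "p \<in> polys_over UNIV"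
  by (simp add: polys_over_def)

lemma poly_scale_add_left: "poly_scale scale (p + p') q = poly_scale scale p q + poly_scale scale p' q"
  and poly_scale_add_right: "poly_scale scale p (q + q') = poly_scale scale p q + poly_scale scale p q'"
  and poly_scale_del_left: "poly_scale scale (pCons 0 p) q = pCons 0 (poly_scale scale p q)"
  and poly_scale_del_right: "poly_scale scale p (pCons 0 q) = pCons 0 (poly_scale scale p q)"
  and poly_scale_const_const: "poly_scale scale [:c:] [:x:] = [:scale c x:]"
  unfolding poly_scale_eq_sesq_ext
  by (rule scaling.add_left scaling.add_right scaling.del_left scaling.del_right scaling.const; simp)+

lemma additive_scale: "additive (scale c)"
  by (simp add: additive_on_def scale_right_distrib)

lemma additive_poly_scale: "additive (poly_scale scale p)"
  by (simp add: additive_on_def poly_scale_add_right)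

lemma poly_scale_0_right [simp]: "poly_scale scale p 0 = 0"
  by (rule additive_0[OF additive_poly_scale])

lemma poly_scale_const: "poly_scale scale [:c:] q = map_poly (scale c) q"
  by (induction q rule: polys_over_induct[where V = UNIV, simplified])
    (simp_all add: poly_scale_const_const poly_scale_del_right poly_scale_add_right map_poly_pCons
      additive_add[OF additive_map_poly[OF additive_scale]])

lemma poly_scale_pCons:
  "poly_scale scale (pCons c p) q = map_poly (scale c) q + pCons 0 (poly_scale scale p q)"
  using poly_scale_add_left[of "[:c:]" "pCons 0 p" q]
  by (simp add: poly_scale_const poly_scale_del_left)

lemma poly_scale_0_left [simp]: "poly_scale scale 0 q = 0"
  using poly_scale_add_left[of 0 0 q] by simp

lemma map_poly_scale_0 [simp]: "map_poly (scale 0) q = 0"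
  and map_poly_scale_1 [simp]: "map_poly (scale 1) q = q"
  by (rule poly_eqI; simp add: coeff_map_poly)+

lemma del_poly_scale: "poly_scale scale [:0, 1:] q = pCons 0 q"
  by (simp add: poly_scale_pCons)

lemma map_poly_scale_poly_scale:
  "map_poly (scale c) (poly_scale scale q r) = poly_scale scale (smult c q) r"
proof (induction q)
  case (pCons d q)
  have "map_poly (scale c) (map_poly (scale d) r) = map_poly (scale (c * d)) r"
    by (rule poly_eqI) (simp add: coeff_map_poly)
  with pCons show ?case
    by (simp add: poly_scale_pCons additive_add[OF additive_map_poly[OF additive_scale]] map_poly_pCons)
qed simp

lemma module_poly_scale: "module (poly_scale scale)"
proof
  fix p q :: "'a poly" and r
  show "poly_scale scale p (poly_scale scale q r) = poly_scale scale (p * q) r"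
    by (induction p)
      (simp_all add: poly_scale_pCons poly_scale_add_left map_poly_scale_poly_scale)
  show "poly_scale scale 1 r = r"
    by (simp add: one_pCons poly_scale_const)
qed (simp_all add: poly_scale_add_left poly_scale_add_right)

lemma poly_scale_mem:
  assumes "subspace V" "q \<in> polys_over V"
  shows "poly_scale scale p q \<in> polys_over V"
proof (induction p)
  case (pCons c p)
  have "map_poly (scale c) q \<in> polys_over V"
    using assms by (simp add: polys_over_def coeff_map_poly subspace_scale)
  with pCons show ?case
    using assms(1) by (auto simp: poly_scale_pCons polys_over_def coeff_pCons subspace_0
        intro!: subspace_add split: nat.splits)
qed (use assms in \<open>simp add: polys_over_def subspace_0\<close>)

lemma subspace_polys_over: "subspace V \<Longrightarrow> module.subspace (poly_scale scale) (polys_over V)"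
  unfolding module.subspace_def[OF module_poly_scale]
  by (auto simp: poly_scale_mem) (auto simp: polys_over_def subspace_0 subspace_add)

text \<open>
  In particular \<open>k[\<partial>]V\<close> is finitely generated if \<open>V\<close> is finite-dimensional.
\<close>

lemma span_polys_over:
  "module.span (poly_scale scale) ((\<lambda>b. [:b:]) ` B) = polys_over (span B)"
proof -
  interpret P: module "poly_scale scale" by (rule module_poly_scale)
  show ?thesis
  proof
    have "(\<lambda>b. [:b:]) ` B \<subseteq> polys_over (span B)"
      by (auto simp: span_base span_zero)
    then show "P.span ((\<lambda>b. [:b:]) ` B) \<subseteq> polys_over (span B)"
      by (intro P.span_minimal subspace_polys_over) auto
    have c: "[:v:] \<in> P.span ((\<lambda>b. [:b:]) ` B)" if "v \<in> span B" for v
      using that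
    proof (induction rule: span_induct_alt)
      case base
      show ?case using P.span_zero by simp
    next
      case (step c x y)
      then have "poly_scale scale [:c:] [:x:] + [:y:] \<in> P.span ((\<lambda>b. [:b:]) ` B)"
        by (intro P.span_add P.span_scale) (auto intro: P.span_base)
      then show ?case by (simp add: poly_scale_const_const)
    qed
    show "polys_over (span B) \<subseteq> P.span ((\<lambda>b. [:b:]) ` B)"
    proof
      fix p assume "p \<in> polys_over (span B)"
      then show "p \<in> P.span ((\<lambda>b. [:b:]) ` B)"
        by (induction rule: polys_over_induct)
          (auto intro: c P.span_add P.span_scale[of _ _ "[:0, 1:]", unfolded del_poly_scale])
    qed
  qed
qed

end

lemma map_poly_image_polys_over:
  assumes "i 0 = 0" "0 \<in> V" "inj i"
  shows "map_poly i ` polys_over V = polys_over (i ` V)"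
proof
  show "map_poly i ` polys_over V \<subseteq> polys_over (i ` V)"
    using assms by (auto simp: polys_over_def coeff_map_poly)
  show "polys_over (i ` V) \<subseteq> map_poly i ` polys_over V"
  proof
    fix p assume p: "p \<in> polys_over (i ` V)"
    have inv0: "inv i 0 = 0" using assms(1,3) by (metis inv_f_f)
    have "p = map_poly i (map_poly (inv i) p)"
    proof (rule poly_eqI)
      fix n
      have "coeff p n \<in> i ` V" using p by (simp add: polys_over_def)
      then show "coeff p n = coeff (map_poly i (map_poly (inv i) p)) n"
        using assms inv0 by (auto simp: coeff_map_poly)
    qed
    moreover have "map_poly (inv i) p \<in> polys_over V"
      unfolding polys_over_def
    proof (intro CollectI allI)
      fix n
      obtain v where "v \<in> V" "coeff p n = i v" using p by (auto simp: polys_over_def)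
      then show "coeff (map_poly (inv i) p) n \<in> V"
        using assms(3) by (simp add: coeff_map_poly inv0)
    qed
    ultimately show "p \<in> map_poly i ` polys_over V" by blast
  qed
qed


section \<open>The Lie conformal algebra of a Gel'fand-Dorfman algebra\<close>

text \<open>
  A map that respects the operations on \<open>V\<close> respects the brackets.  Allowing three maps covers two
  uses: all of them equal to an embedding of Gel'fand-Dorfman algebras, or one factor and the result
  multiplied by a scalar, which yields homogeneity of the bracket.
\<close>

lemma bracket_transfer:
  assumes "sesquilinear_bracket V circ br lb" "sesquilinear_bracket W circ' br' lb'"
    and add: "additive h" "additive h1" "additive h2"
    and mem: "\<And>a. a \<in> V \<Longrightarrow> h1 a \<in> W" "\<And>a. a \<in> V \<Longrightarrow> h2 a \<in> W"
    and hom: "\<And>a b. a \<in> V \<Longrightarrow> b \<in> V \<Longrightarrow> circ' (h1 a) (h2 b) = h (circ a b)"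
      "\<And>a b. a \<in> V \<Longrightarrow> b \<in> V \<Longrightarrow> circ' (h2 b) (h1 a) = h (circ b a)"
      "\<And>a b. a \<in> V \<Longrightarrow> b \<in> V \<Longrightarrow> br' (h1 a) (h2 b) = h (br a b)"
    and p: "p \<in> polys_over V" and q: "q \<in> polys_over V"
  shows "lb' (map_poly h1 p) (map_poly h2 q) = map_poly (map_poly h) (lb p q)"
proof -
  interpret V: sesquilinear_bracket V circ br lb by fact
  interpret W: sesquilinear_bracket W circ' br' lb' by fact
  have 0: "h 0 = 0" "h1 0 = 0" "h2 0 = 0"
    using add by (simp_all add: additive_0)
  have map_mem: "map_poly h1 p \<in> polys_over W" "map_poly h2 p \<in> polys_over W"
    if "p \<in> polys_over V" for p
    using that mem 0 by (simp_all add: polys_over_def coeff_map_poly)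
  have map_del: "map_poly (map_poly h) (map_poly (pCons 0) P) = map_poly (pCons 0) (map_poly (map_poly h) P)" for P
    by (rule poly_eqI) (simp add: coeff_map_poly map_poly_pCons 0)
  note map_add = additive_add[OF additive_map_poly[OF additive_map_poly[OF add(1)]]]
    additive_uminus[OF additive_map_poly[OF additive_map_poly[OF add(1)]]]
    additive_add[OF additive_map_poly[OF add(2)]] additive_add[OF additive_map_poly[OF add(3)]]
  have const_left: "lb' (map_poly h1 [:a:]) (map_poly h2 q) = map_poly (map_poly h) (lb [:a:] q)"
    if "a \<in> V" for a
    using q
  proof (induction rule: polys_over_induct)
    case (const b)
    then show ?case
      using that by (simp add: V.lb_const W.lb_const gd_bracket_base_def map_poly_pCons 0 mem hom
          star_def additive_add[OF add(1)])
  next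
    case (del q)
    have "lb' (map_poly h1 [:a:]) (map_poly h2 (pCons 0 q))
        = pCons 0 (lb' (map_poly h1 [:a:]) (map_poly h2 q))
          + map_poly (pCons 0) (lb' (map_poly h1 [:a:]) (map_poly h2 q))"
      using that del(1) by (subst map_poly_pCons) (simp_all add: 0 W.lb_del_right map_mem)
    then show ?case
      unfolding del(2) using that del(1)
      by (simp add: V.lb_del_right map_add map_poly_pCons 0 map_del)
  next
    case (add q q')
    have "lb' (map_poly h1 [:a:]) (map_poly h2 (q + q'))
        = lb' (map_poly h1 [:a:]) (map_poly h2 q) + lb' (map_poly h1 [:a:]) (map_poly h2 q')"
      unfolding map_add using that add(1,2) by (intro W.lb_add_right map_mem) auto
    then show ?case
      unfolding add using that add(1,2) by (simp add: V.lb_add_right map_add)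
  qed
  show ?thesis
    using p
  proof (induction rule: polys_over_induct)
    case (const a)
    then show ?case by (rule const_left)
  next
    case (del p)
    have "lb' (map_poly h1 (pCons 0 p)) (map_poly h2 q) = - pCons 0 (lb' (map_poly h1 p) (map_poly h2 q))"
      using del(1) q by (subst map_poly_pCons) (simp_all add: 0 W.lb_del_left map_mem)
    then show ?case
      unfolding del(2) using del(1) q
      by (simp add: V.lb_del_left map_add map_poly_pCons 0 del: minus_pCons)
  next
    case (add p p')
    have "lb' (map_poly h1 (p + p')) (map_poly h2 q)
        = lb' (map_poly h1 p) (map_poly h2 q) + lb' (map_poly h1 p') (map_poly h2 q)"
      unfolding map_add using q add(1,2) by (intro W.lb_add_left map_mem) auto
    then show ?case
      unfolding add using q add(1,2) by (simp add: V.lb_add_left map_add)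
  qed
qed

lemma linear_on_additive: "linear_on s s' V f \<Longrightarrow> additive_on V f"
  by (simp add: linear_on_def additive_on_def)

lemma bilinear_on_additive:
  assumes "bilinear_on s s' V b" "x \<in> V"
  shows "additive_on V (b x)" "additive_on V (\<lambda>y. b y x)"
  using assms by (auto simp: bilinear_on_def dest: linear_on_additive)

lemma (in vector_space) sesquilinear_gd_bracket:
  assumes V: "subspace V"
    and mem: "\<And>x y. x \<in> V \<Longrightarrow> y \<in> V \<Longrightarrow> circ x y \<in> V" "\<And>x y. x \<in> V \<Longrightarrow> y \<in> V \<Longrightarrow> br x y \<in> V"
    and bil: "bilinear_on scale scale V circ" "bilinear_on scale scale V br"
  shows "sesquilinear_bracket V circ br (gd_bracket circ br)"
proof -
  let ?S = "\<lambda>r :: 'b poly poly. - pCons 0 r"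
  let ?T = "\<lambda>r :: 'b poly poly. pCons 0 r + map_poly (pCons 0) r"
  note add = bilinear_on_additive[OF bil(1)] bilinear_on_additive[OF bil(2)]
  note add_simps = add[THEN additive_on_add]
  interpret G: sesquilinear_extension V V ?S ?T "gd_bracket_base circ br"
  proof
    show "additive ?S" "additive ?T"
      by (intro additive_intros)+
    show "?S (?T x) = ?T (?S x)" for x
      by (simp add: map_poly_pCons map_del_simps)
  qed (use V in \<open>auto intro!: additive_onI simp: subspace_0 gd_bracket_base_def star_def add_simps
        ac_simps\<close>)
  have closed: "gd_bracket circ br p q \<in> polys_over (polys_over V)"
    if "p \<in> polys_over V" "q \<in> polys_over V" for p q
    unfolding gd_bracket_eq_sesq_ext sesq_ext_def using that(1)
  proof (rule subst_var_closed)
    fix x assume x: "x \<in> V"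
    show "subst_var ?T (gd_bracket_base circ br x) q \<in> polys_over (polys_over V)"
      using that(2)
    proof (rule subst_var_closed)
      show "gd_bracket_base circ br x y \<in> polys_over (polys_over V)" if "y \<in> V" for y
        using that x mem V by (simp add: gd_bracket_base_def star_def subspace_add subspace_0)
    qed (use V in \<open>auto simp: polys_over_def coeff_map_poly coeff_pCons subspace_0 subspace_add
          split: nat.splits\<close>)
  qed (use V in \<open>auto simp: polys_over_def coeff_pCons subspace_0 subspace_add subspace_neg
        split: nat.splits\<close>)
  note G = G.add_left G.add_right G.del_left G.del_right G.const
  note G = G[folded gd_bracket_eq_sesq_ext]
  show ?thesis
    by unfold_locales
      (use V mem closed in \<open>auto simp: subspace_0 subspace_add subspace_neg G add_simps
        intro!: additive_onI\<close>)
qed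

lemma (in vector_space) del_poly_scale_fun: "poly_scale scale [:0, 1:] = pCons 0"
  by (rule ext) (rule del_poly_scale)

lemma (in vector_space) const_poly_scale_fun: "poly_scale scale [:c:] = map_poly (scale c)"
  by (rule ext) (rule poly_scale_const)

lemma (in vector_space) bilinear_on_scale:
  assumes "bilinear_on scale s' V b" "x \<in> V" "y \<in> V"
  shows "b (scale c x) y = s' c (b x y)" "b x (scale c y) = s' c (b x y)"
  using assms by (auto simp: bilinear_on_def linear_on_def)

text \<open>
  The equivalence at the heart of both directions: sesquilinearity and bilinearity are built in,
  and the two remaining axioms were reduced to \<open>V\<close> above.
\<close>

lemma (in vector_space) lie_conformal_algebra_iff:
  assumes V: "subspace V"
    and br: "sesquilinear_bracket V circ br lb"
    and bil: "bilinear_on scale scale V circ" "bilinear_on scale scale V br"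
  shows "lie_conformal_algebra (poly_scale scale) (polys_over V) lb \<longleftrightarrow>
    (\<forall>a\<in>V. \<forall>b\<in>V. br a b = - br b a) \<and> sesquilinear_bracket.gd_identities V circ br"
proof -
  interpret sesquilinear_bracket V circ br lb by fact
  interpret P: module "poly_scale scale" by (rule module_poly_scale)
  have hom: "lb (map_poly (scale c) p) q = map_poly (map_poly (scale c)) (lb p q)"
    "lb p (map_poly (scale c) q) = map_poly (map_poly (scale c)) (lb p q)"
    if "p \<in> R" "q \<in> R" for c p q
    \<comment> \<open>The transfer maps are multiplication by \<open>c\<close> on one factor and the identity on the other.\<close>
    using bracket_transfer[OF br br additive_scale[of c] additive_scale[of c], of id p q]
      bracket_transfer[OF br br additive_scale[of c] _ additive_scale[of c], of id p q]
      that V bilinear_on_scale[OF bil(1)] bilinear_on_scale[OF bil(2)]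
    by (auto simp: subspace_scale additive_on_def)
  have bilin: "bilinear_on (\<lambda>c. poly_scale scale [:c:]) (\<lambda>c. map_poly (poly_scale scale [:c:])) R lb"
    by (simp add: bilinear_on_def linear_on_def lb_add_left lb_add_right const_poly_scale_fun hom)
  have "lie_conformal_algebra (poly_scale scale) R lb \<longleftrightarrow>
      (\<forall>p\<in>R. \<forall>q\<in>R. lb p q = - skew_op (lb q p)) \<and>
      (\<forall>p\<in>R. \<forall>q\<in>R. \<forall>r\<in>R. jac_a_bc p q r = jac_ab_c p q r + jac_b_ac p q r)"
    (is "_ \<longleftrightarrow> ?skew \<and> ?jac")
  proof
    assume "lie_conformal_algebra (poly_scale scale) R lb"
    then interpret L: lie_conformal_algebra "poly_scale scale" R lb .
    show "?skew \<and> ?jac"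
      unfolding jac_a_bc_def jac_ab_c_def jac_b_ac_def sum_op_def skew_op_def subst_lambda_def
      using L.lb_skew L.lb_jacobi unfolding del_poly_scale_fun by blast
  next
    assume sj: "?skew \<and> ?jac"
    show "lie_conformal_algebra (poly_scale scale) R lb"
    proof (intro lie_conformal_algebra.intro module_poly_scale lie_conformal_algebra_axioms.intro)
      show "P.subspace R"
        by (rule subspace_polys_over[OF V])
    qed (use sj lb_mem lb_del_left lb_del_right bilin in
        \<open>unfold del_poly_scale_fun jac_a_bc_def jac_ab_c_def jac_b_ac_def sum_op_def skew_op_def subst_lambda_def,
         blast+\<close>)
  qed
  also have "\<dots> \<longleftrightarrow> (\<forall>a\<in>V. \<forall>b\<in>V. br a b = - br b a) \<and> gd_identities"
    unfolding skew_iff using jacobi_iff by auto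
  finally show ?thesis .
qed

lemma (in lie_algebra) br_skew:
  assumes "a \<in> V" "b \<in> V" shows "br a b = - br b a"
proof -
  note add = bilinear_on_additive[OF br_bilinear, THEN additive_on_add]
  have "br (a + b) (a + b) = br a a + br a b + (br b a + br b b)"
    using assms subspace_carrier by (simp add: add subspace_add)
  then show ?thesis
    using assms br_self subspace_carrier by (simp add: subspace_add eq_neg_iff_add_eq_0)
qed

lemma (in gd_algebra) sesquilinear: "sesquilinear_bracket V circ br (gd_bracket circ br)"
  using subspace_carrier circ_closed lie.br_closed circ_bilinear lie.br_bilinear
  by (rule sesquilinear_gd_bracket)

theorem (in gd_algebra) lie_conformal_algebra:
  "lie_conformal_algebra (poly_scale scale) (polys_over V) (gd_bracket circ br)"
proof -
  interpret sesquilinear_bracket V circ br "gd_bracket circ br" by (rule sesquilinear)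
  have gd_identities
    unfolding gd_identities_def
    using left_symmetric right_commutative lie.br_jacobi gd_compatible by blast
  then show ?thesis
    unfolding lie_conformal_algebra_iff[OF subspace_carrier sesquilinear circ_bilinear lie.br_bilinear]
    using lie.br_skew by blast
qed

lemma bilinear_on_subset: "bilinear_on s s' V b \<Longrightarrow> W \<subseteq> V \<Longrightarrow> bilinear_on s s' W b"
  unfolding bilinear_on_def linear_on_def by (intro ballI conjI allI; simp add: subset_iff)

lemma (in gd_algebra) gd_subalgebra:
  assumes "subspace W" "W \<subseteq> V" "\<And>a b. a \<in> W \<Longrightarrow> b \<in> W \<Longrightarrow> circ a b \<in> W \<and> br a b \<in> W"
  shows "gd_algebra scale W circ br"
proof -
  have bil: "bilinear_on scale scale W circ" "bilinear_on scale scale W br"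
    using bilinear_on_subset[OF circ_bilinear assms(2)] bilinear_on_subset[OF lie.br_bilinear assms(2)]
    by simp_all
  have W: "a \<in> V" if "a \<in> W" for a
    using that assms(2) by blast
  show ?thesis
  proof (unfold_locales, goal_cases)
    case (4 a b c) then show ?case by (intro left_symmetric W)
  next
    case (5 a b c) then show ?case by (intro right_commutative W)
  next
    case (8 a) then show ?case by (intro lie.br_self W)
  next
    case (9 a b c) then show ?case by (intro lie.br_jacobi W)
  next
    case (10 a b c) then show ?case by (intro gd_compatible W)
  qed (simp_all add: assms(1,3) bil)
qed

lemma (in gd_algebra) finite_lie_conformal_algebra:
  assumes "finite B" "span B = V"
  shows "finite_lie_conformal_algebra (poly_scale scale) (polys_over V) (gd_bracket circ br)"
proof -
  interpret L: lie_conformal_algebra "poly_scale scale" "polys_over V" "gd_bracket circ br"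
    by (rule lie_conformal_algebra)
  show ?thesis
  proof
    show "\<exists>S. finite S \<and> L.span S = polys_over V"
      using span_polys_over[of B] assms by (intro exI[of _ "(\<lambda>b. [:b:]) ` B"]) auto
  qed
qed


section \<open>Conformal bilinear forms\<close>

locale symmetric_form = vector_space scale + sesquilinear_pairing V \<phi>
  for scale :: "'k::field \<Rightarrow> 'v::ab_group_add \<Rightarrow> 'v" and V and \<phi> :: "'v \<Rightarrow> 'v \<Rightarrow> 'k" +
  assumes subspace_V: "subspace V"
    and sym: "\<And>a b. a \<in> V \<Longrightarrow> b \<in> V \<Longrightarrow> \<phi> a b = \<phi> b a"
    and \<phi>_scale: "\<And>c a b. a \<in> V \<Longrightarrow> b \<in> V \<Longrightarrow> \<phi> (scale c a) b = c * \<phi> a b"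
begin

lemma F_sym:
  assumes "u \<in> polys_over V" "v \<in> polys_over V"
  shows "F u v = pcompose (F v u) [:0, -1:]"
proof -
  have c: "F [:a:] v = pcompose (F v [:a:]) [:0, -1:]" if "a \<in> V" for a
    using assms(2)
    by (induction rule: polys_over_induct)
      (use that zero_mem sym in \<open>auto simp: F_const F_del_right F_del_left F_add_left F_add_right
        pcompose_add pcompose_uminus pcompose_pCons\<close>)
  show ?thesis
    using assms(1)
    by (induction rule: polys_over_induct)
      (use assms c in \<open>auto simp: F_del_right F_del_left F_add_left F_add_right
        pcompose_add pcompose_uminus pcompose_pCons\<close>)
qed

lemma map_scale_mem: "u \<in> polys_over V \<Longrightarrow> map_poly (scale c) u \<in> polys_over V"
  using subspace_V by (simp add: polys_over_def coeff_map_poly subspace_scale)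

lemma F_map_scale_left:
  assumes "u \<in> polys_over V" "v \<in> polys_over V"
  shows "F (map_poly (scale c) u) v = smult c (F u v)"
  using assms(1)
proof (induction rule: polys_over_induct)
  case (const a)
  have "\<phi> a 0 = 0" "\<phi> (scale c a) 0 = 0"
    using const subspace_V zero_mem by (auto intro!: additive_on_0[OF \<phi>_right] subspace_scale)
  then show ?case
    using assms(2) const subspace_V
    by (intro poly_eqI)
      (simp add: map_poly_pCons F_const_left subspace_scale coeff_map_poly \<phi>_scale polys_over_coeff)
next
  case (add p q)
  then show ?case
    using assms(2)
    by (simp add: additive_add[OF additive_map_poly[OF additive_scale]] F_add_left map_scale_mem
        smult_add_right)
qed (use assms(2) in \<open>simp add: map_poly_pCons F_del_left\<close>)

lemma F_poly_scale_left:
  assumes "u \<in> polys_over V" "v \<in> polys_over V"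
  shows "F (poly_scale scale p u) v = pcompose p [:0, -1:] * F u v"
proof (induction p)
  case 0
  then show ?case using assms by (simp add: F_0)
next
  case (pCons c p)
  then show ?case
    using assms poly_scale_mem[OF subspace_V assms(1), of p] zero_mem
    by (simp add: poly_scale_pCons F_add_left map_scale_mem F_map_scale_left F_del_left pcompose_pCons
        algebra_simps)
qed

lemma F_map_scale_right:
  assumes "u \<in> polys_over V" "v \<in> polys_over V"
  shows "F u (map_poly (scale c) v) = smult c (F u v)"
  using assms F_sym[of u "map_poly (scale c) v"] F_sym[of u v]
  by (simp add: map_scale_mem F_map_scale_left pcompose_smult)

theorem conformal_form_extend: "conformal_form (poly_scale scale) (polys_over V) F"
  by (auto simp: conformal_form_def bilinear_on_def linear_on_def const_poly_scale_fun
      del_poly_scale_fun F_add_left F_add_right F_map_scale_left F_map_scale_right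
      F_del_left F_del_right)

theorem conformal_symmetric_extend: "conformal_symmetric (polys_over V) F"
  unfolding conformal_symmetric_def by (intro ballI F_sym)

text \<open>
  The families \<open>e\<close> and \<open>e'\<close> play the role of dual bases.  The expansion property makes an element
  of \<open>k[\<partial>]V\<close> determined by its pairings with \<open>V\<close>, which gives injectivity.  A conformal functional
  \<open>G\<close> is determined by its values on the \<open>e i\<close>, and it is represented by
  \<open>\<Sum>i. G\<^sub>-\<^sub>\<partial>(e i) e' i\<close>.
\<close>

theorem conformal_nondegenerate_extend:
  assumes mem: "\<And>i. i \<in> I \<Longrightarrow> e i \<in> V" "\<And>i. i \<in> I \<Longrightarrow> e' i \<in> V"
    and expand: "\<And>v. v \<in> V \<Longrightarrow> v = (\<Sum>i\<in>I. scale (\<phi> (e' i) v) (e i))"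
  shows "conformal_nondegenerate (poly_scale scale) (polys_over V) F"
proof -
  let ?R = "polys_over V"
  define L where "L = (\<lambda>v. restrict (F v) ?R)"
  note R_closed = module.subspace_add[OF module_poly_scale subspace_polys_over[OF subspace_V]]
  have add: "L (u + v) = (\<lambda>b\<in>?R. L u b + L v b)" if "u \<in> ?R" "v \<in> ?R" for u v
    using that by (auto simp: L_def F_add_left fun_eq_iff restrict_def)
  have scale: "L (poly_scale scale p v) = conformal_dual_scale ?R p (L v)" if "v \<in> ?R" for p v
    using that by (auto simp: L_def F_poly_scale_left conformal_dual_scale_def fun_eq_iff restrict_def)
  have "inj_on L ?R"
  proof (rule inj_onI)
    fix u v assume uv: "u \<in> ?R" "v \<in> ?R" "L u = L v"
    have F_eq: "F u w = F v w" if "w \<in> ?R" for w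
      using fun_cong[OF uv(3), of w] that by (simp add: L_def)
    have "\<phi> w (coeff u n) = \<phi> w (coeff v n)" if w: "w \<in> V" for w n
    proof -
      have "F [:w:] u = F [:w:] v"
        using F_eq[of "[:w:]"] F_sym[of "[:w:]"] uv w zero_mem by simp
      then have "coeff (map_poly (\<phi> w) u) n = coeff (map_poly (\<phi> w) v) n"
        using uv w by (simp add: F_const_left)
      then show ?thesis
        using additive_on_0[OF \<phi>_right[OF w] zero_mem] by (simp add: coeff_map_poly)
    qed
    then have "(\<Sum>i\<in>I. scale (\<phi> (e' i) (coeff u n)) (e i)) = (\<Sum>i\<in>I. scale (\<phi> (e' i) (coeff v n)) (e i))" for n
      using mem by (intro sum.cong) auto
    then show "u = v"
      using uv by (intro poly_eqI) (metis expand polys_over_coeff)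
  qed
  moreover have "L v \<in> conformal_dual (poly_scale scale) ?R" if "v \<in> ?R" for v
    using that zero_mem R_closed
    by (auto simp: conformal_dual_def L_def linear_on_def F_add_right const_poly_scale_fun
        del_poly_scale_fun F_map_scale_right F_del_right map_scale_mem)
  moreover have "G \<in> L ` ?R" if G: "G \<in> conformal_dual (poly_scale scale) ?R" for G
  proof -
    have G_add: "G (p + q) = G p + G q" if "p \<in> ?R" "q \<in> ?R" for p q
      using that G by (auto simp: conformal_dual_def linear_on_def)
    have G_scale: "G (map_poly (scale c) p) = smult c (G p)" if "p \<in> ?R" for p c
      using that G by (auto simp: conformal_dual_def linear_on_def const_poly_scale_fun)
    have G_del: "G (pCons 0 p) = pCons 0 (G p)" if "p \<in> ?R" for p
      using that G by (auto simp: conformal_dual_def del_poly_scale_fun)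
    have G_0: "G 0 = 0"
      using additive_on_0[of ?R G] G_add zero_mem by (simp add: additive_on_def)
    have F_0': "F 0 w = 0" if "w \<in> ?R" for w
      using that F_0 by simp
    \<comment> \<open>The sign in \<open>G\<^sub>-\<^sub>\<partial>\<close> compensates that \<open>\<partial>\<close> in the first argument of the form acts as \<open>-\<lambda>\<close>.\<close>
    let ?t = "\<lambda>i. poly_scale scale (pcompose (G [:e i:]) [:0, -1:]) [:e' i:]"
    have t: "?t i \<in> ?R" if "i \<in> I" for i
      using that mem zero_mem by (intro poly_scale_mem subspace_V) simp
    have sum_mem: "(\<Sum>i\<in>J. ?t i) \<in> ?R" if "J \<subseteq> I" for J
      using that t zero_mem
      by (induction J rule: infinite_finite_induct) (auto intro!: R_closed)
    have sum_F: "F (\<Sum>i\<in>J. ?t i) w = (\<Sum>i\<in>J. F (?t i) w)" if "J \<subseteq> I" "w \<in> ?R" for J w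
      using that(1)
      by (induction J rule: infinite_finite_induct)
        (use that(2) t sum_mem in \<open>auto simp: F_0' F_add_left\<close>)
    have sum_V: "(\<Sum>i\<in>J. scale (f i) (e i)) \<in> V" if "J \<subseteq> I" for f J
      using that mem subspace_V by (intro subspace_sum subspace_scale) auto
    have sum_G: "G [:\<Sum>i\<in>J. scale (f i) (e i):] = (\<Sum>i\<in>J. smult (f i) (G [:e i:]))"
      if "J \<subseteq> I" for J f
      using that
    proof (induction J rule: infinite_finite_induct)
      case (insert j J)
      have "G ([:scale (f j) (e j):] + [:\<Sum>i\<in>J. scale (f i) (e i):])
          = G [:scale (f j) (e j):] + G [:\<Sum>i\<in>J. scale (f i) (e i):]"
        using insert sum_V[of J] mem subspace_V zero_mem by (intro G_add) (auto simp: subspace_scale)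
      also have "G [:scale (f j) (e j):] = smult (f j) (G [:e j:])"
        using G_scale[of "[:e j:]" "f j"] insert mem zero_mem by (simp add: map_poly_pCons)
      finally show ?case using insert by simp
    qed (simp_all add: G_0)
    define p where "p = (\<Sum>i\<in>I. ?t i)"
    have p: "p \<in> ?R" unfolding p_def by (rule sum_mem) simp
    have "F p w = G w" if "w \<in> ?R" for w
      using that
    proof (induction rule: polys_over_induct)
      case (const v)
      have v: "[:v:] \<in> ?R" using const zero_mem by simp
      have "F p [:v:] = (\<Sum>i\<in>I. smult (\<phi> (e' i) v) (G [:e i:]))"
        unfolding p_def sum_F[OF subset_refl v]
        by (rule sum.cong)
          (use const mem v zero_mem in \<open>simp_all add: F_poly_scale_left F_const flip: pcompose_assoc\<close>,
           simp add: pcompose_pCons)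
      also have "\<dots> = G [:v:]"
        using sum_G[of I "\<lambda>i. \<phi> (e' i) v"] expand[OF const] by simp
      finally show ?case .
    qed (use p in \<open>simp_all add: F_del_right F_add_right G_del G_add\<close>)
    then have "L p = G"
      using G by (auto simp: L_def fun_eq_iff conformal_dual_def extensional_def restrict_def)
    with p show ?thesis by blast
  qed
  ultimately have "bij_betw L ?R (conformal_dual (poly_scale scale) ?R)"
    by (auto simp: bij_betw_def)
  with add scale show ?thesis
    by (simp add: conformal_nondegenerate_def L_def)
qed

end

lemma conformal_invariant_iff:
  assumes "symmetric_form scale V \<phi>" "sesquilinear_bracket V circ br lb"
  shows "conformal_invariant (poly_scale scale) (polys_over V) lb (extend_form \<phi>) \<longleftrightarrow>
    gd_invariant V circ br \<phi>"
proof -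
  interpret S: symmetric_form scale V \<phi> by fact
  interpret sesquilinear_bracket V circ br lb by fact
  interpret bracket_with_pairing V circ br lb \<phi>
    by unfold_locales (rule S.sym)
  show ?thesis
    using invariant_iff
    unfolding conformal_invariant_def gd_invariant_def S.del_poly_scale_fun form_ab_c_def form_a_bc_def
      shift_op_def subst_lambda_def by blast
qed


section \<open>Brackets of a conformal Manin triple have degree at most one\<close>

text \<open>
  The coefficients of the monomials \<open>\<lambda>\<^sup>n \<partial>\<^sup>m\<close> of total degree \<open>k\<close> lie in \<open>W\<close>.
\<close>

definition degree_part_in :: "nat \<Rightarrow> 'v::zero set \<Rightarrow> 'v poly poly \<Rightarrow> bool" where
  "degree_part_in k W P \<longleftrightarrow> (\<forall>n m. n + m = k \<longrightarrow> coeff (coeff P n) m \<in> W)"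

lemma degree_part_in_Int:
  "degree_part_in k (A \<inter> B) P \<longleftrightarrow> degree_part_in k A P \<and> degree_part_in k B P"
  by (auto simp: degree_part_in_def)

text \<open>
  The substitutions \<open>\<lambda> \<mapsto> \<plusminus>\<lambda> \<plusminus> \<partial>\<close> are homogeneous of total degree zero, so they map the part of
  degree \<open>k\<close> to the part of degree \<open>k\<close>.
\<close>

lemma (in vector_space) degree_part_in_subst_lambda:
  assumes W: "subspace W" and T: "additive T"
    and raise: "\<And>P. T P = \<epsilon> (pCons 0 P) + \<delta> (map_poly (pCons 0) P)"
    and signs: "\<epsilon> = id \<or> \<epsilon> = uminus" "\<delta> = id \<or> \<delta> = uminus"
  shows "degree_part_in k W P \<Longrightarrow> degree_part_in k W (subst_lambda T P)"
proof (induction P arbitrary: k)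
  case 0
  show ?case
    using W by (simp add: additive_0[OF additive_subst_lambda[OF T]] degree_part_in_def subspace_0)
next
  case (pCons r P)
  have r: "coeff r k \<in> W"
    using pCons.prems unfolding degree_part_in_def by (metis add_0 coeff_pCons_0)
  define Q where "Q = subst_lambda T P"
  have Q: "coeff (coeff Q n) m \<in> W" if "Suc (n + m) = k" for n m
  proof -
    have "degree_part_in (n + m) W P"
      unfolding degree_part_in_def
    proof (intro allI impI)
      fix n' m' assume "n' + m' = n + m"
      then show "coeff (coeff P n') m' \<in> W"
        using pCons.prems that unfolding degree_part_in_def
        by (metis add_Suc coeff_pCons_Suc)
    qed
    from pCons.IH[OF this] show ?thesis by (simp add: degree_part_in_def Q_def)
  qed
  have eq: "subst_lambda T (pCons r P) = [:r:] + (\<epsilon> (pCons 0 Q) + \<delta> (map_poly (pCons 0) Q))"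
    unfolding subst_lambda_pCons[OF T] Q_def by (simp only: raise)
  show ?case
    unfolding degree_part_in_def eq
  proof (intro allI impI)
    fix n m assume nm: "n + m = k"
    have 1: "coeff (coeff [:r:] n) m \<in> W"
      using r nm W by (cases n) (auto simp: subspace_0)
    have 2: "coeff (coeff (pCons 0 Q) n) m \<in> W"
      using Q nm W by (cases n) (auto simp: subspace_0)
    have 3: "coeff (coeff (map_poly (pCons 0) Q) n) m \<in> W"
      using Q nm W by (cases m) (auto simp: subspace_0 coeff_map_poly)
    have 2: "coeff (coeff (\<epsilon> (pCons 0 Q)) n) m \<in> W"
      using signs(1) 2 W by (auto simp: subspace_neg simp del: minus_pCons)
    have 3: "coeff (coeff (\<delta> (map_poly (pCons 0) Q)) n) m \<in> W"
      using signs(2) 3 W by (auto simp: subspace_neg)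
    show "coeff (coeff ([:r:] + (\<epsilon> (pCons 0 Q) + \<delta> (map_poly (pCons 0) Q))) n) m \<in> W"
      using subspace_add[OF W 1 subspace_add[OF W 2 3]] by simp
  qed
qed

text \<open>
  The inverse \<open>\<lambda> \<mapsto> \<lambda> + \<partial>\<close> of \<open>shift_op\<close>.
\<close>

definition unshift_op :: "'v::ab_group_add poly poly \<Rightarrow> 'v poly poly" where
  "unshift_op = subst_lambda (\<lambda>q. pCons 0 q + map_poly (pCons 0) q)"

lemma additive_unshift_step: "additive (\<lambda>q. pCons 0 q + map_poly (pCons 0) q)"
  by (intro additive_intros)

lemmas additive_unshift_op = additive_subst_lambda[OF additive_unshift_step, folded unshift_op_def]
  and unshift_op_pCons = subst_lambda_pCons[OF additive_unshift_step, folded unshift_op_def]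

lemma unshift_op_del: "unshift_op (map_poly (pCons 0) p) = map_poly (pCons 0) (unshift_op p)"
  unfolding unshift_op_def
  by (rule subst_lambda_del[OF additive_unshift_step]) (simp add: map_del_simps map_poly_pCons)

lemma unshift_shift: "unshift_op (shift_op P) = P"
proof (induction P)
  case 0
  show ?case by (simp add: additive_0[OF additive_unshift_op])
next
  case (pCons r P)
  have "unshift_op (shift_op (pCons r P)) = unshift_op [:r:]
      + (unshift_op (pCons 0 (shift_op P)) - unshift_op (map_poly (pCons 0) (shift_op P)))"
    unfolding shift_op_pCons additive_add[OF additive_unshift_op]
      additive_diff[OF additive_unshift_op] ..
  also have "\<dots> = pCons r P"
    by (simp add: unshift_op_pCons unshift_op_del pCons.IH additive_0[OF additive_unshift_op])
  finally show ?case .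
qed

context vector_space
begin

lemma degree_part_in_skew_op: "subspace W \<Longrightarrow> degree_part_in k W P \<Longrightarrow> degree_part_in k W (skew_op P)"
  unfolding skew_op_def
  by (rule degree_part_in_subst_lambda[OF _ additive_skew_step, where \<epsilon> = uminus and \<delta> = uminus]) auto

lemma degree_part_in_unshift_op: "subspace W \<Longrightarrow> degree_part_in k W P \<Longrightarrow> degree_part_in k W (unshift_op P)"
  unfolding unshift_op_def
  by (rule degree_part_in_subst_lambda[OF _ additive_unshift_step, where \<epsilon> = id and \<delta> = id]) auto

end

definition degree_le_one :: "'v::zero poly poly \<Rightarrow> bool" where
  "degree_le_one P \<longleftrightarrow> (\<forall>k\<ge>2. degree_part_in k {0} P)"

lemma degree_le_one_pCons: "degree_le_one [: [:p, q:], [:w:] :]"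
  by (auto simp: degree_le_one_def degree_part_in_def coeff_pCons split: nat.splits)

lemma degree_le_one_eq:
  assumes "degree_le_one P"
  shows "P = [: [:coeff (coeff P 0) 0, coeff (coeff P 0) 1:], [:coeff (coeff P 1) 0:] :]"
proof (intro poly_eqI)
  fix n m :: nat
  have 0: "coeff (coeff P n) m = 0" if "n + m \<ge> 2" for n m
    using assms that by (auto simp: degree_le_one_def degree_part_in_def)
  consider "n = 0" "m = 0" | "n = 0" "m = 1" | "n = 1" "m = 0" | "n + m \<ge> 2"
    by linarith
  then show "coeff (coeff P n) m
      = coeff (coeff [: [:coeff (coeff P 0) 0, coeff (coeff P 0) 1:], [:coeff (coeff P 1) 0:] :] n) m"
    by cases (use 0[of n m] in \<open>auto simp: coeff_pCons split: nat.splits\<close>)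
qed

lemma coeff_in_mu: "coeff (in_mu p) m = [:coeff p m:]"
  by (simp add: in_mu_def coeff_map_poly)

lemma coeff_mul_lam: "coeff (mul_lam P) m = pCons 0 (coeff P m)"
  by (simp add: mul_lam_def coeff_map_poly)

context symmetric_form
begin

text \<open>
  The right-hand side of the invariance condition for \<open>a \<in> V\<close> records the pairing of \<open>a\<close> with each
  coefficient separately, since \<open>\<partial>\<close> in the second argument of the form becomes \<open>\<mu>\<close>.
\<close>

lemma coeff_pairing:
  assumes a: "a \<in> V" and P: "P \<in> polys_over (polys_over V)"
  shows "coeff (coeff (subst_var mul_lam (\<lambda>x. in_mu (F [:a:] x)) P) m) n = \<phi> a (coeff (coeff P n) m)"
  using P
proof (induction P arbitrary: n)
  case 0
  show ?case
    using additive_on_0[OF \<phi>_right[OF a] zero_mem] a zero_mem by (simp add: F_0)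
next
  case (pCons p P)
  have \<phi>0: "\<phi> a 0 = 0" using additive_on_0[OF \<phi>_right[OF a] zero_mem] .
  have e0: "in_mu (F [:a:] 0) = 0" using a zero_mem by (simp add: F_0)
  have "coeff (coeff (subst_var mul_lam (\<lambda>x. in_mu (F [:a:] x)) (pCons p P)) m) n
      = coeff [:\<phi> a (coeff p m):] n
        + coeff (pCons 0 (coeff (subst_var mul_lam (\<lambda>x. in_mu (F [:a:] x)) P) m)) n"
    unfolding subst_var_pCons[where e = "\<lambda>x. in_mu (F [:a:] x)", OF additive_mul_lam e0]
    using pCons.prems a by (simp add: F_const_left coeff_in_mu coeff_mul_lam coeff_map_poly \<phi>0
        coeff_pCons split: nat.splits)
  also have "\<dots> = \<phi> a (coeff (coeff (pCons p P) n) m)"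
    using pCons.IH pCons.prems by (cases n) simp_all
  finally show ?case .
qed

text \<open>
  Invariance determines the pairing of \<open>a \<in> A\<close> with the coefficients of \<open>[b c]\<close>, the bracket being
  taken at \<open>\<lambda> - \<partial>\<close>, by the bracket \<open>[a\<^sub>\<mu> b]\<close> inside \<open>A\<close>, which has degree at most one.  Hence the
  coefficients of higher degree are orthogonal to \<open>A\<close> and, by the second assumption on \<open>A\<close>, belong
  to \<open>A\<close>.  Undoing the shift of \<open>\<lambda>\<close> transports this to \<open>[b\<^sub>\<lambda> c]\<close>.
\<close>

lemma degree_part_in_maximal_isotropic:
  assumes lca: "lie_conformal_algebra (poly_scale scale) (polys_over V) lb"
    and inv: "conformal_invariant (poly_scale scale) (polys_over V) lb F"
    and A: "A \<subseteq> V" "\<And>v. v \<in> V \<Longrightarrow> (\<And>a. a \<in> A \<Longrightarrow> \<phi> a v = 0) \<Longrightarrow> v \<in> A" "subspace A"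
    and low: "\<And>a b. a \<in> A \<Longrightarrow> b \<in> A \<Longrightarrow> degree_le_one (lb [:a:] [:b:])"
    and b: "b \<in> A" and c: "c \<in> V" and k: "k \<ge> 2"
  shows "degree_part_in k A (lb [:b:] [:c:])"
proof -
  interpret L: lie_conformal_algebra "poly_scale scale" "polys_over V" lb by fact
  have c': "[:c:] \<in> polys_over V" and V': "\<And>a. a \<in> A \<Longrightarrow> [:a:] \<in> polys_over V"
    using c zero_mem A by auto
  define P where "P = shift_op (lb [:b:] [:c:])"
  have P: "P \<in> polys_over (polys_over V)"
    unfolding P_def shift_op_def subst_lambda_def using L.lb_closed[OF V'[OF b] c']
    by (rule subst_var_closed)
      (use subspace_V in \<open>auto simp: polys_over_def coeff_map_poly coeff_pCons subspace_0 subspace_add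
        subspace_diff subspace_neg split: nat.splits\<close>)
  have "\<phi> a (coeff (coeff P n) m) = 0" if a: "a \<in> A" and nm: "n + m \<ge> 2" for a n m
  proof -
    obtain u v w where X: "lb [:a:] [:b:] = [: [:u, v:], [:w:] :]"
      using degree_le_one_eq[OF low[OF a b]] by blast
    then have uvw: "u \<in> V" "v \<in> V" "w \<in> V"
      using L.lb_closed[OF V'[OF a] V'[OF b]] by auto
    have "F ([:u:] + pCons 0 [:v:]) [:c:] = F [:u:] [:c:] + F (pCons 0 [:v:]) [:c:]"
      using uvw c' zero_mem by (intro F_add_left) auto
    then have F_uv: "F [:u, v:] [:c:] = [:\<phi> u c, - \<phi> v c:]"
      using uvw c c' by (simp add: F_const F_del_left)
    have e0: "in_lam (F 0 [:c:]) = 0"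
      using c' by (simp add: F_0)
    have "subst_var mul_mu (\<lambda>x. in_lam (F x [:c:])) (lb [:a:] [:b:])
        = in_lam (F [:u, v:] [:c:]) + mul_mu (in_lam (F [:w:] [:c:]))"
      unfolding X
      by (simp add: subst_var_pCons[where e = "\<lambda>x. in_lam (F x [:c:])", OF additive_mul_mu e0]
          subst_var_0[where e = "\<lambda>x. in_lam (F x [:c:])", OF e0] additive_0[OF additive_mul_mu])
    also have "\<dots> = [: [:\<phi> u c, - \<phi> v c:], [:\<phi> w c:] :]"
      using uvw c by (simp add: F_uv F_const in_lam_eq mul_mu_eq)
    finally have left: "subst_var mul_mu (\<lambda>x. in_lam (F x [:c:])) (lb [:a:] [:b:])
        = [: [:\<phi> u c, - \<phi> v c:], [:\<phi> w c:] :]" .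
    have "subst_var mul_mu (\<lambda>x. in_lam (F x [:c:])) (lb [:a:] [:b:])
        = subst_var mul_lam (\<lambda>x. in_mu (F [:a:] x)) P"
      unfolding P_def shift_op_def subst_lambda_def
      using inv[unfolded conformal_invariant_def del_poly_scale_fun] V'[OF a] V'[OF b] c' by blast
    from trans[OF this[symmetric] left]
have "\<phi> a (coeff (coeff P n) m) = coeff (coeff [: [:\<phi> u c, - \<phi> v c:], [:\<phi> w c:] :] m) n"
      using coeff_pairing[of a P m n] P a A(1) by auto
    also have "\<dots> = 0"
      using nm by (auto simp: coeff_pCons split: nat.splits)
    finally show ?thesis .
  qed
  then have "degree_part_in k A P"
    unfolding degree_part_in_def
    using k P by (auto intro!: A(2) simp: polys_over_def)
  then show ?thesis
    using degree_part_in_unshift_op[OF A(3), of k P] by (simp add: P_def unshift_shift)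
qed

text \<open>
  For \<open>a \<in> A\<close> and \<open>b \<in> B\<close> the coefficients of \<open>[a\<^sub>\<lambda> b]\<close> of degree at least two lie in \<open>A\<close>, by the
  previous lemma.  They also lie in \<open>B\<close>, by the previous lemma for \<open>[b\<^sub>\<lambda> a]\<close> and skew-symmetry.
\<close>

lemma degree_le_one_bracket:
  assumes lca: "lie_conformal_algebra (poly_scale scale) (polys_over V) lb"
    and inv: "conformal_invariant (poly_scale scale) (polys_over V) lb F"
    and A: "A \<subseteq> V" "\<And>v. v \<in> V \<Longrightarrow> (\<And>a. a \<in> A \<Longrightarrow> \<phi> a v = 0) \<Longrightarrow> v \<in> A" "subspace A"
      "\<And>a b. a \<in> A \<Longrightarrow> b \<in> A \<Longrightarrow> degree_le_one (lb [:a:] [:b:])"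
    and B: "B \<subseteq> V" "\<And>v. v \<in> V \<Longrightarrow> (\<And>b. b \<in> B \<Longrightarrow> \<phi> b v = 0) \<Longrightarrow> v \<in> B" "subspace B"
      "\<And>a b. a \<in> B \<Longrightarrow> b \<in> B \<Longrightarrow> degree_le_one (lb [:a:] [:b:])"
    and AB: "A \<inter> B = {0}" "\<And>v. v \<in> V \<Longrightarrow> \<exists>a\<in>A. \<exists>b\<in>B. v = a + b"
    and x: "x \<in> V" and y: "y \<in> V"
  shows "degree_le_one (lb [:x:] [:y:])"
proof -
  interpret L: lie_conformal_algebra "poly_scale scale" "polys_over V" lb by fact
  have c: "[:a:] \<in> polys_over V" if "a \<in> V" for a
    using that zero_mem by simp
  have skew: "lb [:a:] [:b:] = - skew_op (lb [:b:] [:a:])" if "a \<in> V" "b \<in> V" for a b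
    using L.lb_skew[OF c c, OF that] by (simp only: del_poly_scale_fun skew_op_def subst_lambda_def)
  have neg: "degree_part_in k W (- P)" if "subspace W" "degree_part_in k W P" for k W and P :: "'v poly poly"
    using that by (simp add: degree_part_in_def subspace_neg)
  have right: "degree_part_in k W (lb [:b:] [:c:])"
    if "subspace W" "degree_part_in k W (lb [:c:] [:b:])" "b \<in> V" "c \<in> V" for k W b c
    unfolding skew[OF that(3,4)] using that(1,2) by (intro neg degree_part_in_skew_op)
  have mixed: "degree_le_one (lb [:a:] [:b:])" "degree_le_one (lb [:b:] [:a:])" if ab: "a \<in> A" "b \<in> B" for a b
  proof -
    have V: "a \<in> V" "b \<in> V" using ab A(1) B(1) by auto
    have l: "degree_part_in k A (lb [:a:] [:b:])" "degree_part_in k B (lb [:b:] [:a:])" if "k \<ge> 2" for k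
      using degree_part_in_maximal_isotropic[OF lca inv A ab(1) V(2) that] degree_part_in_maximal_isotropic[OF lca inv B ab(2) V(1) that] by auto
    have r: "degree_part_in k A (lb [:b:] [:a:])" "degree_part_in k B (lb [:a:] [:b:])" if "k \<ge> 2" for k
      using right[OF A(3) l(1)[OF that] V(2,1)] right[OF B(3) l(2)[OF that] V] by auto
    show "degree_le_one (lb [:a:] [:b:])" "degree_le_one (lb [:b:] [:a:])"
      using l r by (simp_all add: degree_le_one_def degree_part_in_Int flip: AB(1))
  qed
  obtain a b a' b' where ab: "a \<in> A" "b \<in> B" "a' \<in> A" "b' \<in> B" and xy: "x = a + b" "y = a' + b'"
    using AB(2)[OF x] AB(2)[OF y] by blast
  then have V: "a \<in> V" "b \<in> V" "a' \<in> V" "b' \<in> V" using A(1) B(1) by auto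
  note add_left = bilinear_on_additive(2)[OF L.lb_bilinear, THEN additive_on_add]
    and add_right = bilinear_on_additive(1)[OF L.lb_bilinear, THEN additive_on_add]
  have "lb ([:a:] + [:b:]) ([:a':] + [:b':]) = lb [:a:] [:a':] + lb [:a:] [:b':]
      + (lb [:b:] [:a':] + lb [:b:] [:b':])"
    using V[THEN c] L.submodule_carrier L.subspace_add by (simp add: add_left add_right del: add_pCons)
  then show ?thesis
    unfolding xy using A(4)[OF ab(1,3)] mixed(1)[OF ab(1,4)] mixed(2)[OF ab(3,2)] B(4)[OF ab(2,4)]
    by (simp add: degree_le_one_def degree_part_in_def)
qed

end

text \<open>
  The operations are read off from the coefficients of \<open>1\<close> and \<open>\<partial>\<close>; skew-symmetry of the
  \<open>\<lambda>\<close>-bracket forces the coefficient of \<open>\<lambda>\<close> to be the symmetrised product.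
\<close>

lemma (in vector_space) sesquilinear_if_degree_le_one:
  assumes V: "subspace V"
    and lca: "lie_conformal_algebra (poly_scale scale) (polys_over V) lb"
    and low: "\<And>x y. x \<in> V \<Longrightarrow> y \<in> V \<Longrightarrow> degree_le_one (lb [:x:] [:y:])"
  defines "circ \<equiv> \<lambda>x y. coeff (coeff (lb [:y:] [:x:]) 0) 1"
    and "br \<equiv> \<lambda>x y. coeff (coeff (lb [:x:] [:y:]) 0) 0"
  shows "sesquilinear_bracket V circ br lb"
    and "bilinear_on scale scale V circ" "bilinear_on scale scale V br"
proof -
  interpret L: lie_conformal_algebra "poly_scale scale" "polys_over V" lb by fact
  have c: "[:a:] \<in> polys_over V" if "a \<in> V" for a
    using that V by (simp add: subspace_0)
  note add_left = bilinear_on_additive(2)[OF L.lb_bilinear, THEN additive_on_add]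
    and add_right = bilinear_on_additive(1)[OF L.lb_bilinear, THEN additive_on_add]
  have mem: "coeff (coeff (lb [:x:] [:y:]) n) m \<in> V" if "x \<in> V" "y \<in> V" for x y n m
    using L.lb_closed[OF c c, OF that] by (simp add: polys_over_def)
  have add: "lb [:x + y:] [:z:] = lb [:x:] [:z:] + lb [:y:] [:z:]"
    "lb [:z:] [:x + y:] = lb [:z:] [:x:] + lb [:z:] [:y:]"
    if "x \<in> V" "y \<in> V" "z \<in> V" for x y z
    using add_left[OF c c c, of z x y] add_right[OF c c c, of z x y] that by simp_all
  have scl: "lb [:scale r x:] [:y:] = map_poly (map_poly (scale r)) (lb [:x:] [:y:])"
    "lb [:y:] [:scale r x:] = map_poly (map_poly (scale r)) (lb [:y:] [:x:])"
    if "x \<in> V" "y \<in> V" for r x y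
    using L.lb_bilinear c[OF that(1)] c[OF that(2)] unfolding bilinear_on_def linear_on_def
    by (metis poly_scale_const_const const_poly_scale_fun)+
  show bil: "bilinear_on scale scale V circ" "bilinear_on scale scale V br"
    by (auto simp: bilinear_on_def linear_on_def circ_def br_def add scl coeff_map_poly)
  have base: "lb [:x:] [:y:] = gd_bracket_base circ br x y" if xy: "x \<in> V" "y \<in> V" for x y
  proof -
    have skew: "lb [:y:] [:x:] = - skew_op (lb [:x:] [:y:])"
      using L.lb_skew[OF c c, OF xy(2,1)] by (simp only: del_poly_scale_fun skew_op_def subst_lambda_def)
    obtain p q w where X: "lb [:x:] [:y:] = [: [:p, q:], [:w:] :]"
      using degree_le_one_eq[OF low[OF xy]] by blast
    have "lb [:y:] [:x:] = [: [:- p, w - q:], [:w:] :]"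
      unfolding skew X by (simp add: skew_op_pCons map_poly_pCons)
    then show ?thesis
      by (simp add: gd_bracket_base_def circ_def br_def star_def X)
  qed
  show "sesquilinear_bracket V circ br lb"
  proof
    fix x assume x: "x \<in> V"
    show "additive_on V (\<lambda>y. circ y x)" "additive_on V (circ x)"
      "additive_on V (\<lambda>y. br y x)" "additive_on V (br x)"
      using x bil by (auto dest: bilinear_on_additive)
  next
    fix p assume p: "p \<in> polys_over V"
    show "additive_on (polys_over V) (\<lambda>q. lb q p)" "additive_on (polys_over V) (lb p)"
      using p by (auto intro: bilinear_on_additive[OF L.lb_bilinear])
  next
    show "circ x y \<in> V" "br x y \<in> V" if "x \<in> V" "y \<in> V" for x y
      using that mem by (auto simp: circ_def br_def)
  qed (use V base L.lb_closed L.lb_del_left L.lb_del_right in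
      \<open>auto simp: subspace_0 subspace_add subspace_neg del_poly_scale_fun\<close>)
qed

text \<open>
  The condition \<open>2 \<noteq> 0\<close> turns skew-symmetry of the bracket into \<open>[a,a] = 0\<close>.
\<close>

lemma (in vector_space) gd_algebra_if_lie_conformal_algebra:
  assumes V: "subspace V"
    and lca: "lie_conformal_algebra (poly_scale scale) (polys_over V) lb"
    and br: "sesquilinear_bracket V circ br lb"
    and bil: "bilinear_on scale scale V circ" "bilinear_on scale scale V br"
    and two: "(2 :: 'a) \<noteq> 0"
  shows "gd_algebra scale V circ br"
proof -
  interpret sesquilinear_bracket V circ br lb by fact
  have skew: "br a b = - br b a" if "a \<in> V" "b \<in> V" for a b
    using lca that unfolding lie_conformal_algebra_iff[OF V br bil] by blast
  have "gd_identities"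
    using lca unfolding lie_conformal_algebra_iff[OF V br bil] by blast
  moreover have "br a a = 0" if "a \<in> V" for a
  proof -
    have "scale 2 (br a a) = br a a + br a a"
      using scale_left_distrib[of 1 1 "br a a"] by simp
    also have "\<dots> = 0"
      using skew[OF that that] by (simp add: eq_neg_iff_add_eq_0)
    finally show ?thesis using two by simp
  qed
  ultimately show ?thesis
    unfolding gd_identities_def
    by unfold_locales (use V bil in \<open>blast intro: circ_mem br_mem\<close>)+
qed


section \<open>The space \<open>A \<oplus> A\<^sup>*\<close>\<close>

lemma vector_space_fun_scale: "vector_space (fun_scale :: 'k::field \<Rightarrow> ('a \<Rightarrow> 'k) \<Rightarrow> 'a \<Rightarrow> 'k)"
  by unfold_locales (auto simp: fun_scale_def fun_eq_iff algebra_simps)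

lemma in_A_simps:
  fixes a b :: "'a::ab_group_add"
  shows "in_A (a + b) = (in_A a + in_A b :: 'a \<times> ('a \<Rightarrow> 'k::field))"
    "in_A 0 = (0 :: 'a \<times> ('a \<Rightarrow> 'k))"
  by (simp_all add: in_A_def zero_prod_def)

lemma in_dual_simps: "in_dual (f + g) = in_dual f + in_dual g" "in_dual 0 = 0"
  for f g :: "'a::ab_group_add \<Rightarrow> 'k::field"
  by (simp_all add: in_dual_def zero_prod_def)

lemma inj_in_A: "inj in_A" and inj_in_dual: "inj in_dual"
  by (auto simp: inj_def in_A_def in_dual_def)

lemma additive_in_A: "additive (in_A :: 'a::ab_group_add \<Rightarrow> 'a \<times> ('a \<Rightarrow> 'k::field))"
  and additive_in_dual: "additive (in_dual :: ('a \<Rightarrow> 'k) \<Rightarrow> 'a \<times> ('a \<Rightarrow> 'k))"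
  by (simp_all add: additive_on_def in_A_simps in_dual_simps)

lemma polys_over_direct_sum:
  fixes A B :: "'v::ab_group_add set"
  assumes A: "0 \<in> A" "\<And>x y. x \<in> A \<Longrightarrow> y \<in> A \<Longrightarrow> x + y \<in> A"
    and B: "0 \<in> B" "\<And>x y. x \<in> B \<Longrightarrow> y \<in> B \<Longrightarrow> x + y \<in> B"
    and V: "V = {a + b | a b. a \<in> A \<and> b \<in> B}"
  shows "polys_over V = {p + q | p q. p \<in> polys_over A \<and> q \<in> polys_over B}"
proof
  show "{p + q | p q. p \<in> polys_over A \<and> q \<in> polys_over B} \<subseteq> polys_over V"
    by (auto simp: polys_over_def V) blast
  show "polys_over V \<subseteq> {p + q | p q. p \<in> polys_over A \<and> q \<in> polys_over B}"
  proof
    fix r assume "r \<in> polys_over V"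
    then have "\<exists>p\<in>polys_over A. \<exists>q\<in>polys_over B. r = p + q"
    proof (induction rule: polys_over_induct)
      case (const v)
      then obtain a b where "a \<in> A" "b \<in> B" "v = a + b" using V by blast
      then show ?case
        using A(1) B(1) by (intro bexI[of _ "[:a:]"] bexI[of _ "[:b:]"]) auto
    next
      case (del r)
      then obtain p q where "p \<in> polys_over A" "q \<in> polys_over B" "r = p + q" by blast
      then show ?case
        using A(1) B(1) by (intro bexI[of _ "pCons 0 p"] bexI[of _ "pCons 0 q"]) auto
    next
      case (add r r')
      then obtain p q p' q' where "p \<in> polys_over A" "q \<in> polys_over B" "r = p + q"
        "p' \<in> polys_over A" "q' \<in> polys_over B" "r' = p' + q'" by blast
      then show ?case
        using A(2) B(2)
        by (intro bexI[of _ "p + p'"] bexI[of _ "q + q'"]) (auto simp: polys_over_def algebra_simps)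
    qed
    then show "r \<in> {p + q | p q. p \<in> polys_over A \<and> q \<in> polys_over B}" by blast
  qed
qed

lemma extend_form_isotropic:
  assumes "p \<in> polys_over W" "q \<in> polys_over W" "\<And>x y. x \<in> W \<Longrightarrow> y \<in> W \<Longrightarrow> form x y = 0"
  shows "extend_form form p q = 0"
  using assms by (simp add: extend_form_def polys_over_coeff)

context vector_space
begin

lemma dualD:
  assumes "f \<in> dual scale"
  shows "f (x + y) = f x + f y" "f (scale c x) = c * f x" "f 0 = 0"
proof -
  show *: "f (x + y) = f x + f y" "f (scale c x) = c * f x" for x y c
    using assms by (simp_all add: dual_def Vector_Spaces.linear_iff)
  show "f 0 = 0" using *(2)[of 0 0] by simp
qed

lemma dualI:
  assumes "\<And>x y. f (x + y) = f x + f y" "\<And>c x. f (scale c x) = c * f x"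
  shows "f \<in> dual scale"
  using assms vector_space_axioms
  by (auto simp: dual_def Vector_Spaces.linear_iff intro!: vector_space.intro) (auto simp: algebra_simps)

lemma subspace_dual: "module.subspace fun_scale (dual scale)"
proof -
  interpret D: vector_space "fun_scale :: 'a \<Rightarrow> ('b \<Rightarrow> 'a) \<Rightarrow> _" by (rule vector_space_fun_scale)
  show ?thesis
    unfolding D.subspace_def
    by (auto intro!: dualI simp: dualD fun_scale_def algebra_simps)
qed

lemma vector_space_double: "vector_space (double_scale scale)"
proof -
  interpret D: vector_space "fun_scale :: 'a \<Rightarrow> ('b \<Rightarrow> 'a) \<Rightarrow> _" by (rule vector_space_fun_scale)
  show ?thesis
    by unfold_locales (auto simp: double_scale_def scale_right_distrib scale_left_distrib
        D.scale_right_distrib D.scale_left_distrib)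
qed

lemma double_space_eq:
  "double_space scale = {a + b | a b. a \<in> range in_A \<and> b \<in> in_dual ` dual scale}"
proof -
  have "(x, f) = in_A x + in_dual f" for x and f :: "'b \<Rightarrow> 'a"
    by (simp add: in_A_def in_dual_def)
  then show ?thesis
    unfolding double_space_def by (fastforce simp: in_A_def in_dual_def)
qed

lemma linear_in_A: "Vector_Spaces.linear scale (double_scale scale) in_A"
  unfolding Vector_Spaces.linear_iff using vector_space_axioms vector_space_double
  by (auto simp: in_A_simps) (auto simp: in_A_def double_scale_def fun_scale_def fun_eq_iff)

lemma linear_in_dual: "Vector_Spaces.linear fun_scale (double_scale scale) in_dual"
  unfolding Vector_Spaces.linear_iff using vector_space_fun_scale vector_space_double
  by (auto simp: in_dual_simps) (auto simp: in_dual_def double_scale_def)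

lemma subspace_in_A: "module.subspace (double_scale scale) (range in_A)"
  using module_hom.subspace_image[OF linear_in_A[folded module_hom_iff_linear], of UNIV] by simp

lemma subspace_in_dual: "module.subspace (double_scale scale) (in_dual ` dual scale)"
  using module_hom.subspace_image[OF linear_in_dual[folded module_hom_iff_linear] subspace_dual] .

lemma subspace_double: "module.subspace (double_scale scale) (double_space scale)"
proof -
  interpret D: vector_space "double_scale scale" by (rule vector_space_double)
  show ?thesis
    unfolding double_space_eq by (rule D.subspace_sums[OF subspace_in_A subspace_in_dual])
qed

lemma symmetric_form_double:
  "symmetric_form (double_scale scale) (double_space scale) double_form"
proof -
  interpret D: vector_space "double_scale scale" by (rule vector_space_double)
  show ?thesis
    by unfold_locales
      (use D.subspace_0[OF subspace_double] subspace_double in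
        \<open>auto simp: double_form_def double_space_def additive_on_def dualD double_scale_def
          fun_scale_def algebra_simps\<close>)
qed

text \<open>
  Both summands of \<open>A \<oplus> A\<^sup>*\<close> are maximal isotropic.  For \<open>A\<close> this holds in any dimension; for
  \<open>A\<^sup>*\<close> one needs that linear functionals separate the points of \<open>A\<close>.
\<close>

lemma in_A_orthogonal:
  assumes "v \<in> double_space scale" and orth: "\<And>a. a \<in> range in_A \<Longrightarrow> double_form a v = 0"
  shows "v \<in> range in_A"
proof -
  have "snd v a = 0" for a
    using orth[of "in_A a"] by (simp add: double_form_def in_A_def)
  then have "v = in_A (fst v)"
    by (simp add: in_A_def prod_eq_iff fun_eq_iff)
  then show ?thesis by blast
qed

end

context finite_dimensional_vector_space
begin

text \<open>
  The basis of \<open>A\<^sup>*\<close> dual to \<open>Basis\<close>.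
\<close>

definition coord :: "'b \<Rightarrow> 'b \<Rightarrow> 'a" where
  "coord b = (\<lambda>v. representation Basis v b)"

lemma coord_dual: "coord b \<in> dual scale"
  by (rule dualI)
    (simp_all add: coord_def representation_add representation_scale independent_Basis span_Basis)

lemma sum_coord: "(\<Sum>b\<in>Basis. scale (coord b v) b) = v"
  unfolding coord_def
  by (rule sum_representation_eq) (simp_all add: independent_Basis span_Basis finite_Basis)

lemma dual_expand:
  assumes "f \<in> dual scale"
  shows "(\<Sum>b\<in>Basis. fun_scale (f b) (coord b)) = f"
proof
  fix v
  have "f (\<Sum>b\<in>J. scale (c b) b) = (\<Sum>b\<in>J. c b * f b)" for J c
    by (induction J rule: infinite_finite_induct) (simp_all add: dualD[OF assms])
  then have "f (\<Sum>b\<in>Basis. scale (coord b v) b) = (\<Sum>b\<in>Basis. coord b v * f b)" .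
  moreover have "(\<Sum>b\<in>J. fun_scale (f b) (coord b)) v = (\<Sum>b\<in>J. coord b v * f b)" for J
    by (induction J rule: infinite_finite_induct) (simp_all add: fun_scale_def)
  ultimately show "(\<Sum>b\<in>Basis. fun_scale (f b) (coord b)) v = f v"
    by (simp add: sum_coord)
qed

lemma in_dual_orthogonal:
  assumes v: "v \<in> double_space scale"
    and orth: "\<And>b. b \<in> in_dual ` dual scale \<Longrightarrow> double_form b v = 0"
  shows "v \<in> in_dual ` dual scale"
proof -
  obtain x f where xf: "v = (x, f)" "f \<in> dual scale"
    using v by (auto simp: double_space_def)
  have "coord b x = 0" for b
    using orth[of "in_dual (coord b)"] coord_dual xf by (simp add: double_form_def in_dual_def dualD)
  then have "x = 0"
    using sum_coord[of x] by simp
  with xf show ?thesis by (simp add: in_dual_def)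
qed

lemma span_coord: "module.span fun_scale (coord ` Basis) = dual scale"
proof -
  interpret D: vector_space "fun_scale :: 'a \<Rightarrow> ('b \<Rightarrow> 'a) \<Rightarrow> _" by (rule vector_space_fun_scale)
  show ?thesis
  proof
    show "D.span (coord ` Basis) \<subseteq> dual scale"
      using coord_dual by (intro D.span_minimal subspace_dual) auto
    show "dual scale \<subseteq> D.span (coord ` Basis)"
    proof
      fix f assume "f \<in> dual scale"
      moreover have "(\<Sum>b\<in>Basis. fun_scale (f b) (coord b)) \<in> D.span (coord ` Basis)"
        by (intro D.span_sum D.span_scale D.span_base) auto
      ultimately show "f \<in> D.span (coord ` Basis)" by (simp add: dual_expand)
    qed
  qed
qed

lemma span_in_A: "module.span (double_scale scale) (in_A ` Basis) = range in_A"
  using module_hom.span_image[OF linear_in_A[folded module_hom_iff_linear], of Basis]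
  by (simp add: span_Basis)

lemma span_in_dual: "module.span (double_scale scale) (in_dual ` coord ` Basis) = in_dual ` dual scale"
  using module_hom.span_image[OF linear_in_dual[folded module_hom_iff_linear], of "coord ` Basis"]
  by (simp add: span_coord)

lemma span_double:
  "module.span (double_scale scale) (in_A ` Basis \<union> in_dual ` coord ` Basis) = double_space scale"
proof -
  interpret D: vector_space "double_scale scale" by (rule vector_space_double)
  show ?thesis
    unfolding D.span_Un span_in_A span_in_dual double_space_eq by auto
qed

text \<open>
  The basis of \<open>A \<oplus> A\<^sup>*\<close> formed by \<open>Basis\<close> and the coordinate functionals has as dual basis the
  same vectors in exchanged order.
\<close>

lemma double_nondegenerate:
  "conformal_nondegenerate (poly_scale (double_scale scale)) (polys_over (double_space scale))
    (extend_form double_form)"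
proof -
  interpret S: symmetric_form "double_scale scale" "double_space scale" double_form
    by (rule symmetric_form_double)
  let ?e = "case_sum in_A (\<lambda>b. in_dual (coord b))"
  let ?e' = "case_sum (\<lambda>b. in_dual (coord b)) in_A"
  show ?thesis
  proof (rule S.conformal_nondegenerate_extend[where I = "Basis <+> Basis" and e = ?e and e' = ?e'])
    show "?e i \<in> double_space scale" "?e' i \<in> double_space scale" for i
      using coord_dual dualI[of 0]
      by (auto simp: double_space_def in_A_def in_dual_def split: sum.split)
    fix v assume "v \<in> double_space scale"
    then obtain x f where v: "v = (x, f)" "f \<in> dual scale"
      by (auto simp: double_space_def)
    have sA: "(\<Sum>b\<in>J. double_scale scale (c b) (in_A b)) = in_A (\<Sum>b\<in>J. scale (c b) b)" for J c
      using linear_in_A by (induction J rule: infinite_finite_induct) (simp_all add: in_A_simps Vector_Spaces.linear_iff)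
    have sD: "(\<Sum>b\<in>J. double_scale scale (c b) (in_dual (coord b)))
        = in_dual (\<Sum>b\<in>J. fun_scale (c b) (coord b))" for J c
      using linear_in_dual
      by (induction J rule: infinite_finite_induct) (simp_all add: in_dual_simps Vector_Spaces.linear_iff)
    have "double_form (in_dual (coord b)) v = coord b x" "double_form (in_A b) v = f b" for b
      using v dualD(3)[OF coord_dual] by (simp_all add: double_form_def in_A_def in_dual_def dualD)
    then have "(\<Sum>i\<in>Basis <+> Basis. double_scale scale (double_form (?e' i) v) (?e i))
        = in_A (\<Sum>b\<in>Basis. scale (coord b x) b) + in_dual (\<Sum>b\<in>Basis. fun_scale (f b) (coord b))"
      by (simp add: sum.Plus finite_Basis sA sD)
    also have "\<dots> = v"
      using v by (simp add: sum_coord dual_expand) (simp add: in_A_def in_dual_def)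
    finally show "v = (\<Sum>i\<in>Basis <+> Basis. double_scale scale (double_form (?e' i) v) (?e i))" ..
  qed
qed

end


section \<open>Manin triples\<close>

theorem proposition4p17:
  fixes s :: "'k::field_char_0 \<Rightarrow> 'a::ab_group_add \<Rightarrow> 'a"
    and Basis :: "'a set"
    and circ\<^sub>A br\<^sub>A :: "'a \<Rightarrow> 'a \<Rightarrow> 'a"
    and circ\<^sub>D br\<^sub>D :: "('a \<Rightarrow> 'k) \<Rightarrow> ('a \<Rightarrow> 'k) \<Rightarrow> ('a \<Rightarrow> 'k)"
  assumes "finite_dimensional_vector_space s Basis"
    and "gd_algebra s UNIV circ\<^sub>A br\<^sub>A"
    and "gd_algebra fun_scale (dual s) circ\<^sub>D br\<^sub>D"
  shows "(\<exists>lb. conformal_manin_triple (poly_scale (double_scale s)) lb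
              (extend_form double_form)
              (polys_over (double_space s))
              (map_poly in_A ` polys_over UNIV)
              (map_poly in_dual ` polys_over (dual s)) \<and>
            preserves_bracket in_A (polys_over UNIV) (gd_bracket circ\<^sub>A br\<^sub>A) lb \<and>
            preserves_bracket in_dual (polys_over (dual s)) (gd_bracket circ\<^sub>D br\<^sub>D) lb)
     \<longleftrightarrow> (\<exists>circ br. gd_manin_triple s circ br circ\<^sub>A br\<^sub>A circ\<^sub>D br\<^sub>D)"
proof -
  interpret finite_dimensional_vector_space s Basis by fact
  interpret A: gd_algebra s UNIV circ\<^sub>A br\<^sub>A by fact
  interpret D: gd_algebra fun_scale "dual s" circ\<^sub>D br\<^sub>D by fact
  interpret S: symmetric_form "double_scale s" "double_space s" double_form
    by (rule symmetric_form_double)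
  let ?V = "double_space s" and ?A = "range in_A :: ('a \<times> ('a \<Rightarrow> 'k)) set"
    and ?D = "in_dual ` dual s"
  have R\<^sub>0: "map_poly in_A ` polys_over UNIV = polys_over ?A"
    using inj_in_A by (intro map_poly_image_polys_over) (auto simp: in_A_simps)
  have zero_D: "0 \<in> dual s" by (rule D.subspace_0[OF subspace_dual])
  have R\<^sub>1: "map_poly in_dual ` polys_over (dual s) = polys_over ?D"
    using inj_in_dual zero_D by (intro map_poly_image_polys_over) (auto simp: in_dual_simps)
  have sub: "?A \<subseteq> ?V" "?D \<subseteq> ?V"
    using zero_D by (auto simp: double_space_def in_A_def in_dual_def)
  have int: "?A \<inter> ?D = {0}"
    using zero_D by (auto simp: in_A_def in_dual_def zero_prod_def image_iff)
  have two: "(2 :: 'k) \<noteq> 0"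
    by simp
  show ?thesis
  proof (intro iffI; elim exE conjE)
    fix lb
    assume triple: "conformal_manin_triple (poly_scale (double_scale s)) lb (extend_form double_form)
        (polys_over ?V) (map_poly in_A ` polys_over UNIV) (map_poly in_dual ` polys_over (dual s))"
      and pres_A: "preserves_bracket in_A (polys_over UNIV) (gd_bracket circ\<^sub>A br\<^sub>A) lb"
      and pres_D: "preserves_bracket in_dual (polys_over (dual s)) (gd_bracket circ\<^sub>D br\<^sub>D) lb"
    have lca: "lie_conformal_algebra (poly_scale (double_scale s)) (polys_over ?V) lb"
      and inv: "conformal_invariant (poly_scale (double_scale s)) (polys_over ?V) lb (extend_form double_form)"
      using triple by (auto simp: conformal_manin_triple_def finite_lie_conformal_algebra_def)
    have lb_A: "lb [:in_A a:] [:in_A b:]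
        = [: [:in_A (br\<^sub>A a b), in_A (circ\<^sub>A b a):], [:in_A (star circ\<^sub>A a b):] :]" for a b
      using pres_A[unfolded preserves_bracket_def, rule_format, of "[:a:]" "[:b:]"]
        sesquilinear_bracket.lb_const[OF A.sesquilinear, of a b]
      by (simp add: map_poly_pCons in_A_simps gd_bracket_base_def)
    have lb_D: "lb [:in_dual f:] [:in_dual g:]
        = [: [:in_dual (br\<^sub>D f g), in_dual (circ\<^sub>D g f):], [:in_dual (star circ\<^sub>D f g):] :]"
      if "f \<in> dual s" "g \<in> dual s" for f g
      using pres_D[unfolded preserves_bracket_def, rule_format, of "[:f:]" "[:g:]"] that zero_D
        sesquilinear_bracket.lb_const[OF D.sesquilinear, of f g]
      by (simp add: map_poly_pCons in_dual_simps gd_bracket_base_def)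
    have low: "degree_le_one (lb [:x:] [:y:])" if "x \<in> ?V" "y \<in> ?V" for x y
    proof (rule S.degree_le_one_bracket[OF lca inv sub(1) in_A_orthogonal subspace_in_A _ sub(2)
          in_dual_orthogonal subspace_in_dual _ int _ that])
      show "degree_le_one (lb [:a:] [:b:])" if "a \<in> ?A" "b \<in> ?A" for a b
        using that by (auto simp: lb_A intro: degree_le_one_pCons)
      show "degree_le_one (lb [:a:] [:b:])" if "a \<in> ?D" "b \<in> ?D" for a b
        using that by (auto simp: lb_D intro: degree_le_one_pCons)
      show "\<exists>a\<in>?A. \<exists>b\<in>?D. v = a + b" if "v \<in> ?V" for v
        using that unfolding double_space_eq by blast
    qed
    define circ where "circ = (\<lambda>x y. coeff (coeff (lb [:y:] [:x:]) 0) 1)"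
    define br where "br = (\<lambda>x y. coeff (coeff (lb [:x:] [:y:]) 0) 0)"
    have sesq: "sesquilinear_bracket ?V circ br lb" "bilinear_on (double_scale s) (double_scale s) ?V circ"
      "bilinear_on (double_scale s) (double_scale s) ?V br"
      unfolding circ_def br_def
      by (rule S.sesquilinear_if_degree_le_one[OF subspace_double lca low]; assumption)+
    have "gd_algebra (double_scale s) ?V circ br"
      by (rule S.gd_algebra_if_lie_conformal_algebra[OF subspace_double lca sesq]) (rule two)
    moreover have "gd_invariant ?V circ br double_form"
      using inv conformal_invariant_iff[OF symmetric_form_double sesq(1)] by simp
    ultimately have "gd_manin_triple s circ br circ\<^sub>A br\<^sub>A circ\<^sub>D br\<^sub>D"
      using assms(2,3) by (simp add: gd_manin_triple_def circ_def br_def lb_A lb_D)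
    then show "\<exists>circ br. gd_manin_triple s circ br circ\<^sub>A br\<^sub>A circ\<^sub>D br\<^sub>D" by blast
  next
    fix circ br
    assume triple: "gd_manin_triple s circ br circ\<^sub>A br\<^sub>A circ\<^sub>D br\<^sub>D"
    then interpret G: gd_algebra "double_scale s" ?V circ br
      by (simp add: gd_manin_triple_def)
    have on_A: "circ (in_A a) (in_A b) = in_A (circ\<^sub>A a b)" "br (in_A a) (in_A b) = in_A (br\<^sub>A a b)" for a b
      using triple by (auto simp: gd_manin_triple_def)
    have on_D: "circ (in_dual f) (in_dual g) = in_dual (circ\<^sub>D f g)"
      "br (in_dual f) (in_dual g) = in_dual (br\<^sub>D f g)" if "f \<in> dual s" "g \<in> dual s" for f g
      using triple that by (auto simp: gd_manin_triple_def)
    interpret GA: gd_algebra "double_scale s" ?A circ br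
      by (rule G.gd_subalgebra[OF subspace_in_A sub(1)]) (auto simp: on_A)
    interpret GD: gd_algebra "double_scale s" ?D circ br
      by (rule G.gd_subalgebra[OF subspace_in_dual sub(2)])
        (auto simp: on_D D.circ_closed D.lie.br_closed)
    let ?lb = "gd_bracket circ br"
    have fin: "finite_lie_conformal_algebra (poly_scale (double_scale s)) (polys_over ?V) ?lb"
      "finite_lie_conformal_algebra (poly_scale (double_scale s)) (polys_over ?A) ?lb"
      "finite_lie_conformal_algebra (poly_scale (double_scale s)) (polys_over ?D) ?lb"
      by (rule G.finite_lie_conformal_algebra[OF _ span_double]
          GA.finite_lie_conformal_algebra[OF _ span_in_A]
          GD.finite_lie_conformal_algebra[OF _ span_in_dual]; simp add: finite_Basis)+
    have "conformal_manin_triple (poly_scale (double_scale s)) ?lb (extend_form double_form)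
        (polys_over ?V) (polys_over ?A) (polys_over ?D)"
      unfolding conformal_manin_triple_def
    proof (intro conjI fin ballI)
      show "polys_over ?A \<subseteq> polys_over ?V" "polys_over ?D \<subseteq> polys_over ?V"
        using sub by (auto simp: polys_over_def)
      show "polys_over ?V = {x + y | x y. x \<in> polys_over ?A \<and> y \<in> polys_over ?D}"
        using subspace_in_A subspace_in_dual
        by (intro polys_over_direct_sum S.subspace_0 S.subspace_add double_space_eq)
      show "polys_over ?A \<inter> polys_over ?D = {0}"
      proof -
        have "p = 0" if "p \<in> polys_over ?A" "p \<in> polys_over ?D" for p
          using that int by (intro poly_eqI) (auto simp: polys_over_def)
        then show ?thesis
          using S.subspace_0[OF subspace_in_A] S.subspace_0[OF subspace_in_dual] by auto
      qed
      show "conformal_form (poly_scale (double_scale s)) (polys_over ?V) (extend_form double_form)"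
        by (rule S.conformal_form_extend)
      show "conformal_nondegenerate (poly_scale (double_scale s)) (polys_over ?V) (extend_form double_form)"
        by (rule double_nondegenerate)
      show "conformal_invariant (poly_scale (double_scale s)) (polys_over ?V) ?lb (extend_form double_form)"
        using triple unfolding conformal_invariant_iff[OF symmetric_form_double G.sesquilinear]
        by (simp add: gd_manin_triple_def)
      show "conformal_symmetric (polys_over ?V) (extend_form double_form)"
        by (rule S.conformal_symmetric_extend)
      show "extend_form double_form x y = 0" if "x \<in> polys_over ?A" "y \<in> polys_over ?A" for x y
        using that by (rule extend_form_isotropic) (auto simp: double_form_def in_A_def)
      show "extend_form double_form x y = 0" if "x \<in> polys_over ?D" "y \<in> polys_over ?D" for x y
        using that by (rule extend_form_isotropic) (auto simp: double_form_def in_dual_def dualD)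
    qed
    moreover have "preserves_bracket in_A (polys_over UNIV) (gd_bracket circ\<^sub>A br\<^sub>A) ?lb"
      unfolding preserves_bracket_def
      by (intro ballI bracket_transfer[OF A.sesquilinear G.sesquilinear additive_in_A additive_in_A additive_in_A])
        (use sub(1) in \<open>auto simp: on_A\<close>)
    moreover have "preserves_bracket in_dual (polys_over (dual s)) (gd_bracket circ\<^sub>D br\<^sub>D) ?lb"
      unfolding preserves_bracket_def
      by (intro ballI bracket_transfer[OF D.sesquilinear G.sesquilinear additive_in_dual additive_in_dual
          additive_in_dual])
        (use sub(2) in \<open>auto simp: on_D\<close>)
    ultimately show "\<exists>lb. conformal_manin_triple (poly_scale (double_scale s)) lb (extend_form double_form)
        (polys_over ?V) (map_poly in_A ` polys_over UNIV) (map_poly in_dual ` polys_over (dual s)) \<and>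
        preserves_bracket in_A (polys_over UNIV) (gd_bracket circ\<^sub>A br\<^sub>A) lb \<and>
        preserves_bracket in_dual (polys_over (dual s)) (gd_bracket circ\<^sub>D br\<^sub>D) lb"
      unfolding R\<^sub>0 R\<^sub>1 by blast
  qed
qed

end
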